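(* Let $p=2m$ be a positive even integer. Let $(\mathcal M,\tau)$ and $(\mathcal N,\widetilde\tau)$ be von Neumann algebras equipped with normal faithful finite normalized traces. Let $E\subset L_p(\mathcal M,\tau)$ be a linear subspace and let $u:E\to L_p(\mathcal N,\widetilde\tau)$ be a linear map. Assume that for all $x\in M_m(E)$, $$\|1_m\otimes 1_{\mathcal M}+x\|_{2m}=\|1_m\otimes 1_{\mathcal N}+(\mathrm{id}\otimes u)(x)\|_{2m}.$$ Then for every $n\in\mathbb N$ and every $x\in M_n(E)$, $$\|1_n\otimes 1_{\mathcal M}+x\|_{2m}=\|1_n\otimes 1_{\mathcal N}+(\mathrm{id}\otimes u)(x)\|_{2m}.$$
   Context: Traces are normalized: $\tau(1)=1$, $\widetilde\tau(1)=1$. $L_p(\mathcal M,\tau)$ is the noncommutative $L_p$-space with norm $\|x\|_p=\tau(|x|^p)^{1/p}$. $M_n$ is the algebra of complex $n\times n$ matrices with unit $1_n$ and normalized trace $\mathrm{tr}_n=\frac1n\mathrm{Tr}$; $M_n(E)=M_n\otimes E$, and the $p$-norm on $M_n\otimes L_p(\mathcal M,\tau)$ is taken with respect to $\mathrm{tr}_n\otimes\tau$ (similarly for $\mathcal N$). $\mathrm{id}\otimes u$ is the entrywise extension of $u$ to matrices. *)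

theory Defs
  imports "HOL-Analysis.Analysis"
begin

section \<open>Complex Hilbert spaces\<close>

text \<open>The inner product is conjugate linear in the first and linear in the second argument.
  Positive definiteness is contained in the axiom \<open>cinner_self\<close>.\<close>

class complex_hilbert_space = banach +
  fixes scaleC :: "complex \<Rightarrow> 'a \<Rightarrow> 'a" (infixr \<open>*\<^sub>C\<close> 75)
    and cinner :: "'a \<Rightarrow> 'a \<Rightarrow> complex"
  assumes scaleC_of_real: "complex_of_real r *\<^sub>C x = r *\<^sub>R x"
    and scaleC_scaleC: "a *\<^sub>C b *\<^sub>C x = (a * b) *\<^sub>C x"
    and scaleC_add_left: "(a + b) *\<^sub>C x = a *\<^sub>C x + b *\<^sub>C x"
    and scaleC_add_right: "a *\<^sub>C (x + y) = a *\<^sub>C x + a *\<^sub>C y"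
    and cinner_commute: "cinner x y = cnj (cinner y x)"
    and cinner_add_right: "cinner x (y + z) = cinner x y + cinner x z"
    and cinner_scaleC_right: "cinner x (a *\<^sub>C y) = a * cinner x y"
    and cinner_self: "cinner x x = complex_of_real ((norm x)\<^sup>2)"

lemma norm_scaleC: "norm (a *\<^sub>C x) = cmod a * norm (x :: 'a :: complex_hilbert_space)"
proof -
  have "cinner (a *\<^sub>C x) (a *\<^sub>C x) = a * cnj (cinner x (a *\<^sub>C x))"
    by (metis cinner_scaleC_right cinner_commute)
  also have "\<dots> = a * cnj a * cinner x x"
    by (simp add: cinner_scaleC_right cinner_self)
  also have "\<dots> = complex_of_real ((cmod a * norm x)\<^sup>2)"
    by (simp only: cinner_self power_mult_distrib complex_norm_square of_real_mult)
  finally have "(norm (a *\<^sub>C x))\<^sup>2 = (cmod a * norm x)\<^sup>2"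
    unfolding cinner_self of_real_eq_iff .
  then show ?thesis
    by simp
qed

instantiation complex :: complex_hilbert_space
begin
definition "scaleC_complex (a :: complex) (x :: complex) = a * x"
definition "cinner_complex (x :: complex) (y :: complex) = cnj x * y"
instance
proof
  fix x :: complex
  show "cinner x x = complex_of_real ((norm x)\<^sup>2)"
    by (simp only: cinner_complex_def complex_norm_square mult.commute)
qed (auto simp: scaleC_complex_def cinner_complex_def algebra_simps scaleR_conv_of_real)
end

text \<open>The Hilbert space direct sum of \<open>CARD('n)\<close> copies of \<open>'a\<close>; the library norm on
  \<open>'a ^ 'n\<close> is the \<open>\<ell>\<^sub>2\<close> norm of the norms of the components.\<close>

instantiation vec :: (complex_hilbert_space, finite) complex_hilbert_space
begin
definition "scaleC_vec a (x :: 'a ^ 'b) = (\<chi> i. a *\<^sub>C x $ i)"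
definition "cinner_vec (x :: 'a ^ 'b) (y :: 'a ^ 'b) = (\<Sum>i\<in>UNIV. cinner (x $ i) (y $ i))"
instance
proof
  fix x y :: "'a ^ 'b"
  show "cinner x y = cnj (cinner y x)"
    by (simp add: cinner_vec_def cinner_commute[symmetric])
  show "cinner x x = complex_of_real ((norm x)\<^sup>2)"
    by (simp add: cinner_vec_def norm_vec_def L2_set_def cinner_self sum_nonneg)
qed (auto simp: scaleC_vec_def cinner_vec_def vec_eq_iff scaleC_of_real scaleC_scaleC
       scaleC_add_left scaleC_add_right cinner_add_right cinner_scaleC_right sum.distrib
       sum_distrib_left)
end


section \<open>Bounded operators\<close>

text \<open>The type \<open>'a \<Rightarrow>\<^sub>L 'a\<close> consists of the bounded \<^emph>\<open>real\<close>-linear maps; the bounded operators of a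
  complex Hilbert space are the complex-linear ones among them.\<close>

definition bop :: "('a :: complex_hilbert_space \<Rightarrow>\<^sub>L 'a) set" where
  "bop = {T. \<forall>c x. blinfun_apply T (c *\<^sub>C x) = c *\<^sub>C blinfun_apply T x}"

definition scale_op ::
    "complex \<Rightarrow> ('a :: complex_hilbert_space \<Rightarrow>\<^sub>L 'a) \<Rightarrow> ('a \<Rightarrow>\<^sub>L 'a)" where
  "scale_op c T = Blinfun (\<lambda>x. c *\<^sub>C blinfun_apply T x)"

lemma scale_op_apply: "blinfun_apply (scale_op c T) x = c *\<^sub>C blinfun_apply T x"
proof -
  have "bounded_linear (\<lambda>x. c *\<^sub>C (x :: 'a))"
  proof (rule bounded_linear_intro)
    fix r and x :: 'a
    show "c *\<^sub>C r *\<^sub>R x = r *\<^sub>R c *\<^sub>C x"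
      by (simp add: scaleC_of_real[symmetric] scaleC_scaleC mult.commute)
    show "norm (c *\<^sub>C x) \<le> norm x * cmod c"
      by (simp add: norm_scaleC)
  qed (rule scaleC_add_right)
  then show ?thesis
    unfolding scale_op_def
    by (subst bounded_linear_Blinfun_apply)
       (auto intro: bounded_linear_compose blinfun.bounded_linear_right)
qed

definition adj :: "('a :: complex_hilbert_space \<Rightarrow>\<^sub>L 'a) \<Rightarrow> ('a \<Rightarrow>\<^sub>L 'a)" where
  "adj T = (THE S. \<forall>x y. cinner (blinfun_apply S x) y = cinner x (blinfun_apply T y))"

definition pos_op :: "('a :: complex_hilbert_space \<Rightarrow>\<^sub>L 'a) \<Rightarrow> bool" where
  "pos_op T \<longleftrightarrow> T \<in> bop \<and> (\<forall>x. cinner x (blinfun_apply T x) \<in> \<real>\<^sub>\<ge>\<^sub>0)"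

text \<open>\<open>op_abs T\<close> is \<open>\<bar>T\<bar> = (T\<^sup>* T)\<^bsup>1/2\<^esup>\<close>.\<close>

definition op_abs :: "('a :: complex_hilbert_space \<Rightarrow>\<^sub>L 'a) \<Rightarrow> ('a \<Rightarrow>\<^sub>L 'a)" where
  "op_abs T = (THE S. pos_op S \<and> S o\<^sub>L S = adj T o\<^sub>L T)"

definition op_power :: "('a :: complex_hilbert_space \<Rightarrow>\<^sub>L 'a) \<Rightarrow> nat \<Rightarrow> ('a \<Rightarrow>\<^sub>L 'a)" where
  "op_power T k = ((\<lambda>S. T o\<^sub>L S) ^^ k) id_blinfun"


section \<open>Von Neumann algebras and traces\<close>

definition commutant ::
    "('a :: complex_hilbert_space \<Rightarrow>\<^sub>L 'a) set \<Rightarrow> ('a \<Rightarrow>\<^sub>L 'a) set" where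
  "commutant S = {T \<in> bop. \<forall>A\<in>S. T o\<^sub>L A = A o\<^sub>L T}"

definition von_neumann_algebra :: "('a :: complex_hilbert_space \<Rightarrow>\<^sub>L 'a) set \<Rightarrow> bool" where
  "von_neumann_algebra M \<longleftrightarrow>
     M \<subseteq> bop \<and> (\<forall>T\<in>M. adj T \<in> M) \<and> commutant (commutant M) = M"

text \<open>A set \<open>D\<close> of positive elements directed upwards with supremum \<open>A\<close> in \<open>M\<close>; \<open>S \<le> T\<close> means
  that \<open>T - S\<close> is positive.\<close>

definition directed_to ::
    "('a :: complex_hilbert_space \<Rightarrow>\<^sub>L 'a) set \<Rightarrow> ('a \<Rightarrow>\<^sub>L 'a) set \<Rightarrow> ('a \<Rightarrow>\<^sub>L 'a) \<Rightarrow> bool" where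
  "directed_to M D A \<longleftrightarrow>
     D \<noteq> {} \<and> D \<subseteq> {T \<in> M. pos_op T} \<and>
     (\<forall>S\<in>D. \<forall>T\<in>D. \<exists>R\<in>D. pos_op (R - S) \<and> pos_op (R - T)) \<and>
     A \<in> M \<and> (\<forall>T\<in>D. pos_op (A - T)) \<and>
     (\<forall>B\<in>M. (\<forall>T\<in>D. pos_op (B - T)) \<longrightarrow> pos_op (B - A))"

text \<open>A normal faithful finite normalized trace on \<open>M\<close>, as a linear functional on \<open>M\<close>.
  Its values outside \<open>M\<close> are irrelevant.\<close>

definition normal_faithful_trace ::
    "('a :: complex_hilbert_space \<Rightarrow>\<^sub>L 'a) set \<Rightarrow> (('a \<Rightarrow>\<^sub>L 'a) \<Rightarrow> complex) \<Rightarrow> bool" where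
  "normal_faithful_trace M \<tau> \<longleftrightarrow>
     (\<forall>S\<in>M. \<forall>T\<in>M. \<tau> (S + T) = \<tau> S + \<tau> T) \<and>
     (\<forall>c. \<forall>T\<in>M. \<tau> (scale_op c T) = c * \<tau> T) \<and>
     (\<forall>T\<in>M. pos_op T \<longrightarrow> \<tau> T \<in> \<real>\<^sub>\<ge>\<^sub>0) \<and>
     (\<forall>S\<in>M. \<forall>T\<in>M. \<tau> (S o\<^sub>L T) = \<tau> (T o\<^sub>L S)) \<and>
     (\<forall>T\<in>M. pos_op T \<and> \<tau> T = 0 \<longrightarrow> T = 0) \<and>
     (\<forall>D A. directed_to M D A \<longrightarrow> Re (\<tau> A) = (SUP T\<in>D. Re (\<tau> T))) \<and>
     \<tau> id_blinfun = 1"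


section \<open>Noncommutative \<open>L\<^sub>p\<close>-spaces\<close>

text \<open>\<open>L\<^sub>p(M,\<tau>)\<close> is the completion of \<open>M\<close> for the norm \<open>\<tau>(\<bar>T\<bar>\<^sup>p)\<^bsup>1/p\<^esup>\<close>, realized as the set of
  classes of Cauchy sequences modulo null sequences. Only integral exponents \<open>p\<close> are needed.\<close>

definition op_lp_norm ::
    "(('a :: complex_hilbert_space \<Rightarrow>\<^sub>L 'a) \<Rightarrow> complex) \<Rightarrow> nat \<Rightarrow> ('a \<Rightarrow>\<^sub>L 'a) \<Rightarrow> real" where
  "op_lp_norm \<tau> p T = root p (Re (\<tau> (op_power (op_abs T) p)))"

type_synonym 'a lp_elem = "(nat \<Rightarrow> 'a \<Rightarrow>\<^sub>L 'a) set"

context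
  fixes M :: "('a :: complex_hilbert_space \<Rightarrow>\<^sub>L 'a) set"
    and \<tau> :: "('a \<Rightarrow>\<^sub>L 'a) \<Rightarrow> complex"
    and p :: nat
begin

definition lp_cauchy :: "(nat \<Rightarrow> 'a \<Rightarrow>\<^sub>L 'a) set" where
  "lp_cauchy = {X. (\<forall>k. X k \<in> M) \<and>
     (\<forall>e>0. \<exists>N. \<forall>i\<ge>N. \<forall>j\<ge>N. op_lp_norm \<tau> p (X i - X j) < e)}"

definition lp_rel :: "((nat \<Rightarrow> 'a \<Rightarrow>\<^sub>L 'a) \<times> (nat \<Rightarrow> 'a \<Rightarrow>\<^sub>L 'a)) set" where
  "lp_rel = {(X, Y). X \<in> lp_cauchy \<and> Y \<in> lp_cauchy \<and>
     (\<lambda>k. op_lp_norm \<tau> p (X k - Y k)) \<longlonglongrightarrow> 0}"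

definition lp_space :: "'a lp_elem set" where
  "lp_space = lp_cauchy // lp_rel"

definition lp_embed :: "('a \<Rightarrow>\<^sub>L 'a) \<Rightarrow> 'a lp_elem" where
  "lp_embed T = lp_rel `` {\<lambda>_. T}"

definition lp_add :: "'a lp_elem \<Rightarrow> 'a lp_elem \<Rightarrow> 'a lp_elem" where
  "lp_add x y = lp_rel `` {(\<lambda>k. X k + Y k) | X Y. X \<in> x \<and> Y \<in> y}"

definition lp_scale :: "complex \<Rightarrow> 'a lp_elem \<Rightarrow> 'a lp_elem" where
  "lp_scale c x = lp_rel `` {(\<lambda>k. scale_op c (X k)) | X. X \<in> x}"

definition lp_norm :: "'a lp_elem \<Rightarrow> real" where
  "lp_norm x = (THE r. \<forall>X\<in>x. (\<lambda>k. op_lp_norm \<tau> p (X k)) \<longlonglongrightarrow> r)"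

definition lp_subspace :: "'a lp_elem set \<Rightarrow> bool" where
  "lp_subspace E \<longleftrightarrow> E \<subseteq> lp_space \<and> lp_embed 0 \<in> E \<and>
     (\<forall>x\<in>E. \<forall>y\<in>E. lp_add x y \<in> E) \<and> (\<forall>c. \<forall>x\<in>E. lp_scale c x \<in> E)"

end

definition lp_linear_map ::
    "('a :: complex_hilbert_space \<Rightarrow>\<^sub>L 'a) set \<Rightarrow> (('a \<Rightarrow>\<^sub>L 'a) \<Rightarrow> complex) \<Rightarrow>
     ('b :: complex_hilbert_space \<Rightarrow>\<^sub>L 'b) set \<Rightarrow> (('b \<Rightarrow>\<^sub>L 'b) \<Rightarrow> complex) \<Rightarrow> nat \<Rightarrow>
     'a lp_elem set \<Rightarrow> ('a lp_elem \<Rightarrow> 'b lp_elem) \<Rightarrow> bool" where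
  "lp_linear_map M \<tau> N \<sigma> p E u \<longleftrightarrow>
     (\<forall>x\<in>E. u x \<in> lp_space N \<sigma> p) \<and>
     (\<forall>x\<in>E. \<forall>y\<in>E. u (lp_add M \<tau> p x y) = lp_add N \<sigma> p (u x) (u y)) \<and>
     (\<forall>c. \<forall>x\<in>E. u (lp_scale M \<tau> p c x) = lp_scale N \<sigma> p c (u x))"


section \<open>Matrix amplifications\<close>

definition entry ::
    "(('a :: complex_hilbert_space ^ 'n) \<Rightarrow>\<^sub>L ('a ^ 'n)) \<Rightarrow> 'n \<Rightarrow> 'n \<Rightarrow> ('a \<Rightarrow>\<^sub>L 'a)" where
  "entry X i j = Blinfun (\<lambda>v. blinfun_apply X (axis j v) $ i)"

lemma entry_apply: "blinfun_apply (entry X i j) v = blinfun_apply X (axis j v) $ i"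
proof -
  have "bounded_linear (\<lambda>v :: 'a. (axis j v :: 'a ^ 'b))"
  proof (rule bounded_linear_intro[where K = 1])
    fix v :: 'a
    have "norm (axis j v :: 'a ^ 'b) \<le> (\<Sum>i\<in>UNIV. norm ((axis j v :: 'a ^ 'b) $ i))"
      by (simp add: norm_vec_def L2_set_le_sum)
    also have "\<dots> = (\<Sum>i\<in>UNIV. if i = j then norm v else 0)"
      by (rule sum.cong) (auto simp: axis_def)
    finally show "norm (axis j v :: 'a ^ 'b) \<le> norm v * 1"
      by simp
  qed (auto simp: axis_def vec_eq_iff)
  then have "bounded_linear (\<lambda>v. blinfun_apply X (axis j v) $ i)"
    by (intro bounded_linear_compose[OF bounded_linear_vec_nth]
          bounded_linear_compose[OF blinfun.bounded_linear_right])
  then show ?thesis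
    unfolding entry_def by (simp add: bounded_linear_Blinfun_apply)
qed

text \<open>The von Neumann algebra \<open>M\<^sub>n \<otimes> M\<close> of operator matrices with entries in \<open>M\<close>, acting on
  \<open>'a ^ 'n\<close>, and the normalized trace \<open>tr\<^sub>n \<otimes> \<tau>\<close> on it.\<close>

definition mat_algebra ::
    "('a :: complex_hilbert_space \<Rightarrow>\<^sub>L 'a) set \<Rightarrow> (('a ^ 'n) \<Rightarrow>\<^sub>L ('a ^ 'n)) set" where
  "mat_algebra M = {X \<in> bop. \<forall>i j. entry X i j \<in> M}"

definition mat_trace ::
    "(('a :: complex_hilbert_space \<Rightarrow>\<^sub>L 'a) \<Rightarrow> complex) \<Rightarrow> (('a ^ 'n) \<Rightarrow>\<^sub>L ('a ^ 'n)) \<Rightarrow> complex" where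
  "mat_trace \<tau> X = (\<Sum>i\<in>UNIV. \<tau> (entry X i i)) / of_nat CARD('n)"

text \<open>The identification of \<open>M\<^sub>n(L\<^sub>p(M,\<tau>))\<close> with \<open>L\<^sub>p(M\<^sub>n \<otimes> M, tr\<^sub>n \<otimes> \<tau>)\<close>: a matrix \<open>x\<close> with entries
  in \<open>L\<^sub>p(M,\<tau>)\<close> is the class of all Cauchy sequences in \<open>M\<^sub>n \<otimes> M\<close> whose \<open>(i,j)\<close> entries
  represent \<open>x $ i $ j\<close>.\<close>

definition lp_of_matrix ::
    "('a :: complex_hilbert_space \<Rightarrow>\<^sub>L 'a) set \<Rightarrow> (('a \<Rightarrow>\<^sub>L 'a) \<Rightarrow> complex) \<Rightarrow> nat \<Rightarrow>
     'a lp_elem ^ 'n ^ 'n \<Rightarrow> ('a ^ 'n) lp_elem" where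
  "lp_of_matrix M \<tau> p x =
     {X \<in> lp_cauchy (mat_algebra M) (mat_trace \<tau>) p. \<forall>i j. (\<lambda>k. entry (X k) i j) \<in> x $ i $ j}"

definition mat_lp_norm ::
    "('a :: complex_hilbert_space \<Rightarrow>\<^sub>L 'a) set \<Rightarrow> (('a \<Rightarrow>\<^sub>L 'a) \<Rightarrow> complex) \<Rightarrow> nat \<Rightarrow>
     'a lp_elem ^ 'n ^ 'n \<Rightarrow> real" where
  "mat_lp_norm M \<tau> p x = lp_norm (mat_trace \<tau>) p (lp_of_matrix M \<tau> p x)"

text \<open>The unit \<open>1\<^sub>n \<otimes> 1\<^sub>M\<close> of \<open>M\<^sub>n(L\<^sub>p(M,\<tau>))\<close>.\<close>

definition mat_lp_one ::
    "('a :: complex_hilbert_space \<Rightarrow>\<^sub>L 'a) set \<Rightarrow> (('a \<Rightarrow>\<^sub>L 'a) \<Rightarrow> complex) \<Rightarrow> nat \<Rightarrow>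
     'a lp_elem ^ 'n ^ 'n" where
  "mat_lp_one M \<tau> p = (\<chi> i j. lp_embed M \<tau> p (if i = j then id_blinfun else 0))"

definition mat_lp_add ::
    "('a :: complex_hilbert_space \<Rightarrow>\<^sub>L 'a) set \<Rightarrow> (('a \<Rightarrow>\<^sub>L 'a) \<Rightarrow> complex) \<Rightarrow> nat \<Rightarrow>
     'a lp_elem ^ 'n ^ 'n \<Rightarrow> 'a lp_elem ^ 'n ^ 'n \<Rightarrow> 'a lp_elem ^ 'n ^ 'n" where
  "mat_lp_add M \<tau> p x y = (\<chi> i j. lp_add M \<tau> p (x $ i $ j) (y $ i $ j))"

definition mat_over :: "'e set \<Rightarrow> ('e ^ 'n ^ 'n) set" where
  "mat_over E = {x. \<forall>i j. x $ i $ j \<in> E}"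

definition mat_map :: "('e \<Rightarrow> 'f) \<Rightarrow> 'e ^ 'n ^ 'n \<Rightarrow> 'f ^ 'n ^ 'n" where
  "mat_map u x = (\<chi> i j. u (x $ i $ j))"

end

theory Submission
  imports Defs
begin

text \<open>
  Let \<open>F\<^sub>n(x)\<close> be the \<open>2m\<close>-th power of the norm of \<open>1 + x\<close> for \<open>x \<in> M\<^sub>n(E)\<close>. It is the trace of
  \<open>(1 + x) (1 + x)\<^sup>* (1 + x) \<dots>\<close> with \<open>2m\<close> factors. Written out in matrix entries, it is a sum, over closed
  walks on \<open>n\<close> vertices, of traces \<open>\<tau>(w)\<close> of words \<open>w\<close> with \<open>2m\<close> positions, alternately plain and starred,
  each position carrying either the unit or an element of \<open>E\<close>. The weights in this sum do not depend on
  the algebra. So if \<open>\<tau>(w)\<close> does not change when \<open>u\<close> is applied to the letters of \<open>w\<close>, for all words \<open>w\<close>,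
  then \<open>F\<^sub>n(x)\<close> does not change either, whatever \<open>n\<close> is (\<open>moments_agree_all_sizes\<close>).

  The point is that matrices of size \<open>m\<close> already see every such word (\<open>word_traces_agree\<close>). Deleting the
  units leaves \<open>d \<le> 2m\<close> letters \<open>x\<^sub>0, \<dots>, x\<^sub>d\<^sub>-\<^sub>1\<close>. Put them on the edges of the closed walk
  \<open>0 \<rightarrow> 0 \<rightarrow> 1 \<rightarrow> 1 \<rightarrow> 2 \<rightarrow> \<dots> \<rightarrow> 0\<close> of length \<open>d\<close>, which has at most \<open>m\<close> vertices: take
  \<open>x = \<Sum>\<^sub>l t\<^sub>l e\<^sub>l \<otimes> x\<^sub>l\<close> with \<open>e\<^sub>l\<close> the matrix unit of the edge \<open>l\<close>, transposed if the letter is starred.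
  In the polynomial \<open>F\<^sub>m(x)\<close> of the variables \<open>t\<^sub>l\<close> and their conjugates, consider the coefficient of the
  monomial that contains each \<open>t\<^sub>l\<close> once, conjugated if the letter is starred. Only closed walks that use
  every edge once contribute to it. The staircase has a unique Eulerian circuit
  (\<open>staircase_euler_circuit\<close>), the same idea as in the proof that \<open>M\<^sub>m\<close> satisfies no polynomial identity
  of degree less than \<open>2m\<close>; hence all contributions are cyclic rotations of the given word and have the
  same trace. The coefficient is thus a positive multiple of \<open>\<tau>(w)\<close>, and it is computed from finitely many
  values of \<open>F\<^sub>m\<close> (\<open>staircase_extraction\<close>).

  All of this happens for bounded operators. Elements of \<open>L\<^sub>2\<^sub>m\<close> are limits of sequences of those, and the
  argument is applied to representing sequences; for this the \<open>2m\<close>-norm must be shown to be a norm and to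
  be given by the moment \<open>\<tau>((T\<^sup>* T)\<^sup>m)\<close>. The first rests on Hoelder's inequality for words, obtained by
  reflection positivity (\<open>trace_word_le_one\<close>), the second on existence and uniqueness of positive square
  roots (\<open>op_abs_square\<close>).
\<close>

section \<open>Inner products and adjoints\<close>

lemma cinner_add_left: "cinner (x + y) z = cinner x z + cinner y (z :: 'a :: complex_hilbert_space)"
  by (metis cinner_add_right cinner_commute complex_cnj_add)

lemma cinner_scaleC_left: "cinner (a *\<^sub>C x) y = cnj a * cinner x (y :: 'a :: complex_hilbert_space)"
  by (metis cinner_commute cinner_scaleC_right complex_cnj_mult)

lemma cinner_scaleR_right: "cinner x (r *\<^sub>R y) = of_real r * cinner x (y :: 'a :: complex_hilbert_space)"
  by (metis cinner_scaleC_right scaleC_of_real)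

lemma cinner_scaleR_left: "cinner (r *\<^sub>R x) y = of_real r * cinner x (y :: 'a :: complex_hilbert_space)"
  by (metis cinner_scaleC_left scaleC_of_real complex_cnj_complex_of_real)

lemma cinner_minus_right: "cinner x (- y) = - cinner x (y :: 'a :: complex_hilbert_space)"
  using cinner_scaleR_right[of x "-1" y] by simp

lemma cinner_minus_left: "cinner (- x) y = - cinner x (y :: 'a :: complex_hilbert_space)"
  using cinner_scaleR_left[of "-1" x y] by simp

lemma cinner_diff_right: "cinner x (y - z) = cinner x y - cinner x (z :: 'a :: complex_hilbert_space)"
  using cinner_add_right[of x y "- z"] by (simp add: cinner_minus_right)

lemma cinner_diff_left: "cinner (x - y) z = cinner x z - cinner y (z :: 'a :: complex_hilbert_space)"
  using cinner_add_left[of x "- y" z] by (simp add: cinner_minus_left)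

lemma cinner_zero_right [simp]: "cinner x (0 :: 'a :: complex_hilbert_space) = 0"
  using cinner_diff_right[of x 0 0] by simp

lemma cinner_zero_left [simp]: "cinner 0 (x :: 'a :: complex_hilbert_space) = 0"
  using cinner_diff_left[of 0 0 x] by simp

lemmas cinner_simps = cinner_add_left cinner_add_right cinner_diff_left cinner_diff_right
  cinner_scaleC_left cinner_scaleC_right cinner_scaleR_left cinner_scaleR_right
  cinner_minus_left cinner_minus_right

lemma norm_squared_cinner: "(norm (x :: 'a :: complex_hilbert_space))\<^sup>2 = Re (cinner x x)"
  by (simp add: cinner_self)

lemma scaleC_one [simp]: "1 *\<^sub>C (x :: 'a :: complex_hilbert_space) = x"
  using scaleC_of_real[of 1 x] by simp

lemma scaleC_zero_right [simp]: "c *\<^sub>C (0 :: 'a :: complex_hilbert_space) = 0"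
  using scaleC_add_right[of c 0 0] by simp

lemma scaleC_zero_left [simp]: "0 *\<^sub>C (x :: 'a :: complex_hilbert_space) = 0"
  using scaleC_of_real[of 0 x] by simp

lemma scaleC_minus_right: "c *\<^sub>C (- x) = - (c *\<^sub>C (x :: 'a :: complex_hilbert_space))"
  using scaleC_add_right[of c x "- x"] by (simp add: add_eq_0_iff2)

lemma scaleC_diff_right: "c *\<^sub>C (x - y) = c *\<^sub>C x - c *\<^sub>C (y :: 'a :: complex_hilbert_space)"
  using scaleC_add_right[of c x "- y"] by (simp add: scaleC_minus_right)

lemma scaleC_scaleR: "c *\<^sub>C (r *\<^sub>R x) = r *\<^sub>R (c *\<^sub>C (x :: 'a :: complex_hilbert_space))"
  by (simp add: scaleC_of_real[symmetric] scaleC_scaleC mult.commute)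

lemma scaleC_sum_right: "c *\<^sub>C (\<Sum>i\<in>I. f i) = (\<Sum>i\<in>I. c *\<^sub>C (f i :: 'a :: complex_hilbert_space))"
  by (induction I rule: infinite_finite_induct) (simp_all add: scaleC_add_right)

text \<open>The discriminant argument behind every Cauchy--Schwarz inequality below; it is used for the
  inner product, for the form of a positive operator and for the form of a trace.\<close>

lemma quadratic_form_discriminant:
  fixes \<beta> :: complex
  assumes nonneg: "\<And>c. 0 \<le> \<alpha> + 2 * Re (c * \<beta>) + (cmod c)\<^sup>2 * \<gamma>" and "\<gamma> \<ge> 0"
  shows "(cmod \<beta>)\<^sup>2 \<le> \<alpha> * \<gamma>"
proof (cases "\<gamma> = 0")
  case False
  then have g: "\<gamma> > 0" using assms(2) by simp
  have eq: "cnj \<beta> * \<beta> = complex_of_real ((cmod \<beta>)\<^sup>2)"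
    by (simp only: complex_norm_square mult.commute)
  have "0 \<le> \<alpha> + 2 * Re ((- cnj \<beta> / of_real \<gamma>) * \<beta>) + (cmod (- cnj \<beta> / of_real \<gamma>))\<^sup>2 * \<gamma>"
    by (rule nonneg)
  also have "(- cnj \<beta> / of_real \<gamma>) * \<beta> = of_real (- ((cmod \<beta>)\<^sup>2 / \<gamma>))"
    using eq by (simp add: field_simps)
  also have "(cmod (- cnj \<beta> / of_real \<gamma>))\<^sup>2 * \<gamma> = (cmod \<beta>)\<^sup>2 / \<gamma>"
    using g by (simp add: norm_divide power_divide power2_eq_square)
  finally have "(cmod \<beta>)\<^sup>2 / \<gamma> \<le> \<alpha>"
    by (simp only: Re_complex_of_real)
  then show ?thesis using g by (simp add: field_simps)
next
  case True
  have eq: "cnj \<beta> * \<beta> = complex_of_real ((cmod \<beta>)\<^sup>2)"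
    by (simp only: complex_norm_square mult.commute)
  have *: "2 * s * (cmod \<beta>)\<^sup>2 \<le> \<alpha>" for s :: real
  proof -
    have "(- of_real s * cnj \<beta>) * \<beta> = of_real (- (s * (cmod \<beta>)\<^sup>2))"
      using eq by (simp add: mult.assoc)
    then show ?thesis
      using nonneg[of "- of_real s * cnj \<beta>"] True by (simp only: Re_complex_of_real)
  qed
  have "cmod \<beta> = 0"
  proof (rule ccontr)
    assume "cmod \<beta> \<noteq> 0"
    then show False
      using *[of "(\<alpha> + 1) / (2 * (cmod \<beta>)\<^sup>2)"] by simp
  qed
  then show ?thesis using True by simp
qed

lemma cinner_cauchy_schwarz: "cmod (cinner x y) \<le> norm x * norm (y :: 'a :: complex_hilbert_space)"
proof -
  have "(cmod (cinner x y))\<^sup>2 \<le> (norm x)\<^sup>2 * (norm y)\<^sup>2"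
  proof (rule quadratic_form_discriminant)
    fix c
    have "0 \<le> (norm (x + c *\<^sub>C y))\<^sup>2" by simp
    also have "\<dots> = Re (cinner x x) + Re (c * cinner x y) + Re (cnj c * cinner y x)
        + Re (cnj c * c * cinner y y)"
      by (simp add: norm_squared_cinner cinner_simps algebra_simps)
    also have "cnj c * cinner y x = cnj (c * cinner x y)"
      by (simp add: cinner_commute[of y x])
    also have "cnj c * c * cinner y y = complex_of_real ((cmod c)\<^sup>2 * (norm y)\<^sup>2)"
      by (simp only: cinner_self complex_norm_square mult.commute of_real_mult)
    finally show "0 \<le> (norm x)\<^sup>2 + 2 * Re (c * cinner x y) + (cmod c)\<^sup>2 * (norm y)\<^sup>2"
      by (simp only: Re_complex_of_real) (simp add: norm_squared_cinner)
  qed simp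
  then show ?thesis
    by (metis norm_ge_zero mult_nonneg_nonneg power_mult_distrib power2_le_imp_le)
qed

lemma bounded_linear_cinner_right: "bounded_linear (cinner (x :: 'a :: complex_hilbert_space))"
  by (rule bounded_linear_intro[where K = "norm x"])
     (auto simp: cinner_simps scaleR_conv_of_real mult.commute[of _ "norm x"] cinner_cauchy_schwarz)

lemma tendsto_cinner_right:
  "(f \<longlongrightarrow> y) F \<Longrightarrow> ((\<lambda>k. cinner x (f k)) \<longlongrightarrow> cinner x (y :: 'a :: complex_hilbert_space)) F"
  by (rule bounded_linear.tendsto[OF bounded_linear_cinner_right])

lemma tendsto_cinner_left:
  assumes "(f \<longlongrightarrow> x) F"
  shows "((\<lambda>k. cinner (f k) y) \<longlongrightarrow> cinner x (y :: 'a :: complex_hilbert_space)) F"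
proof -
  have "((\<lambda>k. cnj (cinner y (f k))) \<longlongrightarrow> cnj (cinner y x)) F"
    by (intro tendsto_intros tendsto_cinner_right assms)
  then show ?thesis by (simp add: cinner_commute[symmetric])
qed

lemma cinner_eqI:
  assumes "\<And>z. cinner x z = cinner y (z :: 'a :: complex_hilbert_space)"
  shows "x = y"
proof -
  have "cinner (x - y) (x - y) = 0" by (simp add: cinner_diff_left assms)
  then show ?thesis by (simp add: cinner_self)
qed

lemma parallelogram:
  fixes x y :: "'a :: complex_hilbert_space"
  shows "(norm (x + y))\<^sup>2 + (norm (x - y))\<^sup>2 = 2 * (norm x)\<^sup>2 + 2 * (norm y)\<^sup>2"
  by (simp add: norm_squared_cinner cinner_simps)

text \<open>The Riesz representation: the energy \<open>\<parallel>x\<parallel>\<^sup>2 - 2 Re f(x)\<close> is bounded below, minimizing sequences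
  are Cauchy by the parallelogram law, and the vanishing of the first variation at a minimizer is
  the representation.\<close>

lemma riesz_representation:
  fixes f :: "'a :: complex_hilbert_space \<Rightarrow> complex"
  assumes lin: "bounded_linear f" and cl: "\<And>c x. f (c *\<^sub>C x) = c * f x"
  shows "\<exists>z. \<forall>x. f x = cinner z x"
proof -
  interpret bounded_linear f by (rule lin)
  obtain K where K: "\<And>x. norm (f x) \<le> norm x * K" "K > 0" using pos_bounded by blast
  define J where "J x = (norm x)\<^sup>2 - 2 * Re (f x)" for x
  have J_low: "J x \<ge> - K\<^sup>2" for x
  proof -
    have "Re (f x) \<le> norm x * K" using K(1)[of x] complex_Re_le_cmod[of "f x"] by linarith
    moreover have "0 \<le> (norm x - K)\<^sup>2" by simp
    ultimately show ?thesis by (simp add: J_def power2_diff)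
  qed
  then have bdd: "bdd_below (range J)" by (intro bdd_belowI2[where m = "- K\<^sup>2"])
  define I where "I = Inf (range J)"
  have I_le: "I \<le> J x" for x unfolding I_def by (rule cInf_lower[OF _ bdd]) simp
  have "\<exists>x. J x < I + inverse (real (Suc k))" for k
    using cInf_lessD[of "range J" "I + inverse (real (Suc k))"] unfolding I_def by fastforce
  then obtain X where X: "\<And>k. J (X k) < I + inverse (real (Suc k))" by metis
  have mid: "(norm (x - y))\<^sup>2 \<le> 2 * (J x - I) + 2 * (J y - I)" for x y
  proof -
    have "J ((1/2) *\<^sub>R (x + y)) = (norm (x + y))\<^sup>2 / 4 - Re (f x) - Re (f y)"
    proof -
      have "(norm ((1/2) *\<^sub>R (x + y)))\<^sup>2 = (norm (x + y))\<^sup>2 / 4"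
        by (simp only: norm_scaleR power_mult_distrib) (simp add: power_divide)
      moreover have "Re (f ((1/2) *\<^sub>R (x + y))) = (Re (f x) + Re (f y)) / 2"
        by (simp only: scaleR add) simp
      ultimately show ?thesis unfolding J_def by argo
    qed
    then show ?thesis
      using I_le[of "(1/2) *\<^sub>R (x + y)"] parallelogram[of x y] by (simp add: J_def field_simps)
  qed
  have "Cauchy X"
  proof (rule metric_CauchyI)
    fix e :: real assume e: "e > 0"
    obtain n where n: "inverse (real (Suc n)) < e\<^sup>2 / 4"
      using reals_Archimedean[of "e\<^sup>2/4"] e by auto
    show "\<exists>M. \<forall>i\<ge>M. \<forall>j\<ge>M. dist (X i) (X j) < e"
    proof (intro exI allI impI)
      fix i j assume ij: "n \<le> i" "n \<le> j"
      have "inverse (real (Suc i)) \<le> inverse (real (Suc n))" "inverse (real (Suc j)) \<le> inverse (real (Suc n))"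
        using ij by (auto simp: field_simps)
      then have "(norm (X i - X j))\<^sup>2 < e\<^sup>2"
        using mid[of "X i" "X j"] X[of i] X[of j] n by argo
      then show "dist (X i) (X j) < e"
        using e by (metis dist_norm less_imp_le norm_ge_zero power2_less_imp_less)
    qed
  qed
  then obtain z where z: "X \<longlonglongrightarrow> z" using Cauchy_convergent_iff convergent_def by blast
  have "(\<lambda>k. J (X k)) \<longlonglongrightarrow> J z"
    unfolding J_def by (intro tendsto_intros z tendsto)
  moreover have "(\<lambda>k. I + inverse (real (Suc k))) \<longlonglongrightarrow> I + 0"
    by (intro tendsto_intros LIMSEQ_inverse_real_of_nat)
  ultimately have Jz: "J z \<le> I"
    using LIMSEQ_le X less_imp_le by (metis (no_types, lifting) add.right_neutral)
  have re: "Re (f v) = Re (cinner z v)" for v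
  proof -
    have key: "0 \<le> 2 * t * (Re (cinner z v) - Re (f v)) + t\<^sup>2 * (norm v)\<^sup>2" for t
    proof -
      have "Re (cinner v z) = Re (cinner z v)" by (subst cinner_commute) simp
      then have "J (z + t *\<^sub>R v) = J z + 2 * t * (Re (cinner z v) - Re (f v)) + t\<^sup>2 * (norm v)\<^sup>2"
        unfolding J_def norm_squared_cinner
        by (simp add: cinner_simps add scaleR power2_eq_square algebra_simps)
      then show ?thesis using I_le[of "z + t *\<^sub>R v"] Jz by linarith
    qed
    have "(cmod (of_real (Re (cinner z v) - Re (f v))))\<^sup>2 \<le> 0 * (norm v)\<^sup>2"
    proof (rule quadratic_form_discriminant)
      fix c :: complex
      have "(Re c)\<^sup>2 * (norm v)\<^sup>2 \<le> (cmod c)\<^sup>2 * (norm v)\<^sup>2"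
        by (intro mult_right_mono) (auto simp: cmod_power2)
      then show "0 \<le> 0 + 2 * Re (c * of_real (Re (cinner z v) - Re (f v))) + (cmod c)\<^sup>2 * (norm v)\<^sup>2"
        using key[of "Re c"] by (simp add: algebra_simps)
    qed simp
    then show ?thesis by simp
  qed
  have "f v = cinner z v" for v
  proof (rule complex_eqI)
    have "Re (\<i> * f v) = Re (\<i> * cinner z v)"
      using re[of "\<i> *\<^sub>C v"] by (simp add: cl cinner_simps)
    then show "Im (f v) = Im (cinner z v)" by simp
  qed (rule re)
  then show ?thesis by blast
qed

lemma bop_scaleC: "T \<in> bop \<Longrightarrow> blinfun_apply T (c *\<^sub>C x) = c *\<^sub>C blinfun_apply T x"
  by (simp add: bop_def)

lemma adjoint_exists:
  assumes T: "T \<in> bop"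
  shows "\<exists>S. \<forall>x y. cinner (blinfun_apply S x) y = cinner x (blinfun_apply T y)"
proof -
  have "\<exists>z. \<forall>y. cinner x (blinfun_apply T y) = cinner z y" for x
    by (rule riesz_representation)
       (auto intro: bounded_linear_compose[OF bounded_linear_cinner_right] blinfun.bounded_linear_right
         simp: bop_scaleC[OF T] cinner_simps)
  then obtain s where s: "\<And>x y. cinner x (blinfun_apply T y) = cinner (s x) y" by metis
  have "bounded_linear s"
  proof (rule bounded_linear_intro[where K = "norm T"])
    show "s (x + y) = s x + s y" for x y
      by (rule cinner_eqI) (simp add: s[symmetric] cinner_simps)
    show "s (r *\<^sub>R x) = r *\<^sub>R s x" for r x
      by (rule cinner_eqI) (simp add: s[symmetric] cinner_simps)
    fix x
    have "(norm (s x))\<^sup>2 = cmod (cinner x (blinfun_apply T (s x)))"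
      unfolding s cinner_self by (simp only: norm_of_real abs_power2 norm_ge_zero abs_of_nonneg)
    also have "\<dots> \<le> norm x * (norm T * norm (s x))"
      by (intro order_trans[OF cinner_cauchy_schwarz] mult_left_mono norm_blinfun) simp
    finally have "norm (s x) * norm (s x) \<le> (norm x * norm T) * norm (s x)"
      by (simp add: power2_eq_square mult.assoc)
    then show "norm (s x) \<le> norm x * norm T"
      by (cases "norm (s x) = 0") (auto simp: mult_le_cancel_right)
  qed
  then have "\<forall>x y. cinner (blinfun_apply (Blinfun s) x) y = cinner x (blinfun_apply T y)"
    by (simp add: bounded_linear_Blinfun_apply s)
  then show ?thesis by blast
qed

lemma adjI:
  assumes "\<And>x y. cinner (blinfun_apply S x) y = cinner x (blinfun_apply T y)"
  shows "adj T = S"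
  unfolding adj_def
proof (rule the_equality)
  fix R assume R: "\<forall>x y. cinner (blinfun_apply R x) y = cinner x (blinfun_apply T y)"
  show "R = S"
    by (rule blinfun_eqI, rule cinner_eqI) (simp add: R assms)
qed (use assms in blast)

lemma cinner_adj_left:
  assumes "T \<in> bop"
  shows "cinner (blinfun_apply (adj T) x) y = cinner x (blinfun_apply T y)"
proof -
  obtain S where "\<And>x y. cinner (blinfun_apply S x) y = cinner x (blinfun_apply T y)"
    using adjoint_exists[OF assms] by blast
  then show ?thesis using adjI[of S T] by simp
qed

lemma cinner_adj_right:
  assumes "T \<in> bop"
  shows "cinner x (blinfun_apply (adj T) y) = cinner (blinfun_apply T x) y"
  by (metis assms cinner_adj_left cinner_commute)

lemma bop_id [simp]: "id_blinfun \<in> bop" by (simp add: bop_def)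
lemma bop_zero [simp]: "0 \<in> bop" by (simp add: bop_def)
lemma bop_add: "S \<in> bop \<Longrightarrow> T \<in> bop \<Longrightarrow> S + T \<in> bop"
  by (simp add: bop_def blinfun.add_left scaleC_add_right)
lemma bop_diff: "S \<in> bop \<Longrightarrow> T \<in> bop \<Longrightarrow> S - T \<in> bop"
  by (simp add: bop_def blinfun.diff_left scaleC_diff_right)
lemma bop_compose: "S \<in> bop \<Longrightarrow> T \<in> bop \<Longrightarrow> S o\<^sub>L T \<in> bop"
  by (simp add: bop_def)
lemma bop_scaleR: "T \<in> bop \<Longrightarrow> r *\<^sub>R T \<in> bop"
  by (simp add: bop_def blinfun.scaleR_left scaleC_scaleR)
lemma bop_scale_op: "T \<in> bop \<Longrightarrow> scale_op c T \<in> bop"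
  by (simp add: bop_def scale_op_apply scaleC_scaleC mult.commute)

lemma bop_adj:
  assumes "T \<in> bop"
  shows "adj T \<in> bop"
proof -
  have "blinfun_apply (adj T) (c *\<^sub>C x) = c *\<^sub>C blinfun_apply (adj T) x" for c x
    by (rule cinner_eqI) (simp add: cinner_adj_left[OF assms] cinner_scaleC_left)
  then show ?thesis by (simp add: bop_def)
qed

lemma adj_id [simp]: "adj id_blinfun = id_blinfun"
  by (rule adjI) simp

lemma adj_add: "S \<in> bop \<Longrightarrow> T \<in> bop \<Longrightarrow> adj (S + T) = adj S + adj T"
  by (rule adjI) (simp add: blinfun.add_left cinner_simps cinner_adj_left)

lemma adj_scale_op: "T \<in> bop \<Longrightarrow> adj (scale_op c T) = scale_op (cnj c) (adj T)"
  by (rule adjI) (simp add: scale_op_apply cinner_simps cinner_adj_left)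

lemma adj_compose: "S \<in> bop \<Longrightarrow> T \<in> bop \<Longrightarrow> adj (S o\<^sub>L T) = adj T o\<^sub>L adj S"
  by (rule adjI) (simp add: cinner_adj_left)

lemma adj_adj: "T \<in> bop \<Longrightarrow> adj (adj T) = T"
  by (rule adjI) (simp add: cinner_adj_right)

lemma scale_op_of_real: "scale_op (of_real r) T = r *\<^sub>R T"
  by (rule blinfun_eqI) (simp add: scale_op_apply scaleC_of_real blinfun.scaleR_left)

lemma scale_op_one [simp]: "scale_op 1 T = T"
  by (rule blinfun_eqI) (simp add: scale_op_apply)

lemma scale_op_zero [simp]: "scale_op 0 T = 0"
  by (rule blinfun_eqI) (simp add: scale_op_apply)

lemma scale_op_scale_op: "scale_op a (scale_op b T) = scale_op (a * b) T"
  by (rule blinfun_eqI) (simp add: scale_op_apply scaleC_scaleC)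

lemma scale_op_add_right: "scale_op c (S + T) = scale_op c S + scale_op c T"
  by (rule blinfun_eqI) (simp add: scale_op_apply scaleC_add_right blinfun.add_left)

lemma scale_op_diff_right: "scale_op c (S - T) = scale_op c S - scale_op c T"
  by (rule blinfun_eqI) (simp add: scale_op_apply scaleC_diff_right blinfun.diff_left)

lemma compose_scale_op_left: "scale_op c S o\<^sub>L T = scale_op c (S o\<^sub>L T)"
  by (rule blinfun_eqI) (simp add: scale_op_apply)

lemma compose_scale_op_right: "S \<in> bop \<Longrightarrow> S o\<^sub>L scale_op c T = scale_op c (S o\<^sub>L T)"
  by (rule blinfun_eqI) (simp add: scale_op_apply bop_scaleC)

lemma compose_assoc: "(R o\<^sub>L S) o\<^sub>L T = R o\<^sub>L (S o\<^sub>L T)"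
  by (rule blinfun_eqI) simp

lemma compose_id_left [simp]: "id_blinfun o\<^sub>L T = T"
  by (rule blinfun_eqI) simp

lemma compose_id_right [simp]: "T o\<^sub>L id_blinfun = T"
  by (rule blinfun_eqI) simp

lemmas compose_add_left = bounded_bilinear.add_left[OF bounded_bilinear_blinfun_compose]
lemmas compose_add_right = bounded_bilinear.add_right[OF bounded_bilinear_blinfun_compose]
lemmas compose_diff_left = bounded_bilinear.diff_left[OF bounded_bilinear_blinfun_compose]
lemmas compose_diff_right = bounded_bilinear.diff_right[OF bounded_bilinear_blinfun_compose]
lemmas compose_sum_left = bounded_bilinear.sum_left[OF bounded_bilinear_blinfun_compose]
lemmas compose_sum_right = bounded_bilinear.sum_right[OF bounded_bilinear_blinfun_compose]
lemmas compose_scaleR_left = bounded_bilinear.scaleR_left[OF bounded_bilinear_blinfun_compose]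
lemmas compose_scaleR_right = bounded_bilinear.scaleR_right[OF bounded_bilinear_blinfun_compose]

section \<open>Positive operators and the modulus\<close>

text \<open>Polarization: the sesquilinear form \<open>\<langle>x, S y\<rangle> - \<langle>S x, y\<rangle>\<close> vanishes on the diagonal.\<close>

lemma pos_op_symmetric:
  assumes "pos_op S"
  shows "cinner (blinfun_apply S x) y = cinner x (blinfun_apply S y)"
proof -
  have S: "S \<in> bop" and pos: "\<And>x. cinner x (blinfun_apply S x) \<in> \<real>\<^sub>\<ge>\<^sub>0"
    using assms by (auto simp: pos_op_def)
  define f where "f x y = cinner x (blinfun_apply S y) - cinner (blinfun_apply S x) y" for x y
  have diag: "f x x = 0" for x
  proof -
    have "cinner x (blinfun_apply S x) = cnj (cinner x (blinfun_apply S x))"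
      using pos[of x] by (auto simp: nonneg_Reals_def)
    then show ?thesis by (simp add: f_def cinner_commute[of "blinfun_apply S x"])
  qed
  have "f (x + y) (x + y) = f x x + f x y + f y x + f y y"
    by (simp add: f_def blinfun.add_right cinner_simps)
  then have 1: "f x y + f y x = 0" by (simp add: diag)
  have "f (x + \<i> *\<^sub>C y) (x + \<i> *\<^sub>C y) = f x x + \<i> * f x y - \<i> * f y x + f y y"
    by (simp add: f_def blinfun.add_right bop_scaleC[OF S] cinner_simps algebra_simps)
  then have "\<i> * (f x y - f y x) = 0" by (simp add: diag algebra_simps)
  then have "f x y = f y x" by simp
  with 1 have "f x y = 0" by simp
  then show ?thesis by (simp add: f_def)
qed

lemma pos_op_cauchy_schwarz:
  assumes "pos_op S"
  shows "(cmod (cinner x (blinfun_apply S y)))\<^sup>2 \<le>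
    Re (cinner x (blinfun_apply S x)) * Re (cinner y (blinfun_apply S y))"
proof (rule quadratic_form_discriminant)
  have S: "S \<in> bop" and pos: "\<And>x. 0 \<le> Re (cinner x (blinfun_apply S x))"
    and real: "\<And>x. cinner x (blinfun_apply S x) = of_real (Re (cinner x (blinfun_apply S x)))"
    using assms by (auto simp: pos_op_def nonneg_Reals_def) (metis Re_complex_of_real)+
  show "0 \<le> Re (cinner y (blinfun_apply S y))" by (rule pos)
  fix c
  have "0 \<le> Re (cinner (x + c *\<^sub>C y) (blinfun_apply S (x + c *\<^sub>C y)))" by (rule pos)
  also have "\<dots> = Re (cinner x (blinfun_apply S x)) + Re (c * cinner x (blinfun_apply S y))
      + Re (cnj c * cinner y (blinfun_apply S x)) + Re (cnj c * c * cinner y (blinfun_apply S y))"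
    by (simp add: blinfun.add_right bop_scaleC[OF S] cinner_simps algebra_simps)
  also have "cnj c * cinner y (blinfun_apply S x) = cnj (c * cinner x (blinfun_apply S y))"
    by (simp add: cinner_commute[of y] pos_op_symmetric[OF assms])
  also have "cnj c * c * cinner y (blinfun_apply S y) =
      of_real ((cmod c)\<^sup>2 * Re (cinner y (blinfun_apply S y)))"
    by (subst real) (simp only: complex_norm_square mult.commute of_real_mult)
  finally show "0 \<le> Re (cinner x (blinfun_apply S x)) + 2 * Re (c * cinner x (blinfun_apply S y))
      + (cmod c)\<^sup>2 * Re (cinner y (blinfun_apply S y))"
    by (simp only: Re_complex_of_real) simp
qed

lemma pos_op_kernel:
  assumes "pos_op S" "cinner x (blinfun_apply S x) = 0"
  shows "blinfun_apply S x = 0"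
  using pos_op_cauchy_schwarz[OF assms(1), of "blinfun_apply S x" x] assms(2)
  by (simp add: cinner_self)

lemma pos_op_contraction:
  assumes R: "pos_op R" and le: "\<And>x. Re (cinner x (blinfun_apply R x)) \<le> (norm x)\<^sup>2"
  shows "norm R \<le> 1"
proof (rule norm_blinfun_bound)
  fix x
  let ?n = "norm (blinfun_apply R x)"
  have "(?n\<^sup>2)\<^sup>2 \<le> ?n\<^sup>2 * (norm x)\<^sup>2"
  proof -
    have "(?n\<^sup>2)\<^sup>2 = (cmod (cinner (blinfun_apply R x) (blinfun_apply R x)))\<^sup>2"
      by (simp add: cinner_self norm_power)
    also have "\<dots> \<le> Re (cinner (blinfun_apply R x) (blinfun_apply R (blinfun_apply R x)))
        * Re (cinner x (blinfun_apply R x))"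
      by (rule pos_op_cauchy_schwarz[OF R])
    also have "\<dots> \<le> ?n\<^sup>2 * (norm x)\<^sup>2"
      using R by (intro mult_mono le) (auto simp: pos_op_def complex_nonneg_Reals_iff)
    finally show ?thesis .
  qed
  then have "?n\<^sup>2 * ?n\<^sup>2 \<le> ?n\<^sup>2 * (norm x)\<^sup>2" by (simp add: power2_eq_square)
  then have "?n\<^sup>2 \<le> (norm x)\<^sup>2 \<or> ?n = 0"
    by (metis mult_le_cancel_left_pos zero_less_power2)
  then show "?n \<le> 1 * norm x"
    by (auto intro: power2_le_imp_le)
qed simp

text \<open>The square root of \<open>P\<close>, for \<open>0 \<le> P \<le> 1\<close>, is \<open>1 - Z\<close> where \<open>Z\<close> is the limit of the iteration
  \<open>Z \<mapsto> (R + Z\<^sup>2) / 2\<close> started at \<open>0\<close>, with \<open>R = 1 - P\<close>. The iterates are dominated in norm by the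
  scalar iteration with \<open>R\<close> replaced by \<open>1\<close>, which increases and stays below \<open>1\<close>. The limit
  commutes with whatever commutes with \<open>P\<close>; uniqueness of the root will rest on this.\<close>

lemma contraction_quadratic_fixpoint:
  fixes R :: "'a :: complex_hilbert_space \<Rightarrow>\<^sub>L 'a"
  assumes R: "pos_op R" and nR: "norm R \<le> 1"
  shows "\<exists>Z. Z \<in> bop \<and> norm Z \<le> 1 \<and> (\<forall>x y. cinner (blinfun_apply Z x) y = cinner x (blinfun_apply Z y))
    \<and> Z = (1/2) *\<^sub>R (R + (Z o\<^sub>L Z)) \<and> (\<forall>C. C o\<^sub>L R = R o\<^sub>L C \<longrightarrow> C o\<^sub>L Z = Z o\<^sub>L C)"
proof -
  define Y where "Y n = ((\<lambda>Z. (1/2) *\<^sub>R (R + (Z o\<^sub>L Z))) ^^ n) 0" for n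
  define y :: "nat \<Rightarrow> real" where "y n = ((\<lambda>z. (1 + z\<^sup>2) / 2) ^^ n) 0" for n
  have Y0: "Y 0 = 0" and YS: "\<And>n. Y (Suc n) = (1/2) *\<^sub>R (R + (Y n o\<^sub>L Y n))"
    by (simp_all add: Y_def)
  have y0: "y 0 = 0" and yS: "\<And>n. y (Suc n) = (1 + (y n)\<^sup>2) / 2"
    by (simp_all add: y_def)
  have y_bounds: "0 \<le> y n \<and> y n \<le> 1" for n
    by (induction n) (auto simp: y0 yS power_le_one)
  have y_mono: "y n \<le> y (Suc n)" for n
  proof -
    have "0 \<le> (1 - y n)\<^sup>2" by simp
    then show ?thesis by (simp add: yS power2_diff)
  qed
  have nY: "norm (Y n) \<le> y n" for n
  proof (induction n)
    case (Suc n)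
    have "norm (Y (Suc n)) \<le> (norm R + norm (Y n) * norm (Y n)) / 2"
      using norm_triangle_ineq[of R "Y n o\<^sub>L Y n"] norm_blinfun_compose[of "Y n" "Y n"]
      by (simp add: YS)
    also have "\<dots> \<le> (1 + y n * y n) / 2"
      using Suc nR y_bounds[of n] by (intro divide_right_mono add_mono mult_mono) auto
    finally show ?case by (simp add: yS power2_eq_square)
  qed (simp add: Y0 y0)
  have step: "norm (Y (Suc n) - Y n) \<le> y (Suc n) - y n" for n
  proof (induction n)
    case (Suc n)
    have "Y (Suc (Suc n)) - Y (Suc n) =
        (1/2) *\<^sub>R ((Y (Suc n) o\<^sub>L (Y (Suc n) - Y n)) + ((Y (Suc n) - Y n) o\<^sub>L Y n))"
      by (subst (1) YS, subst (2) YS)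
         (simp add: compose_diff_left compose_diff_right scaleR_diff_right scaleR_add_right)
    then have "norm (Y (Suc (Suc n)) - Y (Suc n)) \<le>
        (norm (Y (Suc n)) * norm (Y (Suc n) - Y n) + norm (Y (Suc n) - Y n) * norm (Y n)) / 2"
      using norm_triangle_ineq[of "Y (Suc n) o\<^sub>L (Y (Suc n) - Y n)" "(Y (Suc n) - Y n) o\<^sub>L Y n"]
        norm_blinfun_compose[of "Y (Suc n)" "Y (Suc n) - Y n"]
        norm_blinfun_compose[of "Y (Suc n) - Y n" "Y n"]
      by simp
    also have "\<dots> \<le> (y (Suc n) * (y (Suc n) - y n) + (y (Suc n) - y n) * y n) / 2"
      using Suc nY[of n] nY[of "Suc n"] y_bounds[of n] y_bounds[of "Suc n"] y_mono[of n]
      by (intro divide_right_mono add_mono mult_mono) auto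
    also have "\<dots> = (1 + (y (Suc n))\<^sup>2) / 2 - (1 + (y n)\<^sup>2) / 2"
      by (simp add: power2_eq_square field_simps)
    also have "\<dots> = y (Suc (Suc n)) - y (Suc n)"
      by (metis yS)
    finally show ?case .
  next
    case 0
    show ?case using nR by (simp add: YS yS Y0 y0)
  qed
  have tail: "norm (Y j - Y i) \<le> y j - y i" if "i \<le> j" for i j
    using that
  proof (induction j rule: dec_induct)
    case (step j)
    then show ?case
      using norm_triangle_ineq[of "Y (Suc j) - Y j" "Y j - Y i"] \<open>\<And>n. norm (Y (Suc n) - Y n) \<le> _ n\<close>[of j]
      by simp
  qed simp
  have "convergent y"
    using y_mono y_bounds
    by (intro Bseq_monoseq_convergent BseqI'[where K = 1])
       (auto simp: monoseq_Suc)
  then have Cy: "Cauchy y" by (simp add: Cauchy_convergent_iff)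
  have "Cauchy Y"
  proof (rule metric_CauchyI)
    fix e :: real assume "e > 0"
    then obtain n where n: "\<And>i j. i \<ge> n \<Longrightarrow> j \<ge> n \<Longrightarrow> dist (y i) (y j) < e"
      using Cy metric_CauchyD by metis
    have "dist (Y i) (Y j) < e" if "i \<ge> n" "j \<ge> n" for i j
    proof (cases "i \<le> j")
      case True
      then show ?thesis using tail[of i j] n[OF that] by (simp add: dist_norm norm_minus_commute)
    next
      case False
      then show ?thesis using tail[of j i] n[OF that] by (simp add: dist_norm)
    qed
    then show "\<exists>M. \<forall>i\<ge>M. \<forall>j\<ge>M. dist (Y i) (Y j) < e" by blast
  qed
  then obtain Z where Z: "Y \<longlonglongrightarrow> Z" using Cauchy_convergent_iff convergent_def by blast
  have app: "(\<lambda>n. blinfun_apply (Y n) x) \<longlonglongrightarrow> blinfun_apply Z x" for x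
    by (intro blinfun.tendsto Z tendsto_const)
  have Rb: "R \<in> bop" using R by (simp add: pos_op_def)
  have Yb: "Y n \<in> bop" for n
    by (induction n) (auto simp: Y0 YS intro!: bop_scaleR bop_add bop_compose Rb)
  have Ysym: "cinner (blinfun_apply (Y n) x) z = cinner x (blinfun_apply (Y n) z)" for n x z
    by (induction n arbitrary: x z)
       (simp_all add: Y0 YS blinfun.scaleR_left blinfun.add_left cinner_simps pos_op_symmetric[OF R])
  have Ycomm: "C o\<^sub>L Y n = Y n o\<^sub>L C" if C: "C o\<^sub>L R = R o\<^sub>L C" for C n
  proof (induction n)
    case (Suc n)
    have "C o\<^sub>L (Y n o\<^sub>L Y n) = (Y n o\<^sub>L Y n) o\<^sub>L C"
      using Suc by (metis compose_assoc)
    then show ?case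
      by (simp add: YS compose_scaleR_left compose_scaleR_right compose_add_left compose_add_right C)
  qed (simp add: Y0)
  have "Z \<in> bop"
  proof -
    have "blinfun_apply Z (c *\<^sub>C x) = c *\<^sub>C blinfun_apply Z x" for c x
    proof (rule LIMSEQ_unique[OF app])
      have "bounded_linear (blinfun_apply (scale_op c id_blinfun))" by (rule blinfun.bounded_linear_right)
      from bounded_linear.tendsto[OF this app[of x]]
      show "(\<lambda>n. blinfun_apply (Y n) (c *\<^sub>C x)) \<longlonglongrightarrow> c *\<^sub>C blinfun_apply Z x"
        by (simp add: scale_op_apply bop_scaleC[OF Yb])
    qed
    then show ?thesis by (simp add: bop_def)
  qed
  moreover have "norm Z \<le> 1"
  proof (rule LIMSEQ_le_const2[OF tendsto_norm[OF Z]])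
    show "\<exists>N. \<forall>n\<ge>N. norm (Y n) \<le> 1" using nY y_bounds order_trans by blast
  qed
  moreover have "cinner (blinfun_apply Z x) z = cinner x (blinfun_apply Z z)" for x z
    using LIMSEQ_unique[OF tendsto_cinner_left[OF app] tendsto_cinner_right[OF app, of x z, folded Ysym]] .
  moreover have "Z = (1/2) *\<^sub>R (R + (Z o\<^sub>L Z))"
  proof (rule LIMSEQ_unique)
    show "(\<lambda>n. Y (Suc n)) \<longlonglongrightarrow> Z" using Z by (rule LIMSEQ_Suc)
    show "(\<lambda>n. Y (Suc n)) \<longlonglongrightarrow> (1/2) *\<^sub>R (R + (Z o\<^sub>L Z))"
      unfolding YS
      by (intro tendsto_intros bounded_bilinear.tendsto[OF bounded_bilinear_blinfun_compose] Z)
  qed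
  moreover have "C o\<^sub>L Z = Z o\<^sub>L C" if C: "C o\<^sub>L R = R o\<^sub>L C" for C
  proof (rule LIMSEQ_unique)
    show "(\<lambda>n. C o\<^sub>L Y n) \<longlonglongrightarrow> (C o\<^sub>L Z)"
      by (intro bounded_bilinear.tendsto[OF bounded_bilinear_blinfun_compose] Z tendsto_const)
    show "(\<lambda>n. C o\<^sub>L Y n) \<longlonglongrightarrow> (Z o\<^sub>L C)"
      unfolding Ycomm[OF C]
      by (intro bounded_bilinear.tendsto[OF bounded_bilinear_blinfun_compose] Z tendsto_const)
  qed
  ultimately show ?thesis by blast
qed

lemma pos_op_sqrt_exists:
  assumes P: "pos_op P"
  shows "\<exists>S. pos_op S \<and> S o\<^sub>L S = P \<and> (\<forall>C. C o\<^sub>L P = P o\<^sub>L C \<longrightarrow> C o\<^sub>L S = S o\<^sub>L C)"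
proof -
  have Pb: "P \<in> bop" and Ppos: "\<And>x. cinner x (blinfun_apply P x) \<in> \<real>\<^sub>\<ge>\<^sub>0"
    using P by (auto simp: pos_op_def)
  define k where "k = norm P + 1"
  have k: "k > 0" by (simp add: k_def add_nonneg_pos)
  define R where "R = id_blinfun - (1/k) *\<^sub>R P"
  have form: "cinner x (blinfun_apply R x) = of_real ((norm x)\<^sup>2 - Re (cinner x (blinfun_apply P x)) / k)" for x
  proof -
    obtain r where "cinner x (blinfun_apply P x) = of_real r" using Ppos[of x] by (auto simp: nonneg_Reals_def)
    then show ?thesis
      by (simp add: R_def blinfun.diff_left blinfun.scaleR_left cinner_simps cinner_self)
  qed
  have Ppos': "0 \<le> Re (cinner x (blinfun_apply P x))" for x
    using Ppos[of x] by (auto simp: nonneg_Reals_def)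
  have low: "0 \<le> (norm x)\<^sup>2 - Re (cinner x (blinfun_apply P x)) / k" for x
  proof -
    have "Re (cinner x (blinfun_apply P x)) \<le> norm x * (norm P * norm x)"
      by (intro order_trans[OF complex_Re_le_cmod] order_trans[OF cinner_cauchy_schwarz]
          mult_left_mono norm_blinfun) simp
    also have "\<dots> \<le> (norm x)\<^sup>2 * k" by (simp add: k_def power2_eq_square algebra_simps)
    finally show ?thesis using k by (simp add: field_simps)
  qed
  have R: "pos_op R"
  proof -
    have "cinner x (blinfun_apply R x) \<in> \<real>\<^sub>\<ge>\<^sub>0" for x
      unfolding form by (simp only: nonneg_Reals_of_real_iff low)
    moreover have "R \<in> bop" by (simp add: R_def bop_diff bop_scaleR Pb)
    ultimately show ?thesis by (simp add: pos_op_def)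
  qed
  have nR: "norm R \<le> 1"
    by (rule pos_op_contraction[OF R]) (use Ppos' k in \<open>simp add: form\<close>)
  obtain Z where Zb: "Z \<in> bop" and nZ: "norm Z \<le> 1"
    and sym: "\<And>x y. cinner (blinfun_apply Z x) y = cinner x (blinfun_apply Z y)"
    and quad: "Z = (1/2) *\<^sub>R (R + (Z o\<^sub>L Z))"
    and comm: "\<And>C. C o\<^sub>L R = R o\<^sub>L C \<Longrightarrow> C o\<^sub>L Z = Z o\<^sub>L C"
    using contraction_quadratic_fixpoint[OF R nR] by blast
  define S where "S = sqrt k *\<^sub>R (id_blinfun - Z)"
  have Sb: "S \<in> bop" by (simp add: S_def bop_scaleR bop_diff Zb)
  have "cinner x (blinfun_apply S x) \<in> \<real>\<^sub>\<ge>\<^sub>0" for x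
  proof -
    have "cinner x (blinfun_apply Z x) = cnj (cinner x (blinfun_apply Z x))"
      by (metis cinner_commute sym)
    then obtain r where r: "cinner x (blinfun_apply Z x) = of_real r"
      by (metis Reals_cnj_iff Reals_cases)
    have "r \<le> norm x * norm (blinfun_apply Z x)"
      using cinner_cauchy_schwarz[of x "blinfun_apply Z x"] r by simp
    also have "\<dots> \<le> norm x * (1 * norm x)"
      using nZ by (intro mult_left_mono order_trans[OF norm_blinfun] mult_right_mono) auto
    finally have "0 \<le> sqrt k * ((norm x)\<^sup>2 - r)" using k by (simp add: power2_eq_square)
    moreover have "cinner x (blinfun_apply S x) = of_real (sqrt k * ((norm x)\<^sup>2 - r))"
      by (simp add: S_def blinfun.diff_left blinfun.scaleR_left cinner_simps cinner_self r)
    ultimately show ?thesis by (simp only: nonneg_Reals_of_real_iff)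
  qed
  then have "pos_op S" using Sb by (simp add: pos_op_def)
  moreover have "S o\<^sub>L S = P"
  proof -
    have "2 *\<^sub>R Z = R + (Z o\<^sub>L Z)" by (subst quad) simp
    then have "(Z o\<^sub>L Z) = Z + Z - R" by (simp add: scaleR_2)
    then have "(id_blinfun - Z) o\<^sub>L (id_blinfun - Z) = (1/k) *\<^sub>R P"
      by (simp add: compose_diff_left compose_diff_right R_def)
    then show ?thesis
      using k by (simp add: S_def compose_scaleR_left compose_scaleR_right real_sqrt_mult_self)
  qed
  moreover have "C o\<^sub>L S = S o\<^sub>L C" if "C o\<^sub>L P = P o\<^sub>L C" for C
  proof -
    have "C o\<^sub>L R = R o\<^sub>L C"
      using that by (simp add: R_def compose_diff_left compose_diff_right compose_scaleR_left compose_scaleR_right)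
    from comm[OF this] show ?thesis
      by (simp add: S_def compose_diff_left compose_diff_right compose_scaleR_left compose_scaleR_right)
  qed
  ultimately show ?thesis by blast
qed

text \<open>With \<open>D\<close> the difference of two commuting positive roots \<open>S\<close> and \<open>S'\<close>, the positive operators
  \<open>D S D\<close> and \<open>D S' D\<close> add up to \<open>D (S\<^sup>2 - S'\<^sup>2) = 0\<close>, so both \<open>S\<close> and \<open>S'\<close> vanish on the range of \<open>D\<close>,
  whence \<open>D\<^sup>2 = 0\<close>, and \<open>D = 0\<close> because \<open>D\<close> is self-adjoint.\<close>

lemma pos_op_sqrt_commuting_unique:
  assumes S: "pos_op S" and S': "pos_op S'" and sq: "S o\<^sub>L S = S' o\<^sub>L S'"
    and comm: "S o\<^sub>L S' = S' o\<^sub>L S"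
  shows "S = S'"
proof (rule blinfun_eqI)
  fix x
  define d where "d = blinfun_apply S x - blinfun_apply S' x"
  have sq': "blinfun_apply S (blinfun_apply S z) = blinfun_apply S' (blinfun_apply S' z)" for z
    using arg_cong[OF sq, of "\<lambda>T. blinfun_apply T z"] by simp
  have comm': "blinfun_apply S (blinfun_apply S' z) = blinfun_apply S' (blinfun_apply S z)" for z
    using arg_cong[OF comm, of "\<lambda>T. blinfun_apply T z"] by simp
  have "blinfun_apply S d + blinfun_apply S' d = 0"
    by (simp add: d_def blinfun.diff_right sq' comm')
  then have "cinner d (blinfun_apply S d) + cinner d (blinfun_apply S' d) = 0"
    by (simp add: cinner_add_right[symmetric])
  moreover have "cinner d (blinfun_apply S d) \<in> \<real>\<^sub>\<ge>\<^sub>0" "cinner d (blinfun_apply S' d) \<in> \<real>\<^sub>\<ge>\<^sub>0"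
    using S S' by (auto simp: pos_op_def)
  ultimately have "cinner d (blinfun_apply S d) = 0" "cinner d (blinfun_apply S' d) = 0"
    by (auto simp: nonneg_Reals_def complex_eq_iff)
  then have z: "blinfun_apply S d = 0" "blinfun_apply S' d = 0"
    using pos_op_kernel S S' by auto
  have "cinner d d = cinner x (blinfun_apply S d - blinfun_apply S' d)"
    by (subst (1) d_def) (simp add: cinner_simps pos_op_symmetric[OF S] pos_op_symmetric[OF S'])
  then have "d = 0" by (simp add: z cinner_self)
  then show "blinfun_apply S x = blinfun_apply S' x" by (simp add: d_def)
qed

lemma pos_op_adj_compose:
  assumes "T \<in> bop"
  shows "pos_op (adj T o\<^sub>L T)"
  unfolding pos_op_def
  by (auto intro!: bop_compose bop_adj assms simp: cinner_adj_right[OF assms] cinner_self)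

text \<open>This is where the definite description in \<open>op_abs\<close> is resolved: the constructed root commutes with
  any other root, since every root commutes with its square.\<close>

lemma op_abs_square:
  assumes T: "T \<in> bop"
  shows "op_abs T o\<^sub>L op_abs T = adj T o\<^sub>L T"
proof -
  obtain S where S: "pos_op S" "S o\<^sub>L S = adj T o\<^sub>L T"
    and comm: "\<And>C. C o\<^sub>L (adj T o\<^sub>L T) = (adj T o\<^sub>L T) o\<^sub>L C \<Longrightarrow> C o\<^sub>L S = S o\<^sub>L C"
    using pos_op_sqrt_exists[OF pos_op_adj_compose[OF T]] by blast
  have "op_abs T = S"
    unfolding op_abs_def
  proof (rule the_equality)
    fix S' assume S': "pos_op S' \<and> S' o\<^sub>L S' = adj T o\<^sub>L T"
    then have "adj T o\<^sub>L T = S' o\<^sub>L S'" by simp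
    then have "S' o\<^sub>L (adj T o\<^sub>L T) = (adj T o\<^sub>L T) o\<^sub>L S'" by (simp only: compose_assoc)
    then have comm': "S' o\<^sub>L S = S o\<^sub>L S'" by (rule comm)
    show "S' = S"
      by (rule pos_op_sqrt_commuting_unique[OF conjunct1[OF S'] S(1) _ comm'])
         (simp only: S(2) conjunct2[OF S'])
  next
    show "pos_op S \<and> S o\<^sub>L S = adj T o\<^sub>L T" using S by blast
  qed
  then show ?thesis using S(2) by (simp only:)
qed

lemma op_power_abs_even:
  assumes "T \<in> bop"
  shows "op_power (op_abs T) (2 * m) = op_power (adj T o\<^sub>L T) m"
proof (induction m)
  case (Suc m)
  have "op_power (op_abs T) (2 * Suc m) = op_abs T o\<^sub>L (op_abs T o\<^sub>L op_power (op_abs T) (2 * m))"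
    by (simp add: op_power_def)
  also have "\<dots> = (adj T o\<^sub>L T) o\<^sub>L op_power (adj T o\<^sub>L T) m"
    by (simp only: compose_assoc[symmetric] op_abs_square[OF assms] Suc)
  finally show ?case by (simp add: op_power_def)
qed (simp add: op_power_def)

lemma adj_scaleR: "T \<in> bop \<Longrightarrow> adj (r *\<^sub>R T) = r *\<^sub>R adj T"
  using adj_scale_op[of T "of_real r"] by (simp add: scale_op_of_real)

section \<open>Words of operators\<close>

definition oprod :: "('a :: complex_hilbert_space \<Rightarrow>\<^sub>L 'a) list \<Rightarrow> ('a \<Rightarrow>\<^sub>L 'a)" where
  "oprod xs = foldr (o\<^sub>L) xs id_blinfun"

definition adj_word :: "('a :: complex_hilbert_space \<Rightarrow>\<^sub>L 'a) list \<Rightarrow> ('a \<Rightarrow>\<^sub>L 'a) list" where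
  "adj_word xs = rev (map adj xs)"

text \<open>The word \<open>T T\<^sup>* T \<dots>\<close> with \<open>n\<close> letters; its trace, for \<open>n = 2m\<close>, is the moment that defines the
  \<open>2m\<close>-norm of \<open>T\<close>.\<close>

primrec alt_word :: "nat \<Rightarrow> ('a :: complex_hilbert_space \<Rightarrow>\<^sub>L 'a) \<Rightarrow> ('a \<Rightarrow>\<^sub>L 'a) list" where
  "alt_word 0 T = []"
| "alt_word (Suc n) T = T # alt_word n (adj T)"

lemma oprod_Nil [simp]: "oprod [] = id_blinfun" by (simp add: oprod_def)
lemma oprod_Cons [simp]: "oprod (x # xs) = x o\<^sub>L oprod xs" by (simp add: oprod_def)
lemma oprod_append: "oprod (xs @ ys) = oprod xs o\<^sub>L oprod ys"
  by (induction xs) (simp_all add: compose_assoc)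

lemma bop_oprod: "set xs \<subseteq> bop \<Longrightarrow> oprod xs \<in> bop"
  by (induction xs) (auto intro: bop_compose)

lemma adj_oprod: "set xs \<subseteq> bop \<Longrightarrow> adj (oprod xs) = oprod (adj_word xs)"
  by (induction xs) (simp_all add: adj_compose bop_oprod adj_word_def oprod_append)

lemma adj_word_append: "adj_word (xs @ ys) = adj_word ys @ adj_word xs"
  by (simp add: adj_word_def)

lemma length_adj_word [simp]: "length (adj_word xs) = length xs" by (simp add: adj_word_def)
lemma length_alt_word [simp]: "length (alt_word n T) = n" by (induction n arbitrary: T) auto

lemma alt_word_append:
  "T \<in> bop \<Longrightarrow> alt_word (i + j) T = alt_word i T @ alt_word j (if even i then T else adj T)"
  by (induction i arbitrary: T) (auto simp: adj_adj bop_adj)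

lemma alt_word_reflect: "T \<in> bop \<Longrightarrow> alt_word n T @ adj_word (alt_word n T) = alt_word (2 * n) T"
proof (induction n arbitrary: T)
  case (Suc n)
  have "alt_word (Suc n) T @ adj_word (alt_word (Suc n) T)
      = T # (alt_word n (adj T) @ adj_word (alt_word n (adj T))) @ [adj T]"
    by (simp add: adj_word_def)
  also have "\<dots> = T # alt_word (2 * n + 1) (adj T)"
    using Suc alt_word_append[of "adj T" "2 * n" 1] by (simp add: bop_adj del: alt_word.simps(2)) simp
  finally show ?case by simp
qed (simp add: adj_word_def)

lemma op_power_alt_word: "T \<in> bop \<Longrightarrow> op_power (adj T o\<^sub>L T) m = oprod (alt_word (2 * m) (adj T))"
  by (induction m) (simp_all add: op_power_def adj_adj compose_assoc)

section \<open>Traces on unital *-algebras of operators\<close>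

text \<open>The structure that a von Neumann algebra with its trace and all its matrix amplifications have in
  common, so that what is proved here applies to both.\<close>

locale star_trace =
  fixes A :: "('a :: complex_hilbert_space \<Rightarrow>\<^sub>L 'a) set" and \<tau> :: "('a \<Rightarrow>\<^sub>L 'a) \<Rightarrow> complex"
  assumes in_bop: "T \<in> A \<Longrightarrow> T \<in> bop"
    and id_in: "id_blinfun \<in> A"
    and add_in: "S \<in> A \<Longrightarrow> T \<in> A \<Longrightarrow> S + T \<in> A"
    and scale_in: "T \<in> A \<Longrightarrow> scale_op c T \<in> A"
    and compose_in: "S \<in> A \<Longrightarrow> T \<in> A \<Longrightarrow> S o\<^sub>L T \<in> A"
    and adj_in: "T \<in> A \<Longrightarrow> adj T \<in> A"
    and trace_add: "S \<in> A \<Longrightarrow> T \<in> A \<Longrightarrow> \<tau> (S + T) = \<tau> S + \<tau> T"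
    and trace_scale: "T \<in> A \<Longrightarrow> \<tau> (scale_op c T) = c * \<tau> T"
    and trace_nonneg: "T \<in> A \<Longrightarrow> \<tau> (adj T o\<^sub>L T) \<in> \<real>\<^sub>\<ge>\<^sub>0"
    and trace_commute: "S \<in> A \<Longrightarrow> T \<in> A \<Longrightarrow> \<tau> (S o\<^sub>L T) = \<tau> (T o\<^sub>L S)"
begin

lemma scaleR_in: "T \<in> A \<Longrightarrow> r *\<^sub>R T \<in> A"
  using scale_in[of T "of_real r"] by (simp add: scale_op_of_real)

lemma zero_in: "0 \<in> A"
  using scale_in[OF id_in, of 0] by simp

lemma diff_in: "S \<in> A \<Longrightarrow> T \<in> A \<Longrightarrow> S - T \<in> A"
  using add_in[OF _ scale_in[of T "-1"], of S] scale_op_of_real[of "-1" T] by simp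

lemma sum_in: "(\<And>i. i \<in> I \<Longrightarrow> f i \<in> A) \<Longrightarrow> (\<Sum>i\<in>I. f i) \<in> A"
  by (induction I rule: infinite_finite_induct) (auto intro: zero_in add_in)

lemma oprod_in: "set xs \<subseteq> A \<Longrightarrow> oprod xs \<in> A"
  by (induction xs) (auto intro: id_in compose_in)

lemma trace_zero: "\<tau> 0 = 0"
  using trace_scale[OF id_in, of 0] by simp

lemma trace_sum: "(\<And>i. i \<in> I \<Longrightarrow> f i \<in> A) \<Longrightarrow> \<tau> (\<Sum>i\<in>I. f i) = (\<Sum>i\<in>I. \<tau> (f i))"
  by (induction I rule: infinite_finite_induct) (auto simp: trace_zero trace_add sum_in)

text \<open>The values of \<open>\<tau>\<close> at \<open>(1 + c T)\<^sup>* (1 + c T)\<close> are real; \<open>c = 1\<close> and \<open>c = \<i>\<close> give the two parts.\<close>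

lemma trace_adj:
  assumes T: "T \<in> A"
  shows "\<tau> (adj T) = cnj (\<tau> T)"
proof -
  have im: "Im (\<tau> (adj S o\<^sub>L S)) = 0" if "S \<in> A" for S
    using trace_nonneg[OF that] by (simp add: complex_nonneg_Reals_iff)
  have expand: "\<tau> (adj (id_blinfun + scale_op c T) o\<^sub>L (id_blinfun + scale_op c T))
      = \<tau> id_blinfun + c * \<tau> T + cnj c * \<tau> (adj T) + cnj c * c * \<tau> (adj T o\<^sub>L T)" for c
    by (simp add: adj_add adj_scale_op in_bop T bop_scale_op compose_add_left compose_add_right
        compose_scale_op_left compose_scale_op_right bop_adj scale_op_scale_op
        trace_add trace_scale add_in scale_in adj_in compose_in id_in scale_op_add_right algebra_simps)
  have one: "Im (\<tau> id_blinfun) = 0" using im[OF id_in] by simp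
  have "Im (\<tau> T + \<tau> (adj T)) = 0"
    using im[OF add_in[OF id_in scale_in[OF T, of 1]]] expand[of 1] one im[OF T] by simp
  moreover have "Im (\<i> * \<tau> T - \<i> * \<tau> (adj T)) = 0"
    using im[OF add_in[OF id_in scale_in[OF T, of \<i>]]] expand[of \<i>] one im[OF T] by simp
  ultimately show ?thesis by (simp add: complex_eq_iff)
qed

lemma trace_rotate:
  assumes "set xs \<subseteq> A" "set ys \<subseteq> A"
  shows "\<tau> (oprod (xs @ ys)) = \<tau> (oprod (ys @ xs))"
  using assms by (simp add: oprod_append trace_commute oprod_in)

lemma trace_cauchy_schwarz:
  assumes S: "S \<in> A" and T: "T \<in> A"
  shows "(cmod (\<tau> (S o\<^sub>L T)))\<^sup>2 \<le> Re (\<tau> (S o\<^sub>L adj S)) * Re (\<tau> (adj T o\<^sub>L T))"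
proof (rule quadratic_form_discriminant)
  show "0 \<le> Re (\<tau> (adj T o\<^sub>L T))"
    using trace_nonneg[OF T] by (simp add: complex_nonneg_Reals_iff)
  fix c
  have TS: "\<tau> (adj T o\<^sub>L adj S) = cnj (\<tau> (S o\<^sub>L T))"
    using trace_adj[of "S o\<^sub>L T"] S T by (simp add: adj_compose in_bop compose_in)
  have "0 \<le> Re (\<tau> (adj (adj S + scale_op c T) o\<^sub>L (adj S + scale_op c T)))"
    using trace_nonneg[of "adj S + scale_op c T"] S T
    by (simp add: add_in adj_in scale_in complex_nonneg_Reals_iff)
  also have "\<tau> (adj (adj S + scale_op c T) o\<^sub>L (adj S + scale_op c T)) =
      \<tau> (S o\<^sub>L adj S) + c * \<tau> (S o\<^sub>L T) + cnj c * \<tau> (adj T o\<^sub>L adj S) + (cnj c * c) * \<tau> (adj T o\<^sub>L T)"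
    using S T by (simp add: adj_add adj_scale_op adj_adj in_bop bop_scale_op compose_add_left compose_add_right
        compose_scale_op_left compose_scale_op_right bop_adj scale_op_scale_op
        trace_add trace_scale add_in scale_in adj_in compose_in scale_op_add_right algebra_simps)
  also have "cnj c * c = of_real ((cmod c)\<^sup>2)"
    by (simp only: complex_norm_square mult.commute)
  also have "Re (\<tau> (S o\<^sub>L adj S) + c * \<tau> (S o\<^sub>L T) + cnj c * \<tau> (adj T o\<^sub>L adj S)
      + of_real ((cmod c)\<^sup>2) * \<tau> (adj T o\<^sub>L T)) =
      Re (\<tau> (S o\<^sub>L adj S)) + 2 * Re (c * \<tau> (S o\<^sub>L T)) + (cmod c)\<^sup>2 * Re (\<tau> (adj T o\<^sub>L T))"
    unfolding TS by simp
  finally show "0 \<le> Re (\<tau> (S o\<^sub>L adj S)) + 2 * Re (c * \<tau> (S o\<^sub>L T))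
      + (cmod c)\<^sup>2 * Re (\<tau> (adj T o\<^sub>L T))" .
qed

lemma alt_word_in: "T \<in> A \<Longrightarrow> set (alt_word n T) \<subseteq> A"
  by (induction n arbitrary: T) (auto intro: adj_in)

lemma trace_word_cauchy_schwarz:
  assumes "set u \<subseteq> A" "set v \<subseteq> A"
  shows "(cmod (\<tau> (oprod (u @ v))))\<^sup>2 \<le>
    Re (\<tau> (oprod (u @ adj_word u))) * Re (\<tau> (oprod (adj_word v @ v)))"
proof -
  have "set u \<subseteq> bop" "set v \<subseteq> bop" using assms in_bop by auto
  then show ?thesis
    using trace_cauchy_schwarz[OF oprod_in[OF assms(1)] oprod_in[OF assms(2)]]
    by (simp add: oprod_append adj_oprod)
qed

lemma trace_reflect_nonneg:
  assumes "set u \<subseteq> A"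
  shows "\<tau> (oprod (u @ adj_word u)) \<in> \<real>\<^sub>\<ge>\<^sub>0"
proof -
  have "set u \<subseteq> bop" using assms in_bop by auto
  then have "oprod (u @ adj_word u) = adj (adj (oprod u)) o\<^sub>L adj (oprod u)"
    by (simp add: adj_adj bop_oprod oprod_append adj_oprod[symmetric])
  then show ?thesis
    using trace_nonneg[OF adj_in[OF oprod_in[OF assms]]] by simp
qed

text \<open>Hoelder's inequality for words of even length \<open>2m\<close>, by reflection positivity. Among the words
  over a finite self-adjoint alphabet take one of maximal modulus \<open>B\<close>. Cauchy--Schwarz replaces
  its halves \<open>u v\<close> by \<open>u u\<^sup>*\<close>, again of modulus \<open>B\<close>, and an alternating block \<open>a a\<^sup>* a \<dots>\<close> at the end of
  \<open>u\<close> gets longer in \<open>u u\<^sup>*\<close>. Once \<open>u\<close> is alternating throughout, \<open>u u\<^sup>*\<close> is a pure power.\<close>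

lemma trace_word_le_one:
  assumes fin: "finite S" and SA: "S \<subseteq> A" and adjS: "\<And>a. a \<in> S \<Longrightarrow> adj a \<in> S"
    and pow: "\<And>a. a \<in> S \<Longrightarrow> Re (\<tau> (oprod (alt_word (2 * m) a))) \<le> 1"
    and m: "m > 0" and w: "set w \<subseteq> S" "length w = 2 * m"
  shows "cmod (\<tau> (oprod w)) \<le> 1"
proof -
  define W where "W = {w. set w \<subseteq> S \<and> length w = 2 * m}"
  define B where "B = Max ((\<lambda>w. cmod (\<tau> (oprod w))) ` W)"
  have finW: "finite W" unfolding W_def by (rule finite_lists_length_eq[OF fin])
  have wW: "w \<in> W" using w by (simp add: W_def)
  have B_max: "cmod (\<tau> (oprod x)) \<le> B" if "x \<in> W" for x
    unfolding B_def using finW that by (intro Max_ge) auto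
  have "B \<in> (\<lambda>w. cmod (\<tau> (oprod w))) ` W"
    unfolding B_def using finW wW by (intro Max_in) auto
  then obtain w0 where w0: "w0 \<in> W" "cmod (\<tau> (oprod w0)) = B" by auto
  have adj_word_S: "set (adj_word u) \<subseteq> S" if "set u \<subseteq> S" for u
    using that adjS by (auto simp: adj_word_def)
  have alt_S: "set (alt_word n a) \<subseteq> S" if "a \<in> S" for n a
    using that by (induction n arbitrary: a) (auto intro: adjS)
  have "B \<le> 1"
  proof (rule ccontr)
    assume "\<not> B \<le> 1"
    then have B1: "B > 1" by simp
    have reflect: "B \<le> Re (\<tau> (oprod (u @ adj_word u)))"
      if "set u \<subseteq> S" "set v \<subseteq> S" "length u = m" "length v = m" "cmod (\<tau> (oprod (u @ v))) = B" for u v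
    proof -
      let ?a = "Re (\<tau> (oprod (u @ adj_word u)))" and ?b = "Re (\<tau> (oprod (adj_word v @ v)))"
      have "?b \<le> B"
        using B_max[of "adj_word v @ v"] adj_word_S that by (intro order_trans[OF complex_Re_le_cmod]) (auto simp: W_def)
      moreover have "B\<^sup>2 \<le> ?a * ?b"
        using trace_word_cauchy_schwarz[of u v] that SA by auto
      moreover have "0 \<le> ?a"
        using trace_reflect_nonneg[of u] that SA by (simp add: complex_nonneg_Reals_iff)
      ultimately have "B * B \<le> ?a * B"
        using mult_left_mono[of ?b B ?a] by (simp add: power2_eq_square)
      then show ?thesis using B1 by simp
    qed
    have chain: "\<exists>u' a v. a \<in> S \<and> set u' \<subseteq> S \<and> set v \<subseteq> S \<and> length u' + j = m \<and> length v = m \<and>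
        cmod (\<tau> (oprod ((u' @ alt_word j a) @ v))) = B" if "1 \<le> j" "j \<le> m" for j
      using that
    proof (induction j rule: dec_induct)
      case base
      let ?u = "take m w0" and ?v = "drop m w0"
      have len: "length w0 = 2 * m" "set w0 \<subseteq> S" using w0 by (auto simp: W_def)
      then have ne: "?u \<noteq> []" using m by auto
      then have u: "?u = butlast ?u @ alt_word 1 (last ?u)" by simp
      have sets: "set ?u \<subseteq> S" "set ?v \<subseteq> S" using len set_take_subset set_drop_subset by fast+
      have "last ?u \<in> S" using sets ne last_in_set by blast
      moreover have "set (butlast ?u) \<subseteq> S" using sets by (meson in_set_butlastD subset_iff)
      moreover have "cmod (\<tau> (oprod ((butlast ?u @ alt_word 1 (last ?u)) @ ?v))) = B"
        using w0 by (simp only: u[symmetric] append_take_drop_id)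
      ultimately show ?case using sets len m
        by (intro exI[of _ "butlast ?u"] exI[of _ "last ?u"] exI[of _ ?v]) auto
    next
      case (step j)
      then obtain u' a v where IH: "a \<in> S" "set u' \<subseteq> S" "set v \<subseteq> S" "length u' + j = m" "length v = m"
        "cmod (\<tau> (oprod ((u' @ alt_word j a) @ v))) = B" by auto
      have "length u' > 0" using IH(4) step.prems by (cases u') auto
      then obtain x u'' where u': "u' = x # u''" by (cases u') auto
      let ?u = "u' @ alt_word j a"
      have aB: "a \<in> bop" using IH SA in_bop by auto
      have setu: "set ?u \<subseteq> S" using IH alt_S by auto
      have le: "B \<le> Re (\<tau> (oprod (?u @ adj_word ?u)))"
        by (rule reflect[of _ v]) (use IH setu in auto)
      \<comment> \<open>The block of length \<open>2j\<close> in the middle of \<open>u u\<^sup>*\<close> is cut after \<open>j + 1\<close> letters; rotating the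
        first letter of the word to its end puts this cut at position \<open>m\<close>.\<close>
      define r where "r = alt_word (j - 1) (if even (Suc j) then a else adj a)"
      have rS: "set r \<subseteq> S" unfolding r_def using IH adjS by (intro alt_S) auto
      have "alt_word j a @ adj_word (alt_word j a) = alt_word (Suc j + (j - 1)) a"
        using step by (simp add: alt_word_reflect[OF aB] mult_2)
      also have "\<dots> = alt_word (Suc j) a @ r"
        unfolding r_def by (rule alt_word_append[OF aB])
      finally have block: "alt_word j a @ adj_word (alt_word j a) = alt_word (Suc j) a @ r" .
      have "?u @ adj_word ?u = u' @ (alt_word j a @ adj_word (alt_word j a)) @ adj_word u'"
        by (simp add: adj_word_append del: alt_word.simps)
      then have cut: "?u @ adj_word ?u = [x] @ ((u'' @ alt_word (Suc j) a) @ (r @ adj_word u'))"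
        unfolding block by (simp add: u' del: alt_word.simps)
      have subA: "set [x] \<subseteq> A" "set ((u'' @ alt_word (Suc j) a) @ (r @ adj_word u')) \<subseteq> A"
        using IH(2) u' rS adj_word_S[OF IH(2)] alt_S[OF IH(1), of "Suc j"] SA
        by (auto simp del: alt_word.simps)
      define v' where "v' = r @ adj_word u' @ [x]"
      have "\<tau> (oprod (?u @ adj_word ?u)) = \<tau> (oprod ((u'' @ alt_word (Suc j) a) @ v'))"
        unfolding cut trace_rotate[OF subA] v'_def by (simp del: alt_word.simps)
      moreover have v'S: "set v' \<subseteq> S" "length v' = m"
        using rS adj_word_S[of u'] IH u' step by (auto simp: v'_def r_def)
      moreover have u''S: "set u'' \<subseteq> S" "length u'' + Suc j = m" using IH u' by auto
      moreover have "cmod (\<tau> (oprod ((u'' @ alt_word (Suc j) a) @ v'))) \<le> B"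
        using v'S u''S alt_S[OF IH(1), of "Suc j"] by (intro B_max) (auto simp: W_def simp del: alt_word.simps)
      ultimately have "cmod (\<tau> (oprod ((u'' @ alt_word (Suc j) a) @ v'))) = B"
        using le complex_Re_le_cmod by (metis order_antisym order_trans)
      then show ?case using v'S u''S IH(1) by blast
    qed
    obtain u' a v where *: "a \<in> S" "set u' \<subseteq> S" "set v \<subseteq> S" "length u' + m = m" "length v = m"
        "cmod (\<tau> (oprod ((u' @ alt_word m a) @ v))) = B"
      using chain[of m] m by auto
    then have "B \<le> Re (\<tau> (oprod (alt_word m a @ adj_word (alt_word m a))))"
      using alt_S by (intro reflect[of _ v]) auto
    also have "\<dots> \<le> 1"
      using pow[OF *(1)] alt_word_reflect[of a m] *(1) SA in_bop by auto
    finally show False using B1 by simp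
  qed
  then show ?thesis using B_max[OF wW] by simp
qed

lemma trace_alt_word_adj:
  assumes T: "T \<in> A"
  shows "\<tau> (oprod (alt_word (2 * m) (adj T))) = \<tau> (oprod (alt_word (2 * m) T))"
proof (cases m)
  case (Suc k)
  have Tb: "T \<in> bop" "adj T \<in> bop" using T by (simp_all add: in_bop bop_adj)
  have 2: "2 * m = (2 * k + 1) + 1" using Suc by simp
  have last: "alt_word (2 * m) (adj T) = alt_word (2 * k + 1) (adj T) @ [T]"
    unfolding 2 by (subst alt_word_append[OF Tb(2)]) (simp add: adj_adj[OF Tb(1)])
  have first: "alt_word (2 * m) T = [T] @ alt_word (2 * k + 1) (adj T)"
    using Suc by simp
  show ?thesis
    unfolding last first
    by (rule trace_rotate) (simp_all add: T alt_word_in adj_in del: alt_word.simps)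
qed simp

text \<open>The unit ball of the \<open>2m\<close>-norm is convex: a word is affine in each of its letters, so the convex
  combinations in it can be replaced one after the other by their end points, until Hoelder's inequality
  for the end points applies.\<close>

lemma trace_alt_word_convex:
  assumes a: "a \<in> A" "Re (\<tau> (oprod (alt_word (2 * m) a))) \<le> 1"
    and b: "b \<in> A" "Re (\<tau> (oprod (alt_word (2 * m) b))) \<le> 1"
    and st: "s \<ge> 0" "t \<ge> 0" "s + t = 1" and m: "m > 0"
  shows "Re (\<tau> (oprod (alt_word (2 * m) (s *\<^sub>R a + t *\<^sub>R b)))) \<le> 1"
proof -
  define c where "c = s *\<^sub>R a + t *\<^sub>R b"
  define S where "S = {a, b, adj a, adj b}"
  have S: "finite S" "S \<subseteq> A" using a b by (auto simp: S_def adj_in)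
  have adjS: "x \<in> S \<Longrightarrow> adj x \<in> S" for x using a b by (auto simp: S_def adj_adj in_bop)
  have powS: "x \<in> S \<Longrightarrow> Re (\<tau> (oprod (alt_word (2 * m) x))) \<le> 1" for x
    using a b by (auto simp: S_def trace_alt_word_adj)
  have cA: "c \<in> A"
    unfolding c_def using a b by (intro add_in scaleR_in)
  have adjc: "adj c = s *\<^sub>R adj a + t *\<^sub>R adj b"
    using a b by (simp add: c_def adj_add adj_scaleR in_bop bop_scaleR)
  have split: "\<exists>y\<in>S. \<exists>z\<in>S. x = s *\<^sub>R y + t *\<^sub>R z" if "x \<in> {c, adj c}" for x
    using that adjc by (auto simp: c_def S_def)
  have "cmod (\<tau> (oprod (xs @ ys))) \<le> 1"
    if "set xs \<subseteq> {c, adj c}" "set ys \<subseteq> S" "length xs + length ys = 2 * m" for xs ys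
    using that
  proof (induction xs arbitrary: ys rule: rev_induct)
    case Nil
    then show ?case using trace_word_le_one[OF S adjS powS m] by auto
  next
    case (snoc x xs)
    obtain y z where yz: "y \<in> S" "z \<in> S" and x: "x = s *\<^sub>R y + t *\<^sub>R z"
      using split[of x] snoc.prems by auto
    have in_A: "oprod xs \<in> A" "oprod ys \<in> A" "y \<in> A" "z \<in> A"
      using snoc.prems S yz cA adj_in by (auto intro!: oprod_in)
    have "\<tau> (oprod ((xs @ [x]) @ ys)) = \<tau> (s *\<^sub>R oprod (xs @ y # ys) + t *\<^sub>R oprod (xs @ z # ys))"
      by (simp add: oprod_append compose_assoc x compose_add_left compose_add_right
          compose_scaleR_left compose_scaleR_right)
    also have "\<dots> = of_real s * \<tau> (oprod (xs @ y # ys)) + of_real t * \<tau> (oprod (xs @ z # ys))"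
      using in_A by (simp add: scale_op_of_real[symmetric] trace_add trace_scale scale_in oprod_append compose_in)
    also have "cmod \<dots> \<le> s * cmod (\<tau> (oprod (xs @ y # ys))) + t * cmod (\<tau> (oprod (xs @ z # ys)))"
      using st by (intro order_trans[OF norm_triangle_ineq]) (simp add: norm_mult)
    also have "\<dots> \<le> s * 1 + t * 1"
      using st yz snoc.prems by (intro add_mono mult_left_mono snoc.IH) auto
    finally show ?case using st by simp
  qed
  note words = this
  have "set (alt_word n x) \<subseteq> {c, adj c}" if "x \<in> {c, adj c}" for n x
    using that by (induction n arbitrary: x) (use adj_adj[OF in_bop[OF cA]] in auto)
  from words[OF this, of c "[]" "2 * m"] show ?thesis
    unfolding c_def[symmetric] using complex_Re_le_cmod order_trans by auto
qed

subsection \<open>The even p-norms\<close>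

lemma alt_word_scale:
  assumes T: "T \<in> A"
  shows "oprod (alt_word (2 * m) (scale_op c T)) = scale_op (of_real (cmod c ^ (2 * m))) (oprod (alt_word (2 * m) T))"
proof (induction m)
  case (Suc m)
  have Tb: "T \<in> bop" "adj T \<in> bop" using T by (simp_all add: in_bop adj_in)
  have pb: "oprod (alt_word (2 * m) T) \<in> bop" using alt_word_in[OF T] in_bop oprod_in by blast
  have cc: "c * cnj c = of_real (cmod c ^ 2)" by (simp only: complex_norm_square)
  have "oprod (alt_word (2 * Suc m) (scale_op c T)) =
      scale_op c T o\<^sub>L (scale_op (cnj c) (adj T) o\<^sub>L oprod (alt_word (2 * m) (scale_op c T)))"
    using Tb by (simp add: adj_scale_op adj_adj)
  also have "\<dots> = scale_op (c * cnj c * of_real (cmod c ^ (2 * m))) (T o\<^sub>L (adj T o\<^sub>L oprod (alt_word (2 * m) T)))"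
    unfolding Suc using Tb pb
    by (simp add: compose_scale_op_left compose_scale_op_right scale_op_scale_op bop_compose mult.assoc)
  also have "c * cnj c * of_real (cmod c ^ (2 * m)) = of_real (cmod c ^ (2 * Suc m))"
    unfolding cc by (simp add: power_add[symmetric] flip: of_real_mult of_real_power)
  finally show ?case using Tb by (simp add: adj_adj)
qed simp

lemma trace_alt_word_nonneg:
  assumes T: "T \<in> A"
  shows "\<tau> (oprod (alt_word (2 * m) T)) \<in> \<real>\<^sub>\<ge>\<^sub>0"
  using trace_reflect_nonneg[OF alt_word_in[OF T], of m] by (simp add: alt_word_reflect in_bop[OF T])

lemma lp_norm_alt_word:
  assumes "T \<in> A"
  shows "op_lp_norm \<tau> (2 * m) T = root (2 * m) (Re (\<tau> (oprod (alt_word (2 * m) T))))"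
  using assms by (simp add: op_lp_norm_def op_power_abs_even op_power_alt_word in_bop trace_alt_word_adj)

lemma lp_norm_power:
  assumes "T \<in> A" "m > 0"
  shows "complex_of_real (op_lp_norm \<tau> (2 * m) T ^ (2 * m)) = \<tau> (oprod (alt_word (2 * m) T))"
  using trace_alt_word_nonneg[OF assms(1), of m] assms
  by (simp add: lp_norm_alt_word complex_nonneg_Reals_iff complex_eq_iff del: of_real_power)

lemma lp_norm_nonneg: "T \<in> A \<Longrightarrow> 0 \<le> op_lp_norm \<tau> (2 * m) T"
  using trace_alt_word_nonneg[of T m] by (simp add: lp_norm_alt_word complex_nonneg_Reals_iff real_root_ge_zero)

lemma lp_norm_scale:
  assumes "T \<in> A" "m > 0"
  shows "op_lp_norm \<tau> (2 * m) (scale_op c T) = cmod c * op_lp_norm \<tau> (2 * m) T"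
  using assms by (simp add: lp_norm_alt_word scale_in alt_word_scale trace_scale oprod_in alt_word_in
      real_root_mult real_root_power_cancel del: of_real_power)

lemma lp_norm_le_one_iff:
  assumes "T \<in> A" "m > 0"
  shows "op_lp_norm \<tau> (2 * m) T \<le> 1 \<longleftrightarrow> Re (\<tau> (oprod (alt_word (2 * m) T))) \<le> 1"
  using assms by (simp add: lp_norm_alt_word)

lemma lp_norm_triangle:
  assumes a: "a \<in> A" and b: "b \<in> A" and m: "m > 0"
  shows "op_lp_norm \<tau> (2 * m) (a + b) \<le> op_lp_norm \<tau> (2 * m) a + op_lp_norm \<tau> (2 * m) b"
proof (rule field_le_epsilon)
  fix e :: real assume e: "e > 0"
  let ?n = "op_lp_norm \<tau> (2 * m)"
  define \<alpha> \<beta> where "\<alpha> = ?n a + e / 2" and "\<beta> = ?n b + e / 2"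
  have pos: "\<alpha> > 0" "\<beta> > 0" using e lp_norm_nonneg[of a m] lp_norm_nonneg[of b m] a b
    by (auto simp: \<alpha>_def \<beta>_def intro: add_nonneg_pos)
  have nR: "?n (r *\<^sub>R T) = r * ?n T" if "r \<ge> 0" "T \<in> A" for r T
    using lp_norm_scale[OF that(2) m, of "of_real r"] that(1) by (simp add: scale_op_of_real)
  have "?n ((1/\<alpha>) *\<^sub>R a) \<le> 1" "?n ((1/\<beta>) *\<^sub>R b) \<le> 1"
    using pos e a b by (simp_all add: nR) (simp_all add: \<alpha>_def \<beta>_def)
  then have "?n ((\<alpha> / (\<alpha> + \<beta>)) *\<^sub>R ((1/\<alpha>) *\<^sub>R a) + (\<beta> / (\<alpha> + \<beta>)) *\<^sub>R ((1/\<beta>) *\<^sub>R b)) \<le> 1"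
    using pos a b m
    by (simp only: lp_norm_le_one_iff scaleR_in add_in, intro trace_alt_word_convex)
      (simp_all add: scaleR_in add_divide_distrib[symmetric])
  also have "(\<alpha> / (\<alpha> + \<beta>)) *\<^sub>R ((1/\<alpha>) *\<^sub>R a) + (\<beta> / (\<alpha> + \<beta>)) *\<^sub>R ((1/\<beta>) *\<^sub>R b) = (1 / (\<alpha> + \<beta>)) *\<^sub>R (a + b)"
    using pos by (simp add: scaleR_add_right)
  finally have "?n (a + b) \<le> \<alpha> + \<beta>"
    using pos a b by (simp add: nR add_in)
  then show "?n (a + b) \<le> ?n a + ?n b + e" by (simp add: \<alpha>_def \<beta>_def)
qed

end

section \<open>Operator matrices\<close>

lemma bounded_linear_axis: "bounded_linear (\<lambda>v :: 'a :: complex_hilbert_space. (axis j v :: 'a ^ 'n))"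
proof (rule bounded_linear_intro[where K = 1])
  fix v :: 'a
  have "norm (axis j v :: 'a ^ 'n) = L2_set (\<lambda>i. if i = j then norm v else 0) UNIV"
    unfolding norm_vec_def by (rule L2_set_cong) (auto simp: axis_def)
  also have "\<dots> \<le> norm v"
    by (rule order_trans[OF L2_set_le_sum]) auto
  finally show "norm (axis j v :: 'a ^ 'n) \<le> norm v * 1" by simp
qed (auto simp: axis_def vec_eq_iff)

lemma vec_eq_sum_axis: "w = (\<Sum>j\<in>UNIV. axis j (w $ j :: 'a :: complex_hilbert_space))"
  by (simp add: vec_eq_iff axis_def)

lemma axis_scaleC: "axis j (c *\<^sub>C v) = c *\<^sub>C (axis j v :: 'a :: complex_hilbert_space ^ 'n)"
  by (simp add: vec_eq_iff axis_def scaleC_vec_def)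

lemma scaleC_nth: "(c *\<^sub>C w) $ i = c *\<^sub>C (w $ i :: 'a :: complex_hilbert_space)"
  by (simp add: scaleC_vec_def)

lemma cinner_axis_left: "cinner (axis i v) w = cinner v (w $ i :: 'a :: complex_hilbert_space)"
proof -
  have "cinner (axis i v) w = (\<Sum>k\<in>UNIV. if k = i then cinner v (w $ i) else 0)"
    unfolding cinner_vec_def by (rule sum.cong) (auto simp: axis_def)
  then show ?thesis by simp
qed

lemma cinner_axis_right: "cinner w (axis i v) = cinner (w $ i) (v :: 'a :: complex_hilbert_space)"
  by (metis cinner_axis_left cinner_commute)

lemma apply_nth_entries:
  "blinfun_apply X w $ i = (\<Sum>j\<in>UNIV. blinfun_apply (entry X i j) (w $ j))"
  by (subst vec_eq_sum_axis[of w]) (simp add: blinfun.sum_right entry_apply)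

lemma entry_eqI: "(\<And>i j. entry X i j = entry Y i j) \<Longrightarrow> X = Y"
  by (rule blinfun_eqI) (simp add: vec_eq_iff apply_nth_entries)

lemma entry_zero [simp]: "entry 0 i j = 0"
  by (rule blinfun_eqI) (simp add: entry_apply)

lemma entry_add: "entry (X + Y) i j = entry X i j + entry Y i j"
  by (rule blinfun_eqI) (simp add: entry_apply blinfun.add_left)

lemma entry_diff: "entry (X - Y) i j = entry X i j - entry Y i j"
  by (rule blinfun_eqI) (simp add: entry_apply blinfun.diff_left)

lemma entry_sum: "entry (\<Sum>k\<in>I. f k) i j = (\<Sum>k\<in>I. entry (f k) i j)"
  by (induction I rule: infinite_finite_induct) (simp_all add: entry_add)

lemma entry_scale_op: "entry (scale_op c X) i j = scale_op c (entry X i j)"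
  by (rule blinfun_eqI) (simp add: entry_apply scale_op_apply scaleC_nth)

lemma entry_id: "entry id_blinfun i j = (if i = j then id_blinfun else 0)"
  by (rule blinfun_eqI) (simp add: entry_apply axis_def)

lemma entry_compose: "entry (X o\<^sub>L Y) i j = (\<Sum>k\<in>UNIV. entry X i k o\<^sub>L entry Y k j)"
  by (rule blinfun_eqI) (simp add: entry_apply[of "X o\<^sub>L Y"] entry_apply[of Y] apply_nth_entries[of X] blinfun.sum_left)

lemma bop_iff_entries: "X \<in> bop \<longleftrightarrow> (\<forall>i j. entry X i j \<in> bop)"
proof
  show "X \<in> bop \<Longrightarrow> \<forall>i j. entry X i j \<in> bop"
    by (simp add: bop_def entry_apply axis_scaleC scaleC_nth)
next
  assume *: "\<forall>i j. entry X i j \<in> bop"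
  show "X \<in> bop"
    unfolding bop_def mem_Collect_eq
  proof (intro allI)
    fix c w
    show "blinfun_apply X (c *\<^sub>C w) = c *\<^sub>C blinfun_apply X w"
      using * by (simp add: vec_eq_iff apply_nth_entries scaleC_nth bop_scaleC scaleC_sum_right)
  qed
qed

lemma entry_adj:
  assumes X: "X \<in> bop"
  shows "entry (adj X) i j = adj (entry X j i)"
proof (rule adjI[symmetric])
  fix x y
  have "cinner (blinfun_apply (entry (adj X) i j) x) y = cinner (blinfun_apply (adj X) (axis j x)) (axis i y)"
    by (simp add: entry_apply cinner_axis_right)
  also have "\<dots> = cinner x (blinfun_apply (entry X j i) y)"
    by (simp add: cinner_adj_left[OF X] cinner_axis_left entry_apply)
  finally show "cinner (blinfun_apply (entry (adj X) i j) x) y = cinner x (blinfun_apply (entry X j i) y)" .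
qed

text \<open>The elementary tensor \<open>e\<^sub>i\<^sub>j \<otimes> T\<close>.\<close>

definition munit :: "'n \<Rightarrow> 'n \<Rightarrow> ('a :: complex_hilbert_space \<Rightarrow>\<^sub>L 'a) \<Rightarrow> (('a ^ 'n) \<Rightarrow>\<^sub>L ('a ^ 'n))" where
  "munit i j T = Blinfun (\<lambda>w. axis i (blinfun_apply T (w $ j)))"

lemma munit_apply: "blinfun_apply (munit i j T) w = axis i (blinfun_apply T (w $ j))"
proof -
  have "bounded_linear (\<lambda>w. axis i (blinfun_apply T (w $ j)))"
    by (intro bounded_linear_compose[OF bounded_linear_axis]
        bounded_linear_compose[OF blinfun.bounded_linear_right bounded_linear_vec_nth])
  then show ?thesis unfolding munit_def by (simp add: bounded_linear_Blinfun_apply)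
qed

lemma entry_munit: "entry (munit i j T) k l = (if k = i \<and> l = j then T else 0)"
  by (rule blinfun_eqI) (auto simp: entry_apply munit_apply axis_def)

lemma bop_munit: "T \<in> bop \<Longrightarrow> munit i j T \<in> bop"
  by (simp add: bop_iff_entries[of "munit i j T"] entry_munit)

lemma adj_munit: "T \<in> bop \<Longrightarrow> adj (munit i j T) = munit j i (adj T)"
proof -
  assume T: "T \<in> bop"
  have "adj 0 = (0 :: 'a \<Rightarrow>\<^sub>L 'a)" by (rule adjI) simp
  then show ?thesis by (intro entry_eqI) (auto simp: entry_adj bop_munit T entry_munit)
qed

lemma munit_compose: "munit i j S o\<^sub>L munit k l T = (if j = k then munit i l (S o\<^sub>L T) else 0)"
  by (rule blinfun_eqI) (auto simp: munit_apply axis_def vec_eq_iff)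

lemma munit_diff: "munit i j (S - T) = munit i j S - munit i j T"
  by (rule entry_eqI) (simp add: entry_diff entry_munit)

lemma sum_munit_entries: "X = (\<Sum>i\<in>UNIV. \<Sum>j\<in>UNIV. munit i j (entry X i j))"
proof (rule entry_eqI)
  fix a b
  have "(\<Sum>i\<in>UNIV. \<Sum>j\<in>UNIV. if a = i \<and> b = j then entry X i j else 0)
      = (\<Sum>i\<in>UNIV. if i = a then entry X a b else 0)"
  proof (intro sum.cong refl)
    fix i
    have "(\<Sum>j\<in>UNIV. if a = i \<and> b = j then entry X i j else 0)
        = (\<Sum>j\<in>UNIV. if j = b then (if i = a then entry X a b else 0) else 0)"
      by (rule sum.cong) auto
    then show "(\<Sum>j\<in>UNIV. if a = i \<and> b = j then entry X i j else 0) = (if i = a then entry X a b else 0)"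
      by simp
  qed
  then show "entry X a b = entry (\<Sum>i\<in>UNIV. \<Sum>j\<in>UNIV. munit i j (entry X i j)) a b"
    by (simp add: entry_sum entry_munit)
qed

lemma entry_sum_munit: "entry (\<Sum>i\<in>UNIV. \<Sum>j\<in>UNIV. munit i j (f i j)) a b = f a b"
proof -
  have "(\<Sum>j\<in>UNIV. if a = i \<and> b = j then f i j else 0) = (if i = a then f a b else 0)" for i
  proof -
    have "(\<Sum>j\<in>UNIV. if a = i \<and> b = j then f i j else 0)
        = (\<Sum>j\<in>UNIV. if j = b then (if i = a then f a b else 0) else 0)"
      by (rule sum.cong) auto
    then show ?thesis by simp
  qed
  then show ?thesis by (simp add: entry_sum entry_munit)
qed

lemma id_eq_sum_munit:
  "(id_blinfun :: ('a :: complex_hilbert_space ^ 'n) \<Rightarrow>\<^sub>L ('a ^ 'n)) = (\<Sum>i\<in>UNIV. munit i i id_blinfun)"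
proof (rule entry_eqI)
  fix a b :: 'n
  have "entry (\<Sum>i\<in>UNIV. munit i i (id_blinfun :: 'a \<Rightarrow>\<^sub>L 'a)) a b
      = (\<Sum>i\<in>UNIV. if i = a then (if a = b then id_blinfun else 0) else 0)"
    unfolding entry_sum by (rule sum.cong) (auto simp: entry_munit)
  also have "\<dots> = (if a = b then id_blinfun else 0)" by simp
  finally show "entry id_blinfun a b = entry (\<Sum>i\<in>UNIV. munit i i (id_blinfun :: 'a \<Rightarrow>\<^sub>L 'a)) a b"
    by (simp only: entry_id)
qed

text \<open>Commutants are unital algebras, and a von Neumann algebra is the commutant of its commutant.\<close>

lemma von_neumann_algebra_closed:
  assumes vN: "von_neumann_algebra M"
  shows "id_blinfun \<in> M"
    and "S \<in> M \<Longrightarrow> T \<in> M \<Longrightarrow> S + T \<in> M"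
    and "T \<in> M \<Longrightarrow> scale_op c T \<in> M"
    and "S \<in> M \<Longrightarrow> T \<in> M \<Longrightarrow> S o\<^sub>L T \<in> M"
proof -
  define C where "C = commutant M"
  have M: "M = commutant C" using vN by (simp add: von_neumann_algebra_def C_def)
  have C: "A \<in> bop" if "A \<in> C" for A using that by (simp add: C_def commutant_def)
  show "id_blinfun \<in> M" unfolding M by (simp add: commutant_def)
  show "S \<in> M \<Longrightarrow> T \<in> M \<Longrightarrow> S + T \<in> M"
    unfolding M by (simp add: commutant_def bop_add compose_add_left compose_add_right)
  show "T \<in> M \<Longrightarrow> scale_op c T \<in> M"
    unfolding M using C
    by (simp add: commutant_def bop_scale_op compose_scale_op_left compose_scale_op_right)
  show "S \<in> M \<Longrightarrow> T \<in> M \<Longrightarrow> S o\<^sub>L T \<in> M"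
    unfolding M by (simp add: commutant_def bop_compose) (metis compose_assoc)
qed

lemma von_neumann_star_trace:
  assumes vN: "von_neumann_algebra M" and tr: "normal_faithful_trace M \<tau>"
  shows "star_trace M \<tau>"
proof
  note cl = von_neumann_algebra_closed[OF vN]
  have b: "T \<in> M \<Longrightarrow> T \<in> bop" and a: "T \<in> M \<Longrightarrow> adj T \<in> M" for T
    using vN by (auto simp: von_neumann_algebra_def)
  fix S T c
  show "id_blinfun \<in> M" by (rule cl)
  show "T \<in> M \<Longrightarrow> T \<in> bop" by (rule b)
  show "T \<in> M \<Longrightarrow> adj T \<in> M" by (rule a)
  show "S \<in> M \<Longrightarrow> T \<in> M \<Longrightarrow> S + T \<in> M" by (rule cl)
  show "T \<in> M \<Longrightarrow> scale_op c T \<in> M" by (rule cl)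
  show "S \<in> M \<Longrightarrow> T \<in> M \<Longrightarrow> S o\<^sub>L T \<in> M" by (rule cl)
  have tr_add: "\<forall>S\<in>M. \<forall>T\<in>M. \<tau> (S + T) = \<tau> S + \<tau> T"
    and tr_scale: "\<forall>c. \<forall>T\<in>M. \<tau> (scale_op c T) = c * \<tau> T"
    and tr_pos: "\<forall>T\<in>M. pos_op T \<longrightarrow> \<tau> T \<in> \<real>\<^sub>\<ge>\<^sub>0"
    and tr_comm: "\<forall>S\<in>M. \<forall>T\<in>M. \<tau> (S o\<^sub>L T) = \<tau> (T o\<^sub>L S)"
    using tr unfolding normal_faithful_trace_def by - (elim conjE, assumption)+
  show "S \<in> M \<Longrightarrow> T \<in> M \<Longrightarrow> \<tau> (S + T) = \<tau> S + \<tau> T"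
    using tr_add by blast
  show "T \<in> M \<Longrightarrow> \<tau> (scale_op c T) = c * \<tau> T"
    using tr_scale by blast
  show "S \<in> M \<Longrightarrow> T \<in> M \<Longrightarrow> \<tau> (S o\<^sub>L T) = \<tau> (T o\<^sub>L S)"
    using tr_comm by blast
  show "\<tau> (adj T o\<^sub>L T) \<in> \<real>\<^sub>\<ge>\<^sub>0" if T: "T \<in> M"
    using tr_pos cl(4)[OF a[OF T] T] pos_op_adj_compose[OF b[OF T]] by blast
qed

context star_trace
begin

lemma mat_algebra_iff: "X \<in> mat_algebra A \<longleftrightarrow> (\<forall>i j. entry X i j \<in> A)"
  using in_bop by (auto simp: mat_algebra_def bop_iff_entries[of X])

lemma munit_in: "T \<in> A \<Longrightarrow> munit i j T \<in> mat_algebra A"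
  by (simp add: mat_algebra_iff entry_munit zero_in)

lemma star_trace_mat_algebra:
  "star_trace (mat_algebra A :: (('a ^ 'n) \<Rightarrow>\<^sub>L ('a ^ 'n)) set) (mat_trace \<tau>)"
proof
  fix S T :: "('a ^ 'n) \<Rightarrow>\<^sub>L ('a ^ 'n)" and c
  show bop: "T \<in> bop" if "T \<in> mat_algebra A" using that by (simp add: mat_algebra_def)
  show "id_blinfun \<in> (mat_algebra A :: (('a ^ 'n) \<Rightarrow>\<^sub>L ('a ^ 'n)) set)"
    by (simp add: mat_algebra_iff entry_id id_in zero_in)
  show "S + T \<in> mat_algebra A" if "S \<in> mat_algebra A" "T \<in> mat_algebra A"
    using that by (simp add: mat_algebra_iff entry_add add_in)
  show "scale_op c T \<in> mat_algebra A" if "T \<in> mat_algebra A"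
    using that by (simp add: mat_algebra_iff entry_scale_op scale_in)
  show "S o\<^sub>L T \<in> mat_algebra A" if "S \<in> mat_algebra A" "T \<in> mat_algebra A"
    using that by (simp add: mat_algebra_iff entry_compose sum_in compose_in)
  show "adj T \<in> mat_algebra A" if "T \<in> mat_algebra A"
    using that bop[OF that] by (simp add: mat_algebra_iff entry_adj adj_in)
  show "mat_trace \<tau> (S + T) = mat_trace \<tau> S + mat_trace \<tau> T" if "S \<in> mat_algebra A" "T \<in> mat_algebra A"
    using that by (simp add: mat_trace_def mat_algebra_iff entry_add trace_add sum.distrib add_divide_distrib)
  show "mat_trace \<tau> (scale_op c T) = c * mat_trace \<tau> T" if "T \<in> mat_algebra A"
    using that by (simp add: mat_trace_def mat_algebra_iff entry_scale_op trace_scale sum_distrib_left)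
  show "mat_trace \<tau> (adj T o\<^sub>L T) \<in> \<real>\<^sub>\<ge>\<^sub>0" if "T \<in> mat_algebra A"
  proof -
    have eA: "entry T i j \<in> A" for i j using that by (simp add: mat_algebra_iff)
    have "\<tau> (entry (adj T o\<^sub>L T) i i) = (\<Sum>k\<in>UNIV. \<tau> (adj (entry T k i) o\<^sub>L entry T k i))" for i
      by (simp add: entry_compose entry_adj[OF bop[OF that]] trace_sum compose_in adj_in eA)
    moreover have "(\<Sum>i\<in>UNIV. \<Sum>k\<in>UNIV. \<tau> (adj (entry T k i) o\<^sub>L entry T k i)) \<in> \<real>\<^sub>\<ge>\<^sub>0"
      using trace_nonneg[OF eA] by (auto simp: complex_nonneg_Reals_iff intro!: sum_nonneg)
    ultimately show ?thesis
      by (simp add: mat_trace_def complex_nonneg_Reals_iff)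
  qed
  show "mat_trace \<tau> (S o\<^sub>L T) = mat_trace \<tau> (T o\<^sub>L S)" if "S \<in> mat_algebra A" "T \<in> mat_algebra A"
  proof -
    have eA: "entry S i j \<in> A" "entry T i j \<in> A" for i j using that by (simp_all add: mat_algebra_iff)
    have "(\<Sum>i\<in>UNIV. \<Sum>k\<in>UNIV. \<tau> (entry S i k o\<^sub>L entry T k i))
        = (\<Sum>i\<in>UNIV. \<Sum>k\<in>UNIV. \<tau> (entry T i k o\<^sub>L entry S k i))"
      by (subst sum.swap) (simp add: trace_commute[OF eA(1) eA(2)])
    then show ?thesis
      by (simp add: mat_trace_def entry_compose trace_sum compose_in eA)
  qed
qed

lemma mat_trace_munit:
  "mat_trace \<tau> (munit i j T :: ('a ^ 'n) \<Rightarrow>\<^sub>L ('a ^ 'n)) = (if i = j then \<tau> T / of_nat CARD('n) else 0)"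
proof -
  have "(\<Sum>k\<in>UNIV. \<tau> (entry (munit i j T) k k)) = (\<Sum>k\<in>UNIV. if k = i then (if i = j then \<tau> T else 0) else 0)"
    by (rule sum.cong) (auto simp: entry_munit trace_zero)
  then show ?thesis by (simp add: mat_trace_def)
qed

lemma alt_word_munit:
  assumes T: "T \<in> A"
  shows "oprod (alt_word (2 * Suc m) (munit i j T)) = munit i i (oprod (alt_word (2 * Suc m) T))"
proof (induction m)
  case 0
  show ?case using T by (simp add: numeral_2_eq_2 adj_munit in_bop munit_compose)
next
  case (Suc m)
  then show ?case using T by (simp add: adj_munit in_bop bop_adj adj_adj munit_compose)
qed

text \<open>A diagonal corner has normalized trace \<open>1/n\<close>, which produces a factor \<open>n\<^bsup>-1/(2m)\<^esup> \<le> 1\<close>.\<close>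

lemma lp_norm_munit_le:
  assumes T: "T \<in> A" and m: "m > 0"
  shows "op_lp_norm (mat_trace \<tau>) (2 * m) (munit i j T :: ('a ^ 'n) \<Rightarrow>\<^sub>L ('a ^ 'n)) \<le> op_lp_norm \<tau> (2 * m) T"
proof -
  interpret M: star_trace "mat_algebra A :: (('a ^ 'n) \<Rightarrow>\<^sub>L ('a ^ 'n)) set" "mat_trace \<tau>"
    by (rule star_trace_mat_algebra)
  obtain k where k: "m = Suc k" using m by (cases m) auto
  let ?t = "Re (\<tau> (oprod (alt_word (2 * m) T)))"
  have "0 \<le> ?t" using trace_alt_word_nonneg[OF T, of m] by (simp add: complex_nonneg_Reals_iff)
  then have "?t / real CARD('n) \<le> ?t"
    by (simp add: divide_le_eq mult_le_cancel_left1)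
  moreover have "Re (mat_trace \<tau> (oprod (alt_word (2 * m) (munit i j T :: ('a ^ 'n) \<Rightarrow>\<^sub>L ('a ^ 'n))))) = ?t / real CARD('n)"
    unfolding k by (subst alt_word_munit[OF T], subst mat_trace_munit) (simp add: Re_divide_of_nat del: alt_word.simps mult_Suc_right)
  ultimately show ?thesis
    using m T by (simp add: M.lp_norm_alt_word lp_norm_alt_word munit_in)
qed

end

section \<open>Representatives of elements of \<open>L\<^sub>p\<close>\<close>

locale star_trace_lp = star_trace A \<tau> for A :: "('a :: complex_hilbert_space \<Rightarrow>\<^sub>L 'a) set" and \<tau> +
  fixes m :: nat
  assumes m_pos: "m > 0"
begin

abbreviation nrm :: "('a \<Rightarrow>\<^sub>L 'a) \<Rightarrow> real" where "nrm \<equiv> op_lp_norm \<tau> (2 * m)"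
abbreviation cauchy_seqs :: "(nat \<Rightarrow> 'a \<Rightarrow>\<^sub>L 'a) set" where "cauchy_seqs \<equiv> lp_cauchy A \<tau> (2 * m)"
abbreviation null_rel :: "((nat \<Rightarrow> 'a \<Rightarrow>\<^sub>L 'a) \<times> (nat \<Rightarrow> 'a \<Rightarrow>\<^sub>L 'a)) set" where "null_rel \<equiv> lp_rel A \<tau> (2 * m)"
abbreviation Lp :: "'a lp_elem set" where "Lp \<equiv> lp_space A \<tau> (2 * m)"

lemmas nrm_nonneg = lp_norm_nonneg[of _ m]
lemmas nrm_triangle = lp_norm_triangle[OF _ _ m_pos]
lemmas nrm_scale = lp_norm_scale[OF _ m_pos]

lemma nrm_zero: "nrm 0 = 0"
  using nrm_scale[OF id_in, of 0] by simp

lemma nrm_diff_commute: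
  assumes "S \<in> A" "T \<in> A"
  shows "nrm (S - T) = nrm (T - S)"
proof -
  have "S - T = scale_op (-1) (T - S)"
    using scale_op_of_real[of "-1" "T - S"] by simp
  then show ?thesis using nrm_scale[OF diff_in[OF assms(2,1)], of "-1"] by simp
qed

lemma nrm_triangle_diff:
  assumes "R \<in> A" "S \<in> A" "T \<in> A"
  shows "nrm (R - T) \<le> nrm (R - S) + nrm (S - T)"
  using nrm_triangle[of "R - S" "S - T"] assms by (simp add: diff_in)

lemma nrm_diff_le:
  assumes "S \<in> A" "T \<in> A"
  shows "\<bar>nrm S - nrm T\<bar> \<le> nrm (S - T)"
  using nrm_triangle[of "S - T" T] nrm_triangle[of "T - S" S] nrm_diff_commute[OF assms] assms
  by (simp add: diff_in abs_le_iff)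

lemma nrm_sum_le:
  "(\<And>i. i \<in> I \<Longrightarrow> f i \<in> A) \<Longrightarrow> nrm (\<Sum>i\<in>I. f i) \<le> (\<Sum>i\<in>I. nrm (f i))"
proof (induction I rule: infinite_finite_induct)
  case (insert i I)
  then show ?case using nrm_triangle[of "f i" "\<Sum>i\<in>I. f i"] by (simp add: sum_in)
qed (simp_all add: nrm_zero)

lemma cauchy_seqs_in: "X \<in> cauchy_seqs \<Longrightarrow> X k \<in> A"
  by (simp add: lp_cauchy_def)

lemma cauchy_seqsD:
  "X \<in> cauchy_seqs \<Longrightarrow> e > 0 \<Longrightarrow> \<exists>N. \<forall>i\<ge>N. \<forall>j\<ge>N. nrm (X i - X j) < e"
  by (simp add: lp_cauchy_def)

lemma cauchy_seqs_const: "T \<in> A \<Longrightarrow> (\<lambda>_. T) \<in> cauchy_seqs"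
  by (simp add: lp_cauchy_def nrm_zero)

lemma cauchy_seqs_dominated:
  assumes W: "\<And>k. W k \<in> A" and X: "X \<in> cauchy_seqs" and Y: "Y \<in> cauchy_seqs" and c: "c > 0"
    and le: "\<And>i j. nrm (W i - W j) \<le> c * (nrm (X i - X j) + nrm (Y i - Y j))"
  shows "W \<in> cauchy_seqs"
  unfolding lp_cauchy_def mem_Collect_eq
proof (intro conjI allI impI)
  fix e :: real assume e: "e > 0"
  then have e2: "e / (2 * c) > 0" using c by simp
  obtain K where K: "\<And>i j. i \<ge> K \<Longrightarrow> j \<ge> K \<Longrightarrow> nrm (X i - X j) < e / (2 * c)"
    using cauchy_seqsD[OF X e2] by blast
  obtain L where L: "\<And>i j. i \<ge> L \<Longrightarrow> j \<ge> L \<Longrightarrow> nrm (Y i - Y j) < e / (2 * c)"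
    using cauchy_seqsD[OF Y e2] by blast
  show "\<exists>N. \<forall>i\<ge>N. \<forall>j\<ge>N. nrm (W i - W j) < e"
  proof (intro exI[of _ "max K L"] allI impI)
    fix i j assume "i \<ge> max K L" "j \<ge> max K L"
    then have "nrm (X i - X j) + nrm (Y i - Y j) < e / (2 * c) + e / (2 * c)"
      by (intro add_strict_mono K L) auto
    also have "\<dots> = e / c" by simp
    finally have "c * (nrm (X i - X j) + nrm (Y i - Y j)) < e" using c by (simp add: field_simps)
    then show "nrm (W i - W j) < e" using le[of i j] by linarith
  qed
qed (rule W)

lemma cauchy_seqs_add:
  assumes X: "X \<in> cauchy_seqs" and Y: "Y \<in> cauchy_seqs"
  shows "(\<lambda>k. X k + Y k) \<in> cauchy_seqs"
proof (rule cauchy_seqs_dominated[OF _ X Y, of _ 1])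
  fix i j
  show "X i + Y i \<in> A" using X Y by (simp add: add_in cauchy_seqs_in)
  show "nrm (X i + Y i - (X j + Y j)) \<le> 1 * (nrm (X i - X j) + nrm (Y i - Y j))"
    using nrm_triangle[of "X i - X j" "Y i - Y j"] X Y by (simp add: diff_in cauchy_seqs_in algebra_simps)
qed simp

lemma cauchy_seqs_scale:
  assumes X: "X \<in> cauchy_seqs"
  shows "(\<lambda>k. scale_op c (X k)) \<in> cauchy_seqs"
proof (rule cauchy_seqs_dominated[OF _ X X, of _ "cmod c + 1"])
  fix i j
  show "scale_op c (X i) \<in> A" using X by (simp add: scale_in cauchy_seqs_in)
  have d: "X i - X j \<in> A" using X by (simp add: diff_in cauchy_seqs_in)
  have "cmod c * nrm (X i - X j) \<le> (cmod c + 1) * (nrm (X i - X j) + nrm (X i - X j))"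
    using nrm_nonneg[OF d] by (intro mult_mono) auto
  then show "nrm (scale_op c (X i) - scale_op c (X j)) \<le> (cmod c + 1) * (nrm (X i - X j) + nrm (X i - X j))"
    using nrm_scale[OF d, of c] by (simp add: scale_op_diff_right)
qed (simp add: add_nonneg_pos)

lemma cauchy_seqs_sum:
  "(\<And>i. i \<in> I \<Longrightarrow> f i \<in> cauchy_seqs) \<Longrightarrow> (\<lambda>k. \<Sum>i\<in>I. f i k) \<in> cauchy_seqs"
  by (induction I rule: infinite_finite_induct) (auto intro: cauchy_seqs_const zero_in cauchy_seqs_add)

lemma cauchy_seqs_norm_convergent:
  assumes X: "X \<in> cauchy_seqs"
  shows "\<exists>r. (\<lambda>k. nrm (X k)) \<longlonglongrightarrow> r"
proof -
  have "Cauchy (\<lambda>k. nrm (X k))"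
  proof (rule metric_CauchyI)
    fix e :: real assume e: "e > 0"
    obtain K where K: "\<And>i j. i \<ge> K \<Longrightarrow> j \<ge> K \<Longrightarrow> nrm (X i - X j) < e"
      using cauchy_seqsD[OF X e] by blast
    have "dist (nrm (X i)) (nrm (X j)) < e" if "i \<ge> K" "j \<ge> K" for i j
      using nrm_diff_le[of "X i" "X j"] K[OF that] X by (simp add: cauchy_seqs_in dist_real_def)
    then show "\<exists>M. \<forall>i\<ge>M. \<forall>j\<ge>M. dist (nrm (X i)) (nrm (X j)) < e" by blast
  qed
  then show ?thesis by (simp add: Cauchy_convergent_iff convergent_def)
qed

lemma null_relI:
  assumes X: "X \<in> cauchy_seqs" and Y: "Y \<in> cauchy_seqs"
    and le: "\<And>k. nrm (X k - Y k) \<le> f k" and f: "f \<longlonglongrightarrow> 0"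
  shows "(X, Y) \<in> null_rel"
proof -
  have "(\<lambda>k. nrm (X k - Y k)) \<longlonglongrightarrow> 0"
    by (rule tendsto_sandwich[OF _ _ tendsto_const f])
       (use le X Y in \<open>simp_all add: nrm_nonneg diff_in cauchy_seqs_in\<close>)
  then show ?thesis using X Y by (simp add: lp_rel_def)
qed

lemma null_relD:
  assumes "(X, Y) \<in> null_rel"
  shows "X \<in> cauchy_seqs" "Y \<in> cauchy_seqs" "(\<lambda>k. nrm (X k - Y k)) \<longlonglongrightarrow> 0"
  using assms by (auto simp: lp_rel_def)

lemma equiv_null_rel: "equiv cauchy_seqs null_rel"
proof (rule equivI)
  show "null_rel \<subseteq> cauchy_seqs \<times> cauchy_seqs" by (auto simp: lp_rel_def)
  show "refl_on cauchy_seqs null_rel" by (auto simp: refl_on_def lp_rel_def nrm_zero)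
  show "sym null_rel"
    by (rule symI) (auto simp: lp_rel_def cauchy_seqs_in nrm_diff_commute)
  show "trans null_rel"
  proof (rule transI)
    fix X Y Z assume XY: "(X, Y) \<in> null_rel" and YZ: "(Y, Z) \<in> null_rel"
    note D = null_relD[OF XY] null_relD[OF YZ]
    show "(X, Z) \<in> null_rel"
    proof (rule null_relI[OF D(1,5)])
      show "nrm (X k - Z k) \<le> nrm (X k - Y k) + nrm (Y k - Z k)" for k
        using D by (intro nrm_triangle_diff) (auto intro: cauchy_seqs_in)
      show "(\<lambda>k. nrm (X k - Y k) + nrm (Y k - Z k)) \<longlonglongrightarrow> 0"
        using tendsto_add[OF D(3,6)] by simp
    qed
  qed
qed

lemma Lp_eq_class:
  assumes "x \<in> Lp" "X \<in> x"
  shows "x = null_rel `` {X}"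
proof -
  obtain Y where Y: "x = null_rel `` {Y}" using assms(1) unfolding lp_space_def by (rule quotientE)
  with assms(2) have "(Y, X) \<in> null_rel" by simp
  from equiv_class_eq[OF equiv_null_rel this] show ?thesis using Y by simp
qed

lemma Lp_null:
  assumes "x \<in> Lp" "X \<in> x" "Y \<in> x"
  shows "(X, Y) \<in> null_rel"
  using Lp_eq_class[OF assms(1,2)] assms(3) by simp

lemma Lp_cauchy: "x \<in> Lp \<Longrightarrow> X \<in> x \<Longrightarrow> X \<in> cauchy_seqs"
  using Lp_null[of x X X] null_relD(1) by simp

lemma Lp_nonempty:
  assumes "x \<in> Lp"
  shows "\<exists>X. X \<in> x"
  using in_quotient_imp_non_empty[OF equiv_null_rel] assms unfolding lp_space_def by fast

lemma class_in_Lp: "X \<in> cauchy_seqs \<Longrightarrow> null_rel `` {X} \<in> Lp"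
  unfolding lp_space_def by (rule quotientI)

lemma in_class: "X \<in> cauchy_seqs \<Longrightarrow> X \<in> null_rel `` {X}"
  by (rule equiv_class_self[OF equiv_null_rel])

lemma lp_embed_rep:
  assumes "T \<in> A"
  shows "lp_embed A \<tau> (2 * m) T \<in> Lp" "(\<lambda>_. T) \<in> lp_embed A \<tau> (2 * m) T"
  unfolding lp_embed_def by (intro class_in_Lp in_class cauchy_seqs_const assms)+

lemma lp_add_rep:
  assumes x: "x \<in> Lp" "X \<in> x" and y: "y \<in> Lp" "Y \<in> y"
  shows "lp_add A \<tau> (2 * m) x y \<in> Lp" "(\<lambda>k. X k + Y k) \<in> lp_add A \<tau> (2 * m) x y"
proof -
  have X: "X \<in> cauchy_seqs" and Y: "Y \<in> cauchy_seqs" using x y Lp_cauchy by auto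
  have "((\<lambda>k. X k + Y k), (\<lambda>k. X' k + Y' k)) \<in> null_rel" if "X' \<in> x" "Y' \<in> y" for X' Y'
  proof (rule null_relI)
    have X': "X' \<in> cauchy_seqs" and Y': "Y' \<in> cauchy_seqs" using x y that Lp_cauchy by auto
    show "(\<lambda>k. X k + Y k) \<in> cauchy_seqs" "(\<lambda>k. X' k + Y' k) \<in> cauchy_seqs"
      using X Y X' Y' by (auto intro: cauchy_seqs_add)
    show "nrm (X k + Y k - (X' k + Y' k)) \<le> nrm (X k - X' k) + nrm (Y k - Y' k)" for k
      using nrm_triangle[of "X k - X' k" "Y k - Y' k"] X Y X' Y'
      by (simp add: diff_in cauchy_seqs_in algebra_simps)
    show "(\<lambda>k. nrm (X k - X' k) + nrm (Y k - Y' k)) \<longlonglongrightarrow> 0"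
      using tendsto_add[OF null_relD(3)[OF Lp_null[OF x that(1)]] null_relD(3)[OF Lp_null[OF y that(2)]]] by simp
  qed
  note rel = this
  have "null_rel `` {(\<lambda>k. X' k + Y' k)} = null_rel `` {(\<lambda>k. X k + Y k)}" if "X' \<in> x" "Y' \<in> y" for X' Y'
    by (rule equiv_class_eq[OF equiv_null_rel, symmetric, OF rel]) (rule that)+
  then have "lp_add A \<tau> (2 * m) x y = null_rel `` {(\<lambda>k. X k + Y k)}"
    unfolding lp_add_def using x(2) y(2) by blast
  then show "lp_add A \<tau> (2 * m) x y \<in> Lp" "(\<lambda>k. X k + Y k) \<in> lp_add A \<tau> (2 * m) x y"
    using cauchy_seqs_add[OF X Y] class_in_Lp in_class by auto
qed

lemma lp_scale_rep:
  assumes x: "x \<in> Lp" "X \<in> x"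
  shows "lp_scale A \<tau> (2 * m) c x \<in> Lp" "(\<lambda>k. scale_op c (X k)) \<in> lp_scale A \<tau> (2 * m) c x"
proof -
  have X: "X \<in> cauchy_seqs" using x Lp_cauchy by auto
  have "((\<lambda>k. scale_op c (X k)), (\<lambda>k. scale_op c (X' k))) \<in> null_rel" if "X' \<in> x" for X'
  proof (rule null_relI)
    have X': "X' \<in> cauchy_seqs" using x that Lp_cauchy by auto
    show "(\<lambda>k. scale_op c (X k)) \<in> cauchy_seqs" "(\<lambda>k. scale_op c (X' k)) \<in> cauchy_seqs"
      using X X' by (auto intro: cauchy_seqs_scale)
    show "nrm (scale_op c (X k) - scale_op c (X' k)) \<le> cmod c * nrm (X k - X' k)" for k
      using nrm_scale[of "X k - X' k" c] X X' by (simp add: diff_in cauchy_seqs_in scale_op_diff_right)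
    show "(\<lambda>k. cmod c * nrm (X k - X' k)) \<longlonglongrightarrow> 0"
      using tendsto_mult_right_zero[OF null_relD(3)[OF Lp_null[OF x that]]] by simp
  qed
  note rel = this
  have "null_rel `` {(\<lambda>k. scale_op c (X' k))} = null_rel `` {(\<lambda>k. scale_op c (X k))}" if "X' \<in> x" for X'
    by (rule equiv_class_eq[OF equiv_null_rel, symmetric, OF rel]) (rule that)
  then have "lp_scale A \<tau> (2 * m) c x = null_rel `` {(\<lambda>k. scale_op c (X k))}"
    unfolding lp_scale_def using x(2) by blast
  then show "lp_scale A \<tau> (2 * m) c x \<in> Lp" "(\<lambda>k. scale_op c (X k)) \<in> lp_scale A \<tau> (2 * m) c x"
    using cauchy_seqs_scale[OF X] class_in_Lp in_class by auto
qed

text \<open>The norm of a matrix over \<open>L\<^sub>p\<close> is computed entrywise: convergence in each entry is convergence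
  in the norm of the matrix algebra, since a matrix is the finite sum of its entries.\<close>

lemma mat_lp_norm_limit:
  fixes z :: "'a lp_elem ^ 'n ^ 'n"
  assumes z: "\<And>i j. z $ i $ j \<in> Lp" and Z: "\<And>i j. Z i j \<in> z $ i $ j"
  shows "(\<lambda>k. op_lp_norm (mat_trace \<tau>) (2 * m) (\<Sum>i\<in>UNIV. \<Sum>j\<in>UNIV. munit i j (Z i j k) :: ('a ^ 'n) \<Rightarrow>\<^sub>L ('a ^ 'n)))
    \<longlonglongrightarrow> mat_lp_norm A \<tau> (2 * m) z"
proof -
  interpret MA: star_trace "mat_algebra A :: (('a ^ 'n) \<Rightarrow>\<^sub>L ('a ^ 'n)) set" "mat_trace \<tau>"
    by (rule star_trace_mat_algebra)
  interpret M: star_trace_lp "mat_algebra A :: (('a ^ 'n) \<Rightarrow>\<^sub>L ('a ^ 'n)) set" "mat_trace \<tau>" m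
    by unfold_locales (rule m_pos)
  define W where "W k = (\<Sum>i\<in>UNIV. \<Sum>j\<in>UNIV. munit i j (Z i j k) :: ('a ^ 'n) \<Rightarrow>\<^sub>L ('a ^ 'n))" for k
  have Zc: "Z i j \<in> cauchy_seqs" for i j using z Z Lp_cauchy by blast
  have unit_cauchy: "(\<lambda>k. munit i j (X k)) \<in> M.cauchy_seqs" if X: "X \<in> cauchy_seqs" for i j X
    unfolding lp_cauchy_def mem_Collect_eq
  proof (intro conjI allI impI)
    fix k show "munit i j (X k) \<in> mat_algebra A" using X by (simp add: munit_in cauchy_seqs_in)
  next
    fix e :: real assume e: "e > 0"
    obtain K where K: "\<And>k l. k \<ge> K \<Longrightarrow> l \<ge> K \<Longrightarrow> nrm (X k - X l) < e"
      using cauchy_seqsD[OF X e] by blast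
    have "M.nrm (munit i j (X k) - munit i j (X l)) < e" if "k \<ge> K" "l \<ge> K" for k l
      using lp_norm_munit_le[OF diff_in m_pos, of "X k" "X l" i j] K[OF that] X
      by (simp add: cauchy_seqs_in munit_diff)
    then show "\<exists>N. \<forall>k\<ge>N. \<forall>l\<ge>N. M.nrm (munit i j (X k) - munit i j (X l)) < e" by blast
  qed
  have Wc: "W \<in> M.cauchy_seqs"
    unfolding W_def by (intro M.cauchy_seqs_sum unit_cauchy Zc)
  have entryW: "entry (W k) i j = Z i j k" for k i j
    unfolding W_def by (rule entry_sum_munit)
  have W_in: "W \<in> lp_of_matrix A \<tau> (2 * m) z"
    using Wc Z by (simp add: lp_of_matrix_def entryW)
  obtain r where r: "(\<lambda>k. M.nrm (W k)) \<longlonglongrightarrow> r" using M.cauchy_seqs_norm_convergent[OF Wc] by blast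
  have all: "(\<lambda>k. M.nrm (V k)) \<longlonglongrightarrow> r" if V: "V \<in> lp_of_matrix A \<tau> (2 * m) z" for V
  proof -
    have Vc: "V \<in> M.cauchy_seqs" and Ve: "(\<lambda>k. entry (V k) i j) \<in> z $ i $ j" for i j
      using V by (auto simp: lp_of_matrix_def)
    have dA: "entry (V k) i j - Z i j k \<in> A" for i j k
      using cauchy_seqs_in[OF Lp_cauchy[OF z Ve]] cauchy_seqs_in[OF Zc] by (intro diff_in) auto
    have "M.nrm (V k - W k) \<le> (\<Sum>i\<in>UNIV. \<Sum>j\<in>UNIV. nrm (entry (V k) i j - Z i j k))" for k
    proof -
      have "V k - W k = (\<Sum>i\<in>UNIV. \<Sum>j\<in>UNIV. munit i j (entry (V k) i j - Z i j k))"
        by (subst sum_munit_entries[of "V k - W k"]) (simp add: entry_diff entryW)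
      then have "M.nrm (V k - W k) = M.nrm (\<Sum>i\<in>UNIV. \<Sum>j\<in>UNIV. munit i j (entry (V k) i j - Z i j k))" by simp
      also have "\<dots> \<le> (\<Sum>i\<in>UNIV. M.nrm (\<Sum>j\<in>UNIV. munit i j (entry (V k) i j - Z i j k)))"
        by (intro M.nrm_sum_le MA.sum_in munit_in dA)
      also have "\<dots> \<le> (\<Sum>i\<in>UNIV. \<Sum>j\<in>UNIV. M.nrm (munit i j (entry (V k) i j - Z i j k)))"
        by (intro sum_mono M.nrm_sum_le munit_in dA)
      also have "\<dots> \<le> (\<Sum>i\<in>UNIV. \<Sum>j\<in>UNIV. nrm (entry (V k) i j - Z i j k))"
        by (intro sum_mono lp_norm_munit_le dA m_pos)
      finally show ?thesis .
    qed
    moreover have "(\<lambda>k. \<Sum>i\<in>UNIV. \<Sum>j\<in>UNIV. nrm (entry (V k) i j - Z i j k)) \<longlonglongrightarrow> 0"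
      using null_relD(3)[OF Lp_null[OF z Ve Z]] by (intro tendsto_null_sum) auto
    ultimately have "(V, W) \<in> M.null_rel" by (intro M.null_relI[OF Vc Wc])
    then have "(\<lambda>k. M.nrm (V k - W k)) \<longlonglongrightarrow> 0" by (rule M.null_relD)
    then have "(\<lambda>k. M.nrm (V k) - M.nrm (W k)) \<longlonglongrightarrow> 0"
      by (rule Lim_null_comparison[rotated])
         (use M.nrm_diff_le M.cauchy_seqs_in[OF Vc] M.cauchy_seqs_in[OF Wc] in auto)
    from tendsto_add[OF this r] show ?thesis by simp
  qed
  have "mat_lp_norm A \<tau> (2 * m) z = r"
    unfolding mat_lp_norm_def lp_norm_def
  proof (rule the_equality)
    show "s = r" if "\<forall>X\<in>lp_of_matrix A \<tau> (2 * m) z. (\<lambda>k. M.nrm (X k)) \<longlonglongrightarrow> s" for s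
      using LIMSEQ_unique that W_in r by blast
  qed (use all in blast)
  then show ?thesis using r by (simp add: W_def)
qed

end

section \<open>Closed walks\<close>

primrec walk :: "'v \<Rightarrow> ('v \<times> 'v) list \<Rightarrow> 'v \<Rightarrow> bool" where
  "walk a [] b \<longleftrightarrow> a = b"
| "walk a (e # es) b \<longleftrightarrow> fst e = a \<and> walk (snd e) es b"

lemma walk_nth:
  assumes "walk a es b" "i < length es"
  shows "snd (es ! i) = (if Suc i < length es then fst (es ! Suc i) else b)"
  using assms
proof (induction es arbitrary: a i)
  case (Cons e es)
  then show ?case by (cases i; cases es) auto
qed simp

lemma closed_walk_nth:
  assumes "walk a es a" "i < length es"
  shows "snd (es ! i) = fst (es ! (Suc i mod length es))"
proof (cases "Suc i < length es")
  case False
  then have "Suc i = length es" using assms(2) by simp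
  moreover have "fst (es ! 0) = a" using assms by (cases es) auto
  ultimately show ?thesis using walk_nth[OF assms] by simp
qed (use walk_nth[OF assms] in simp)

text \<open>The staircase \<open>0, 0, 1, 1, 2, 2, \<dots>\<close>, closed up at step \<open>d\<close>: it visits a loop at each vertex
  between consecutive steps to the next vertex.\<close>

definition staircase :: "nat \<Rightarrow> nat \<Rightarrow> nat" where
  "staircase d l = (if l < d then l div 2 else 0)"

text \<open>The edges \<open>l\<close>, from \<open>staircase d l\<close> to \<open>staircase d (Suc l)\<close>, form a multigraph with a single
  Eulerian circuit: at a vertex with a loop, the circuit takes the loop between entering and leaving,
  for otherwise the loop would be followed by itself.\<close>

lemma staircase_successor:
  assumes dist: "distinct ns" and set: "set ns = {..<d}"
    and walk: "\<And>i. i < d \<Longrightarrow> staircase d (Suc (ns ! i)) = staircase d (ns ! (Suc i mod d))"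
    and i: "i < d"
  shows "ns ! (Suc i mod d) = Suc (ns ! i) mod d"
proof -
  have len: "length ns = d" using distinct_card[OF dist] set by simp
  have lt: "ns ! j < d" if "j < d" for j using that len set nth_mem by blast
  have inj: "j = k" if "ns ! j = ns ! k" "j < d" "k < d" for j k
    using that dist len by (simp add: nth_eq_iff_index_eq)
  have next_lt: "Suc j mod d < d" for j using i by simp
  have next_inj: "j = k" if "Suc j mod d = Suc k mod d" "j < d" "k < d" for j k
    using that by (auto simp: mod_Suc split: if_splits)
  have next_ne: "Suc j mod d \<noteq> j" if "j < d" "d > 1" for j
    using that by (auto simp: mod_Suc)
  have eq: "staircase d (Suc (ns ! j)) = ns ! (Suc j mod d) div 2" if "j < d" for j
    using walk[OF that] lt[OF next_lt, of j] by (simp add: staircase_def)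
  have even_step: "ns ! (Suc j mod d) = Suc (ns ! j)" if "j < d" "even (ns ! j)" "Suc (ns ! j) < d" for j
  proof -
    have "ns ! j div 2 = ns ! (Suc j mod d) div 2" using eq[OF that(1)] that by (simp add: staircase_def)
    then have "ns ! (Suc j mod d) = ns ! j \<or> ns ! (Suc j mod d) = Suc (ns ! j)"
      using that(2) by presburger
    moreover have "ns ! (Suc j mod d) \<noteq> ns ! j"
      using inj[OF _ next_lt that(1)] next_ne[OF that(1)] that(3) by force
    ultimately show ?thesis by blast
  qed
  let ?a = "ns ! i" and ?b = "ns ! (Suc i mod d)"
  have not_after_even: False if c: "even c" "Suc c < d" "?b = Suc c" "c \<noteq> ?a" for c
  proof -
    obtain j where j: "j < d" "ns ! j = c"
      using c(2) set len by (metis Suc_lessD in_set_conv_nth lessThan_iff)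
    have "ns ! (Suc j mod d) = ?b" using even_step[OF j(1)] j c by simp
    then have "j = i" using inj next_lt next_inj j(1) i by blast
    then show False using j c by simp
  qed
  consider "Suc ?a < d" "even ?a" | "Suc ?a < d" "odd ?a" | "Suc ?a = d" using lt[OF i] by linarith
  then show ?thesis
  proof cases
    case 1
    then show ?thesis using even_step[OF i] by simp
  next
    case 2
    then have "Suc ?a div 2 = ?b div 2" using eq[OF i] by (simp add: staircase_def)
    then have "?b = Suc ?a \<or> ?b = Suc (Suc ?a)" using 2(2) by presburger
    then show ?thesis using not_after_even[of "Suc ?a"] 2 lt[OF next_lt, of i] by auto
  next
    case 3
    then have "?b div 2 = 0" using eq[OF i] by (simp add: staircase_def)
    then have "?b = 0 \<or> ?b = Suc 0" by presburger
    then show ?thesis using not_after_even[of 0] 3 lt[OF next_lt, of i] by auto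
  qed
qed

lemma staircase_euler_circuit:
  assumes dist: "distinct ns" and set: "set ns = {..<d}"
    and walk: "\<And>i. i < d \<Longrightarrow> staircase d (Suc (ns ! i)) = staircase d (ns ! (Suc i mod d))"
  shows "\<exists>k. rotate k ns = [0..<d]"
proof (cases "d = 0")
  case True
  then show ?thesis using set by simp
next
  case False
  have len: "length ns = d" using distinct_card[OF dist] set by simp
  obtain k where k: "k < d" "ns ! k = 0"
    using False set len by (metis in_set_conv_nth lessThan_iff neq0_conv)
  have "ns ! ((k + j) mod d) = j" if "j < d" for j
    using that
  proof (induction j)
    case 0
    then show ?case using k by simp
  next
    case (Suc j)
    have "ns ! (Suc ((k + j) mod d) mod d) = Suc (ns ! ((k + j) mod d)) mod d"
      using False by (intro staircase_successor[OF dist set walk]) auto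
    then show ?case using Suc by (simp add: mod_Suc_eq)
  qed
  then have "rotate k ns = [0..<d]"
    by (intro nth_equalityI) (simp_all add: len nth_rotate)
  then show ?thesis by blast
qed

section \<open>Expansion of the norm into words\<close>

text \<open>The alternating pattern of stars along a word; \<open>True\<close> marks a starred position.\<close>

primrec flags :: "nat \<Rightarrow> bool \<Rightarrow> bool list" where
  "flags 0 b = []"
| "flags (Suc n) b = b # flags n (\<not> b)"

lemma length_flags [simp]: "length (flags n b) = n" by (induction n arbitrary: b) auto

definition star_if :: "bool \<Rightarrow> ('a :: complex_hilbert_space \<Rightarrow>\<^sub>L 'a) \<Rightarrow> ('a \<Rightarrow>\<^sub>L 'a)" where
  "star_if b T = (if b then adj T else T)"

lemma alt_word_flags: "T \<in> bop \<Longrightarrow> alt_word n (star_if b T) = map (\<lambda>b. star_if b T) (flags n b)"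
proof (induction n arbitrary: b)
  case (Suc n)
  have "adj (star_if b T) = star_if (\<not> b) T" using Suc.prems by (simp add: star_if_def adj_adj)
  then show ?case using Suc by simp
qed simp

lemma bop_sum: "(\<And>i. i \<in> I \<Longrightarrow> f i \<in> bop) \<Longrightarrow> (\<Sum>i\<in>I. f i) \<in> bop"
  by (induction I rule: infinite_finite_induct) (auto intro: bop_add)

lemma adj_sum: "(\<And>i. i \<in> I \<Longrightarrow> f i \<in> bop) \<Longrightarrow> adj (\<Sum>i\<in>I. f i) = (\<Sum>i\<in>I. adj (f i))"
proof (induction I rule: infinite_finite_induct)
  case (insert i I)
  then show ?case by (simp add: adj_add bop_sum)
qed (auto intro: adjI)

definition words :: "'o set \<Rightarrow> nat \<Rightarrow> 'o list set" where
  "words Q n = {os. set os \<subseteq> Q \<and> length os = n}"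

lemma finite_words: "finite Q \<Longrightarrow> finite (words Q n)"
  unfolding words_def by (rule finite_lists_length_eq)

lemma sum_words_Suc:
  "(\<Sum>os\<in>words Q (Suc n). f os) = (\<Sum>x\<in>Q. \<Sum>os\<in>words Q n. f (x # os))"
proof -
  have "bij_betw (\<lambda>(x, os). x # os) (Q \<times> words Q n) (words Q (Suc n))"
    by (rule bij_betwI[where g = "\<lambda>os. (hd os, tl os)"]) (auto simp: words_def length_Suc_conv)
  then have "(\<Sum>os\<in>words Q (Suc n). f os) = (\<Sum>(x, os)\<in>Q \<times> words Q n. f (x # os))"
    by (simp add: sum.reindex_bij_betw[symmetric] case_prod_unfold)
  then show ?thesis by (simp add: sum.cartesian_product)
qed

lemma oprod_sum_words:
  "oprod (map (\<lambda>b. \<Sum>x\<in>Q. g (b, x)) bs) = (\<Sum>os\<in>words Q (length bs). oprod (map g (zip bs os)))"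
proof (induction bs)
  case Nil
  have "words Q 0 = {[]}" by (auto simp: words_def)
  then show ?case by simp
next
  case (Cons b bs)
  then show ?case by (simp add: sum_words_Suc compose_sum_left) (simp add: compose_sum_right)
qed

lemma entry_oprod_munit:
  "entry (oprod (map (\<lambda>x. munit (s x) (t x) (g x)) w)) a b =
    (if walk a (map (\<lambda>x. (s x, t x)) w) b then oprod (map g w) else 0)"
proof (induction w arbitrary: a)
  case (Cons x w)
  have "entry (munit (s x) (t x) (g x) o\<^sub>L oprod (map (\<lambda>x. munit (s x) (t x) (g x)) w)) a b
      = (\<Sum>k\<in>UNIV. if k = t x then (if a = s x then g x o\<^sub>L entry (oprod (map (\<lambda>x. munit (s x) (t x) (g x)) w)) (t x) b else 0) else 0)"
    unfolding entry_compose by (rule sum.cong) (auto simp: entry_munit)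
  also have "\<dots> = (if a = s x then g x o\<^sub>L entry (oprod (map (\<lambda>x. munit (s x) (t x) (g x)) w)) (t x) b else 0)"
    by simp
  finally show ?case unfolding Cons.IH by auto
qed (simp add: entry_id)

text \<open>A letter \<open>x\<close> stands for \<open>e\<^bsub>r(x), c(x)\<^esub> \<otimes> V(x)\<close>. Its adjoint carries the transposed matrix unit, so
  starred letters are walked along in the opposite direction.\<close>

definition letter_edge :: "('o \<Rightarrow> 'v) \<Rightarrow> ('o \<Rightarrow> 'v) \<Rightarrow> bool \<times> 'o \<Rightarrow> 'v \<times> 'v" where
  "letter_edge r c x = (if fst x then (c (snd x), r (snd x)) else (r (snd x), c (snd x)))"

definition letter_op :: "('o \<Rightarrow> ('a :: complex_hilbert_space \<Rightarrow>\<^sub>L 'a)) \<Rightarrow> bool \<times> 'o \<Rightarrow> ('a \<Rightarrow>\<^sub>L 'a)" where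
  "letter_op V x = star_if (fst x) (V (snd x))"

context star_trace
begin

lemma letter_op_in: "V (snd x) \<in> A \<Longrightarrow> letter_op V x \<in> A"
  by (simp add: letter_op_def star_if_def adj_in)

text \<open>A product of elementary tensors vanishes unless the matrix units form a walk, and has trace zero
  unless the walk is closed.\<close>

lemma mat_trace_alt_word_expand:
  fixes r c :: "'o \<Rightarrow> 'n :: finite"
  assumes V: "\<And>x. x \<in> Q \<Longrightarrow> V x \<in> A" and fin: "finite Q"
  shows "mat_trace \<tau> (oprod (alt_word n (\<Sum>x\<in>Q. munit (r x) (c x) (V x)))) =
    (\<Sum>os\<in>words Q n. of_nat (card {a. walk a (map (letter_edge r c) (zip (flags n False) os)) a}) / of_nat CARD('n)
      * \<tau> (oprod (map (letter_op V) (zip (flags n False) os))))"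
proof -
  let ?W = "\<Sum>x\<in>Q. munit (r x) (c x) (V x)"
  interpret MA: star_trace "mat_algebra A :: (('a ^ 'n) \<Rightarrow>\<^sub>L ('a ^ 'n)) set" "mat_trace \<tau>"
    by (rule star_trace_mat_algebra)
  define g where "g x = munit (fst (letter_edge r c x)) (snd (letter_edge r c x)) (letter_op V x)" for x
  have g_fun: "g = (\<lambda>x. munit (fst (letter_edge r c x)) (snd (letter_edge r c x)) (letter_op V x))"
    by (simp add: g_def fun_eq_iff)
  have Wb: "?W \<in> bop" using V by (intro bop_sum bop_munit in_bop)
  have star: "star_if b ?W = (\<Sum>x\<in>Q. g (b, x))" for b
  proof (cases b)
    case True
    have "adj ?W = (\<Sum>x\<in>Q. munit (c x) (r x) (adj (V x)))"
      using V by (subst adj_sum) (auto simp: adj_munit bop_munit in_bop)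
    then show ?thesis using True by (simp add: star_if_def g_def letter_edge_def letter_op_def)
  qed (simp add: star_if_def g_def letter_edge_def letter_op_def)
  have word_in: "oprod (map (letter_op V) (zip bs os)) \<in> A" if "set os \<subseteq> Q" for bs os
    using that V by (intro oprod_in) (auto intro!: letter_op_in dest: set_zip_rightD)
  have g_in: "oprod (map g (zip bs os)) \<in> mat_algebra A" if "set os \<subseteq> Q" for bs os
    using that V by (intro MA.oprod_in) (auto simp: g_def intro!: munit_in letter_op_in dest: set_zip_rightD)
  have trace_g: "mat_trace \<tau> (oprod (map g w)) =
      of_nat (card {a. walk a (map (letter_edge r c) w) a}) / of_nat CARD('n) * \<tau> (oprod (map (letter_op V) w))" for w
  proof -
    have "(\<Sum>a\<in>UNIV. \<tau> (entry (oprod (map g w)) a a)) =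
        (\<Sum>a\<in>UNIV. if walk a (map (letter_edge r c) w) a then \<tau> (oprod (map (letter_op V) w)) else 0)"
      by (rule sum.cong) (simp_all add: g_fun entry_oprod_munit trace_zero)
    also have "\<dots> = of_nat (card {a. walk a (map (letter_edge r c) w) a}) * \<tau> (oprod (map (letter_op V) w))"
      by (simp add: sum.If_cases)
    finally show ?thesis by (simp add: mat_trace_def)
  qed
  have "alt_word n ?W = map (\<lambda>b. star_if b ?W) (flags n False)"
    using alt_word_flags[OF Wb, of n False] by (simp add: star_if_def)
  then have "oprod (alt_word n ?W) = (\<Sum>os\<in>words Q n. oprod (map g (zip (flags n False) os)))"
    by (simp add: star oprod_sum_words)
  also have "mat_trace \<tau> \<dots> = (\<Sum>os\<in>words Q n. mat_trace \<tau> (oprod (map g (zip (flags n False) os))))"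
    by (rule MA.trace_sum) (auto simp: words_def intro: g_in)
  finally show ?thesis by (simp add: trace_g)
qed

end

text \<open>The unit of \<open>M\<^sub>n \<otimes> M\<close> is the sum of the diagonal tensors \<open>e\<^sub>a\<^sub>a \<otimes> 1\<close>. In the expansion of \<open>1 + x\<close>, a position
  of a word therefore carries either a vertex \<open>a\<close> (\<open>Inl\<close>), standing for \<open>e\<^sub>a\<^sub>a \<otimes> 1\<close>, or a letter of \<open>x\<close>
  (\<open>Inr\<close>). The trace of a word only depends on its letters.\<close>

fun letters :: "(bool \<times> ('v + 'l)) list \<Rightarrow> (bool \<times> 'l) list" where
  "letters [] = []"
| "letters ((b, Inl a) # w) = letters w"
| "letters ((b, Inr l) # w) = (b, l) # letters w"

lemma length_letters_le: "length (letters w) \<le> length w"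
  by (induction w rule: letters.induct) auto

lemma letters_subset: "x \<in> set (letters w) \<Longrightarrow> (fst x, Inr (snd x)) \<in> set w"
  by (induction w rule: letters.induct) auto

lemma oprod_letters:
  "oprod (map (letter_op (case_sum (\<lambda>_. id_blinfun) V)) w) = oprod (map (letter_op V) (letters w))"
  by (induction w rule: letters.induct) (simp_all add: letter_op_def star_if_def)

lemma letter_edge_sum [simp]:
  "letter_edge (case_sum id r) (case_sum id c) (b, Inl a) = (a, a)"
  "letter_edge (case_sum id r) (case_sum id c) (b, Inr l) = letter_edge r c (b, l)"
  by (simp_all add: letter_edge_def)

lemma walk_letters:
  "walk a (map (letter_edge (case_sum id r) (case_sum id c)) w) b \<Longrightarrow> walk a (map (letter_edge r c) (letters w)) b"
  by (induction w arbitrary: a rule: letters.induct) auto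

text \<open>Closed walks are counted with their starting vertex, and divided by the dimension as in the
  normalized trace.\<close>

definition walk_weight :: "('l \<Rightarrow> 'v :: finite) \<Rightarrow> ('l \<Rightarrow> 'v) \<Rightarrow> nat \<Rightarrow> ('v + 'l) list \<Rightarrow> real" where
  "walk_weight r c n os =
    card {a. walk a (map (letter_edge (case_sum id r) (case_sum id c)) (zip (flags n False) os)) a} / CARD('v)"

context star_trace
begin

lemma mat_trace_one_plus_expand:
  fixes r c :: "'l \<Rightarrow> 'n :: finite"
  assumes V: "\<And>l. l \<in> L \<Longrightarrow> V l \<in> A" and fin: "finite L"
  shows "mat_trace \<tau> (oprod (alt_word n (id_blinfun + (\<Sum>l\<in>L. munit (r l) (c l) (V l))))) =
    (\<Sum>os\<in>words (UNIV <+> L) n. of_real (walk_weight r c n os)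
      * \<tau> (oprod (map (letter_op V) (letters (zip (flags n False) os)))))"
proof -
  let ?V = "case_sum (\<lambda>_. id_blinfun) V"
  have eq: "id_blinfun + (\<Sum>l\<in>L. munit (r l) (c l) (V l)) =
      (\<Sum>x\<in>UNIV <+> L. munit (case_sum id r x) (case_sum id c x) (?V x))"
    by (simp add: sum.Plus fin id_eq_sum_munit)
  have V_in: "?V x \<in> A" if "x \<in> UNIV <+> L" for x
    using that V id_in by auto
  show ?thesis
    unfolding eq
    by (subst mat_trace_alt_word_expand[OF V_in]) (simp_all add: fin walk_weight_def oprod_letters)
qed

end

section \<open>Extraction of a multilinear coefficient\<close>

lemma interpolation_poly:
  fixes z :: "'a :: field"
  assumes "finite S" "z \<notin> S"
  shows "\<exists>Q. poly Q z = 1 \<and> (\<forall>s\<in>S. poly Q s = 0)"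
proof -
  let ?R = "\<Prod>s\<in>S. [:- s, 1:]"
  have "poly ?R z \<noteq> 0" using assms by (auto simp: poly_prod)
  moreover have "\<forall>s\<in>S. poly ?R s = 0" using assms(1) by (auto simp: poly_prod)
  ultimately show ?thesis
    by (intro exI[of _ "smult (1 / poly ?R z) ?R"]) auto
qed

text \<open>The number \<open>2\<i>\<close> is separated from all other monomials \<open>(2\<i>)\<^sup>x (-2\<i>)\<^sup>y\<close>: by its modulus unless
  \<open>x + y = 1\<close>, and from its conjugate because it is not real. The coefficients of the polynomials
  below are therefore weights for the points \<open>t = (2\<i>)\<^sup>s\<close> that extract the coefficient of
  \<open>t\<close>, respectively of its conjugate, from a polynomial in \<open>t\<close> and its conjugate.\<close>

lemma probe_poly_exists:
  "\<exists>Q :: bool \<Rightarrow> complex poly. \<forall>b x y. x + y \<le> n \<longrightarrow>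
    poly (Q b) ((2 * \<i>) ^ x * (- (2 * \<i>)) ^ y) =
      (if x = (if b then 0 else 1) \<and> y = (if b then 1 else 0) then 1 else 0)"
proof -
  have "\<exists>Q :: complex poly. \<forall>x y. x + y \<le> n \<longrightarrow>
    poly Q ((2 * \<i>) ^ x * (- (2 * \<i>)) ^ y) =
      (if x = (if b then 0 else 1) \<and> y = (if b then 1 else 0) then 1 else 0)" for b :: bool
  proof -
    define \<mu> :: "nat \<times> nat \<Rightarrow> complex" where "\<mu> = (\<lambda>(x, y). (2 * \<i>) ^ x * (- (2 * \<i>)) ^ y)"
    define xy :: "nat \<times> nat" where "xy = (if b then (0, 1) else (1, 0))"
    define I where "I = ({..n} \<times> {..n}) - {xy}"
    have sep: "p = xy" if eq: "\<mu> p = \<mu> xy" for p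
    proof -
      obtain x y where p: "p = (x, y)" by (cases p)
      have "cmod (\<mu> p) = 2 ^ (x + y)" by (simp add: \<mu>_def p norm_mult norm_power power_add)
      moreover have "cmod (\<mu> xy) = 2" by (simp add: \<mu>_def xy_def norm_mult)
      ultimately have "(2 :: real) ^ (x + y) = 2 ^ 1" using eq by simp
      then have "x + y = 1" by (subst (asm) power_inject_exp) auto
      then have "p = (0, 1) \<or> p = (1, 0)" unfolding p by auto
      then show ?thesis using eq by (auto simp: \<mu>_def xy_def complex_eq_iff split: if_splits)
    qed
    have "finite (\<mu> ` I)" by (simp add: I_def)
    moreover have "\<mu> xy \<notin> \<mu> ` I" using sep by (force simp: I_def)
    ultimately obtain Q where Q: "poly Q (\<mu> xy) = 1" "\<forall>s\<in>\<mu> ` I. poly Q s = 0"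
      using interpolation_poly by blast
    have "poly Q (\<mu> (x, y)) = (if x = (if b then 0 else 1) \<and> y = (if b then 1 else 0) then 1 else 0)"
      if le: "x + y \<le> n" for x y
    proof (cases "(x, y) = xy")
      case True
      then show ?thesis using Q(1) by (auto simp: xy_def split: if_splits)
    next
      case False
      then have "(x, y) \<in> I" using le by (simp add: I_def)
      then show ?thesis using Q(2) False by (auto simp: xy_def split: if_splits)
    qed
    then show ?thesis unfolding \<mu>_def prod.case by blast
  qed
  then show ?thesis by (rule choice[OF allI])
qed

text \<open>The letters \<open>ls\<close> contribute to the coefficient of the monomial that contains each of the variables
  \<open>t\<^sub>l\<close>, \<open>l < d\<close>, exactly once, and conjugated precisely if \<open>\<beta> l\<close> holds.\<close>

definition multilinear :: "(nat \<Rightarrow> bool) \<Rightarrow> nat \<Rightarrow> (bool \<times> nat) list \<Rightarrow> bool" where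
  "multilinear \<beta> d ls \<longleftrightarrow> (\<forall>l<d. count_list ls (\<beta> l, l) = 1 \<and> count_list ls (\<not> \<beta> l, l) = 0)"

lemma count_list_pair_le: "count_list ls (False, l) + count_list ls (True, l) \<le> length ls"
  by (induction ls) auto

lemma distinct_if_count_list: "(\<And>x. x \<in> set ls \<Longrightarrow> count_list ls x = 1) \<Longrightarrow> distinct ls"
proof (induction ls)
  case (Cons y ls)
  have "y \<notin> set ls" using Cons.prems[of y] by (simp add: count_list_0_iff)
  moreover have "count_list ls x = 1" if "x \<in> set ls" for x
    using Cons.prems[of x] that \<open>y \<notin> set ls\<close> by (auto split: if_splits)
  ultimately show ?case using Cons.IH by simp
qed simp

lemma multilinear_letters:
  assumes ml: "multilinear \<beta> d ls" and sub: "snd ` set ls \<subseteq> {..<d}"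
  shows "ls = map (\<lambda>l. (\<beta> l, l)) (map snd ls)" "distinct (map snd ls)" "set (map snd ls) = {..<d}"
proof -
  have flag: "fst x = \<beta> (snd x)" if "x \<in> set ls" for x
  proof (rule ccontr)
    assume ne: "fst x \<noteq> \<beta> (snd x)"
    then have x: "x = (\<not> \<beta> (snd x), snd x)" by (cases x) auto
    have "count_list ls (\<not> \<beta> (snd x), snd x) = 0" using ml sub that by (auto simp: multilinear_def)
    then show False using that x by (metis count_list_0_iff)
  qed
  show eq: "ls = map (\<lambda>l. (\<beta> l, l)) (map snd ls)"
    unfolding map_map by (rule map_idI[symmetric]) (use flag in \<open>auto simp: prod_eq_iff\<close>)
  have "distinct ls"
  proof (rule distinct_if_count_list)
    fix x assume x: "x \<in> set ls"
    then have "x = (\<beta> (snd x), snd x)" using flag[OF x] by (simp add: prod_eq_iff)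
    moreover have "count_list ls (\<beta> (snd x), snd x) = 1" using ml sub x by (auto simp: multilinear_def)
    ultimately show "count_list ls x = 1" by simp
  qed
  then have "distinct (map (\<lambda>l. (\<beta> l, l)) (map snd ls))" using eq by simp
  then show "distinct (map snd ls)" by (simp only: distinct_map)
  have "l \<in> snd ` set ls" if "l < d" for l
  proof -
    have "count_list ls (\<beta> l, l) \<noteq> 0" using ml that by (simp add: multilinear_def)
    then have "(\<beta> l, l) \<in> set ls" by (metis count_list_0_iff)
    then show ?thesis by (rule rev_image_eqI) simp
  qed
  then show "set (map snd ls) = {..<d}" using sub by auto
qed

lemma multilinear_enumeration: "multilinear \<beta> d (map (\<lambda>l. (\<beta> l, l)) [0..<d])"
proof -
  have "count_list (map (\<lambda>l. (\<beta> l, l)) [0..<d]) (b, l) = (if b = \<beta> l \<and> l < d then 1 else 0)" for b l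
    by (induction d) auto
  then show ?thesis by (auto simp: multilinear_def)
qed

text \<open>At the positions where the given word \<open>os'\<close> has a unit, the walk pauses at its current vertex.\<close>

lemma padded_walk_exists:
  assumes "map fst (letters (zip bs os')) = map \<beta> [j..<d]" "length os' = length bs" "j \<le> d"
    and edge: "\<And>l. l < d \<Longrightarrow> letter_edge r c (\<beta> l, l) = (v l, v (Suc l))"
  shows "\<exists>os. os \<in> words (UNIV <+> {..<d}) (length bs) \<and>
    letters (zip bs os) = map (\<lambda>l. (\<beta> l, l)) [j..<d] \<and>
    walk (v j) (map (letter_edge (case_sum id r) (case_sum id c)) (zip bs os)) (v d)"
  using assms(1-3)
proof (induction bs arbitrary: os' j)
  case Nil
  then have "j = d" by auto
  then show ?case by (auto simp: words_def)
next
  case (Cons b bs)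
  then obtain x xs where os': "os' = x # xs" by (cases os') auto
  show ?case
  proof (cases x)
    case (Inl a)
    then obtain os where "os \<in> words (UNIV <+> {..<d}) (length bs)"
      "letters (zip bs os) = map (\<lambda>l. (\<beta> l, l)) [j..<d]"
      "walk (v j) (map (letter_edge (case_sum id r) (case_sum id c)) (zip bs os)) (v d)"
      using Cons.IH[of xs j] Cons.prems os' by auto
    then show ?thesis
      by (intro exI[of _ "Inl (v j) # os"]) (auto simp: words_def)
  next
    case (Inr l)
    then have ne: "map \<beta> [j..<d] = b # map fst (letters (zip bs xs))" using Cons.prems os' by simp
    then have jd: "j < d" by (cases "j < d") auto
    then have b: "b = \<beta> j" "map fst (letters (zip bs xs)) = map \<beta> [Suc j..<d]"
      using ne by (simp_all add: upt_conv_Cons)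
    then obtain os where "os \<in> words (UNIV <+> {..<d}) (length bs)"
      "letters (zip bs os) = map (\<lambda>l. (\<beta> l, l)) [Suc j..<d]"
      "walk (v (Suc j)) (map (letter_edge (case_sum id r) (case_sum id c)) (zip bs os)) (v d)"
      using Cons.IH[of xs "Suc j"] Cons.prems os' jd by auto
    then show ?thesis
      using jd b edge[OF jd]
      by (intro exI[of _ "Inr j # os"]) (auto simp: words_def upt_conv_Cons)
  qed
qed

context star_trace
begin

lemma oprod_scaled_letters:
  fixes d :: nat
  assumes X: "\<And>l. l < d \<Longrightarrow> X l \<in> A" and ls: "snd ` set ls \<subseteq> {..<d}"
  shows "oprod (map (letter_op (\<lambda>l. scale_op (t l) (X l))) ls) =
    scale_op (\<Prod>l<d. t l ^ count_list ls (False, l) * cnj (t l) ^ count_list ls (True, l))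
      (oprod (map (letter_op X) ls))"
  using ls
proof (induction ls)
  case (Cons x ls)
  obtain b k where x: "x = (b, k)" by (cases x)
  have k: "k < d" using Cons.prems x by simp
  define z where "z = (if b then cnj (t k) else t k)"
  have "(\<Prod>l<d. t l ^ count_list (x # ls) (False, l) * cnj (t l) ^ count_list (x # ls) (True, l))
      = (\<Prod>l<d. (if l = k then z else 1) * (t l ^ count_list ls (False, l) * cnj (t l) ^ count_list ls (True, l)))"
    by (rule prod.cong) (auto simp: x z_def)
  also have "\<dots> = z * (\<Prod>l<d. t l ^ count_list ls (False, l) * cnj (t l) ^ count_list ls (True, l))"
    using k by (subst prod.distrib, subst prod.delta) auto
  finally have coef: "(\<Prod>l<d. t l ^ count_list (x # ls) (False, l) * cnj (t l) ^ count_list (x # ls) (True, l))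
      = z * (\<Prod>l<d. t l ^ count_list ls (False, l) * cnj (t l) ^ count_list ls (True, l))" .
  have op: "letter_op (\<lambda>l. scale_op (t l) (X l)) x = scale_op z (letter_op X x)"
    using X[OF k] by (simp add: x z_def letter_op_def star_if_def adj_scale_op in_bop)
  have inb: "letter_op X x \<in> bop" using X[OF k] by (intro in_bop letter_op_in) (simp add: x)
  show ?case
    unfolding coef using Cons
    by (simp add: op compose_scale_op_left compose_scale_op_right[OF inb] scale_op_scale_op)
qed simp

text \<open>The left side samples the moment at \<open>t\<^sub>l = (2\<i>)\<^bsup>s(l)\<^esup>\<close>. A word in which \<open>l\<close> occurs \<open>x\<^sub>l\<close> times plain and \<open>y\<^sub>l\<close>
  times starred contributes \<open>\<Prod>\<^sub>l \<mu>\<^sub>l\<^bsup>s(l)\<^esup>\<close> with \<open>\<mu>\<^sub>l = (2\<i>)\<^bsup>x(l)\<^esup> (-2\<i>)\<^bsup>y(l)\<^esup>\<close>, and summing against the coefficients of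
  \<open>Q\<close> evaluates \<open>Q\<close> at each \<open>\<mu>\<^sub>l\<close>, which is \<open>1\<close> or \<open>0\<close>.\<close>

lemma multilinear_coefficient:
  fixes r c :: "nat \<Rightarrow> 'v :: finite" and Q :: "bool \<Rightarrow> complex poly"
  assumes X: "\<And>l. l < d \<Longrightarrow> X l \<in> A"
    and Q: "\<And>b x y. x + y \<le> n \<Longrightarrow> poly (Q b) ((2 * \<i>) ^ x * (- (2 * \<i>)) ^ y) =
      (if x = (if b then 0 else 1) \<and> y = (if b then 1 else 0) then 1 else 0)"
  shows "(\<Sum>s\<in>PiE {..<d} (\<lambda>l. {..degree (Q (\<beta> l))}). (\<Prod>l<d. coeff (Q (\<beta> l)) (s l)) *
      mat_trace \<tau> (oprod (alt_word n (id_blinfun +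
        (\<Sum>l<d. munit (r l) (c l) (scale_op ((2 * \<i>) ^ s l) (X l))))))) =
    (\<Sum>os\<in>{os \<in> words (UNIV <+> {..<d}) n. multilinear \<beta> d (letters (zip (flags n False) os))}.
      of_real (walk_weight r c n os) * \<tau> (oprod (map (letter_op X) (letters (zip (flags n False) os)))))"
    (is "(\<Sum>s\<in>?S. ?q s * ?G s) = _")
proof -
  let ?ls = "\<lambda>os :: ('v + nat) list. letters (zip (flags n False) os)"
  let ?w = "\<lambda>os. complex_of_real (walk_weight r c n os) * \<tau> (oprod (map (letter_op X) (?ls os)))"
  let ?W = "words (UNIV <+> {..<d}) n :: ('v + nat) list set"
  define \<mu> where "\<mu> os l = (2 * \<i>) ^ count_list (?ls os) (False, l) * (- (2 * \<i>)) ^ count_list (?ls os) (True, l)" for os l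
  have conj_power: "cnj ((2 * \<i>) ^ k) = (- (2 * \<i>)) ^ k" for k
    by (simp only: complex_cnj_power complex_cnj_mult complex_cnj_numeral complex_cnj_i mult_minus_right)
  have powers: "(z ^ k) ^ x * (w ^ k) ^ y = (z ^ x * w ^ y) ^ k" for z w :: complex and k x y
    by (simp add: power_mult_distrib power_mult[symmetric] mult.commute)
  have sub: "snd ` set (?ls os) \<subseteq> {..<d}" if "os \<in> ?W" for os
    using that by (auto simp: words_def dest!: letters_subset set_zip_rightD)
  have G: "?G s = (\<Sum>os\<in>?W. (\<Prod>l<d. \<mu> os l ^ s l) * ?w os)" for s
  proof -
    have "?G s = (\<Sum>os\<in>?W. of_real (walk_weight r c n os) *
        \<tau> (oprod (map (letter_op (\<lambda>l. scale_op ((2 * \<i>) ^ s l) (X l))) (?ls os))))"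
      by (rule mat_trace_one_plus_expand) (auto intro: scale_in X)
    also have "\<dots> = (\<Sum>os\<in>?W. (\<Prod>l<d. \<mu> os l ^ s l) * ?w os)"
    proof (rule sum.cong[OF refl])
      fix os assume os: "os \<in> ?W"
      have inA: "oprod (map (letter_op X) (?ls os)) \<in> A"
        using sub[OF os] X by (intro oprod_in) (auto intro!: letter_op_in)
      have "(\<Prod>l<d. ((2 * \<i>) ^ s l) ^ count_list (?ls os) (False, l) * cnj ((2 * \<i>) ^ s l) ^ count_list (?ls os) (True, l))
          = (\<Prod>l<d. \<mu> os l ^ s l)"
        by (rule prod.cong) (simp_all only: \<mu>_def conj_power powers)
      then show "of_real (walk_weight r c n os) *
          \<tau> (oprod (map (letter_op (\<lambda>l. scale_op ((2 * \<i>) ^ s l) (X l))) (?ls os))) = (\<Prod>l<d. \<mu> os l ^ s l) * ?w os"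
        using oprod_scaled_letters[OF X sub[OF os], where t = "\<lambda>l. (2 * \<i>) ^ s l"] trace_scale[OF inA] by simp
    qed
    finally show ?thesis .
  qed
  have "(\<Sum>s\<in>?S. ?q s * ?G s) = (\<Sum>s\<in>?S. \<Sum>os\<in>?W. ?q s * ((\<Prod>l<d. \<mu> os l ^ s l) * ?w os))"
    by (simp only: G sum_distrib_left)
  also have "\<dots> = (\<Sum>os\<in>?W. \<Sum>s\<in>?S. ?q s * ((\<Prod>l<d. \<mu> os l ^ s l) * ?w os))"
    by (rule sum.swap)
  also have "\<dots> = (\<Sum>os\<in>?W. if multilinear \<beta> d (?ls os) then ?w os else 0)"
  proof (rule sum.cong[OF refl])
    fix os assume os: "os \<in> ?W"
    have "(\<Sum>s\<in>?S. ?q s * ((\<Prod>l<d. \<mu> os l ^ s l) * ?w os))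
        = (\<Sum>s\<in>?S. \<Prod>l<d. coeff (Q (\<beta> l)) (s l) * \<mu> os l ^ s l) * ?w os"
      by (simp add: sum_distrib_right prod.distrib mult.assoc)
    also have "(\<Sum>s\<in>?S. \<Prod>l<d. coeff (Q (\<beta> l)) (s l) * \<mu> os l ^ s l)
        = (\<Prod>l<d. \<Sum>s\<le>degree (Q (\<beta> l)). coeff (Q (\<beta> l)) s * \<mu> os l ^ s)"
      by (rule prod_sum_PiE[symmetric]) auto
    also have "\<dots> = (\<Prod>l<d. poly (Q (\<beta> l)) (\<mu> os l))"
      by (simp add: poly_altdef)
    also have "\<dots> = (\<Prod>l<d. if count_list (?ls os) (\<beta> l, l) = 1 \<and> count_list (?ls os) (\<not> \<beta> l, l) = 0 then 1 else 0)"
    proof (rule prod.cong[OF refl])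
      fix l
      have "count_list (?ls os) (False, l) + count_list (?ls os) (True, l) \<le> n"
        using count_list_pair_le[of "?ls os" l] length_letters_le[of "zip (flags n False) os"] by simp
      from Q[OF this, of "\<beta> l"]
      show "poly (Q (\<beta> l)) (\<mu> os l) = (if count_list (?ls os) (\<beta> l, l) = 1 \<and> count_list (?ls os) (\<not> \<beta> l, l) = 0 then 1 else 0)"
        by (cases "\<beta> l") (auto simp: \<mu>_def)
    qed
    also have "\<dots> = (if multilinear \<beta> d (?ls os) then 1 else 0)"
      by (auto simp: multilinear_def intro: prod_zero)
    finally show "(\<Sum>s\<in>?S. ?q s * ((\<Prod>l<d. \<mu> os l ^ s l) * ?w os)) = (if multilinear \<beta> d (?ls os) then ?w os else 0)"
      by simp
  qed
  also have "\<dots> = (\<Sum>os\<in>{os \<in> ?W. multilinear \<beta> d (?ls os)}. ?w os)"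
    by (rule sum.inter_filter[symmetric]) (simp add: finite_words)
  finally show ?thesis .
qed

text \<open>A word that uses every letter of the staircase once and walks along it is, up to rotation, the
  word \<open>0, 1, \<dots>, d - 1\<close>; and a trace does not see rotations.\<close>

lemma staircase_word_trace:
  fixes v :: "nat \<Rightarrow> 'v"
  assumes X: "\<And>l. l < d \<Longrightarrow> X l \<in> A"
    and v: "\<And>k l. k \<le> d \<Longrightarrow> l \<le> d \<Longrightarrow> v k = v l \<Longrightarrow> staircase d k = staircase d l"
    and edge: "\<And>l. l < d \<Longrightarrow> letter_edge r c (\<beta> l, l) = (v l, v (Suc l))"
    and ml: "multilinear \<beta> d ls" and sub: "snd ` set ls \<subseteq> {..<d}"
    and walk: "walk a (map (letter_edge r c) ls) a"
  shows "\<tau> (oprod (map (letter_op X) ls)) = \<tau> (oprod (map (letter_op X) (map (\<lambda>l. (\<beta> l, l)) [0..<d])))"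
proof -
  define ns where "ns = map snd ls"
  have ls: "ls = map (\<lambda>l. (\<beta> l, l)) ns" and dist: "distinct ns" and set: "set ns = {..<d}"
    using multilinear_letters[OF ml sub] by (simp_all only: ns_def)
  have len: "length ns = d" using distinct_card[OF dist] set by simp
  have lt: "ns ! i < d" if "i < d" for i using that len set nth_mem by blast
  have "staircase d (Suc (ns ! i)) = staircase d (ns ! (Suc i mod d))" if i: "i < d" for i
  proof -
    have i': "Suc i mod d < d" using i by simp
    have "snd (map (letter_edge r c) ls ! i) = fst (map (letter_edge r c) ls ! (Suc i mod d))"
      using closed_walk_nth[OF walk] i len by (simp add: ls)
    then have "v (Suc (ns ! i)) = v (ns ! (Suc i mod d))"
      using i i' len by (simp add: ls edge lt)
    then show ?thesis using lt[OF i] lt[OF i'] by (intro v) auto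
  qed
  then obtain k where k: "rotate k ns = [0..<d]" using staircase_euler_circuit[OF dist set] by blast
  let ?f = "\<lambda>l. letter_op X (\<beta> l, l)"
  let ?j = "k mod length ns"
  have sets: "set (map ?f (take ?j ns)) \<subseteq> A" "set (map ?f (drop ?j ns)) \<subseteq> A"
    using X set by (auto intro!: letter_op_in dest!: in_set_takeD in_set_dropD)
  have "\<tau> (oprod (map ?f ns)) = \<tau> (oprod (map ?f (take ?j ns) @ map ?f (drop ?j ns)))"
    by (simp flip: map_append)
  also have "\<dots> = \<tau> (oprod (map ?f (drop ?j ns) @ map ?f (take ?j ns)))"
    by (rule trace_rotate[OF sets])
  also have "\<dots> = \<tau> (oprod (map ?f (rotate k ns)))"
    by (simp add: rotate_drop_take)
  finally show ?thesis unfolding k ls by (simp add: o_def)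
qed

end

text \<open>The total weight with which the word \<open>0, \<dots>, d - 1\<close> occurs; it does not depend on the algebra.\<close>

definition staircase_weight :: "(nat \<Rightarrow> 'v :: finite) \<Rightarrow> (nat \<Rightarrow> 'v) \<Rightarrow> (nat \<Rightarrow> bool) \<Rightarrow> nat \<Rightarrow> nat \<Rightarrow> real" where
  "staircase_weight r c \<beta> d n =
    (\<Sum>os\<in>{os \<in> words (UNIV <+> {..<d}) n. multilinear \<beta> d (letters (zip (flags n False) os))}. walk_weight r c n os)"

lemma staircase_weight_pos:
  fixes r c :: "nat \<Rightarrow> 'v :: finite"
  assumes edge: "\<And>l. l < d \<Longrightarrow> letter_edge r c (\<beta> l, l) = (v l, v (Suc l))" and closed: "v d = v 0"
    and pad: "map fst (letters (zip (flags n False) os')) = map \<beta> [0..<d]" "length os' = n"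
  shows "staircase_weight r c \<beta> d n > 0"
proof -
  obtain os where os: "os \<in> words (UNIV <+> {..<d}) n"
    "letters (zip (flags n False) os) = map (\<lambda>l. (\<beta> l, l)) [0..<d]"
    "walk (v 0) (map (letter_edge (case_sum id r) (case_sum id c)) (zip (flags n False) os)) (v d)"
    using padded_walk_exists[OF pad(1), of r c v] pad(2) edge by auto
  let ?S = "{a. walk a (map (letter_edge (case_sum id r) (case_sum id c)) (zip (flags n False) os)) a}"
  have "v 0 \<in> ?S" using os(3) closed by simp
  then have "0 < card ?S" by (metis card_gt_0_iff empty_iff finite)
  then have "0 < walk_weight r c n os" unfolding walk_weight_def by simp
  then show ?thesis
    unfolding staircase_weight_def using os multilinear_enumeration[of \<beta> d]
    by (intro sum_pos2[of _ os]) (auto simp: finite_words walk_weight_def)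
qed

lemma (in star_trace) staircase_extraction:
  fixes r c :: "nat \<Rightarrow> 'v :: finite" and Q :: "bool \<Rightarrow> complex poly"
  assumes X: "\<And>l. l < d \<Longrightarrow> X l \<in> A"
    and Q: "\<And>b x y. x + y \<le> n \<Longrightarrow> poly (Q b) ((2 * \<i>) ^ x * (- (2 * \<i>)) ^ y) =
      (if x = (if b then 0 else 1) \<and> y = (if b then 1 else 0) then 1 else 0)"
    and v: "\<And>k l. k \<le> d \<Longrightarrow> l \<le> d \<Longrightarrow> v k = v l \<Longrightarrow> staircase d k = staircase d l"
    and edge: "\<And>l. l < d \<Longrightarrow> letter_edge r c (\<beta> l, l) = (v l, v (Suc l))"
  shows "(\<Sum>s\<in>PiE {..<d} (\<lambda>l. {..degree (Q (\<beta> l))}). (\<Prod>l<d. coeff (Q (\<beta> l)) (s l)) *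
      mat_trace \<tau> (oprod (alt_word n (id_blinfun +
        (\<Sum>l<d. munit (r l) (c l) (scale_op ((2 * \<i>) ^ s l) (X l))))))) =
    of_real (staircase_weight r c \<beta> d n) * \<tau> (oprod (map (letter_op X) (map (\<lambda>l. (\<beta> l, l)) [0..<d])))"
proof -
  let ?ls = "\<lambda>os :: ('v + nat) list. letters (zip (flags n False) os)"
  let ?t = "\<tau> (oprod (map (letter_op X) (map (\<lambda>l. (\<beta> l, l)) [0..<d])))"
  have "of_real (walk_weight r c n os) * \<tau> (oprod (map (letter_op X) (?ls os))) = of_real (walk_weight r c n os) * ?t"
    if os: "os \<in> words (UNIV <+> {..<d}) n" "multilinear \<beta> d (?ls os)" for os
  proof (cases "walk_weight r c n os = 0")
    case False
    then obtain a where "walk a (map (letter_edge (case_sum id r) (case_sum id c)) (zip (flags n False) os)) a"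
      by (auto simp: walk_weight_def)
    then have "walk a (map (letter_edge r c) (?ls os)) a" by (rule walk_letters)
    moreover have "snd ` set (?ls os) \<subseteq> {..<d}"
      using os(1) by (auto simp: words_def dest!: letters_subset set_zip_rightD)
    ultimately have "\<tau> (oprod (map (letter_op X) (?ls os))) = ?t"
      by (intro staircase_word_trace[of d X v r c \<beta> "?ls os" a] X v edge os(2))
    then show ?thesis by (simp only:)
  qed simp
  note weights = this
  have "(\<Sum>os\<in>{os \<in> words (UNIV <+> {..<d}) n. multilinear \<beta> d (?ls os)}.
      of_real (walk_weight r c n os) * \<tau> (oprod (map (letter_op X) (?ls os)))) =
    (\<Sum>os\<in>{os \<in> words (UNIV <+> {..<d}) n. multilinear \<beta> d (?ls os)}. of_real (walk_weight r c n os) * ?t)"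
    by (rule sum.cong[OF refl]) (use weights in blast)
  also have "\<dots> = of_real (staircase_weight r c \<beta> d n) * ?t"
    by (simp only: staircase_weight_def of_real_sum sum_distrib_right)
  finally show ?thesis
    using multilinear_coefficient[of d X n Q \<beta> r c, OF X Q] by (simp only:)
qed

section \<open>Norms and traces of words\<close>

lemma sum_munit_group:
  fixes r c :: "'l \<Rightarrow> 'n :: finite"
  assumes "finite L"
  shows "(\<Sum>l\<in>L. munit (r l) (c l) (V l)) =
    (\<Sum>i\<in>UNIV. \<Sum>j\<in>UNIV. munit i j (\<Sum>l\<in>{l \<in> L. i = r l \<and> j = c l}. V l))"
  by (rule entry_eqI) (simp add: entry_sum_munit, simp add: entry_sum entry_munit sum.inter_filter[OF assms])

text \<open>The linear map \<open>u\<close> on \<open>E\<close> enters only through the set \<open>P\<close> of all pairs of sequences that represent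
  some \<open>x \<in> E\<close> and its image \<open>u x\<close>. As a relation between sequences of bounded operators it is linear.\<close>

locale trace_pair =
  M: star_trace M \<tau> + N: star_trace N \<sigma>
  for M :: "('a :: complex_hilbert_space \<Rightarrow>\<^sub>L 'a) set" and \<tau>
    and N :: "('b :: complex_hilbert_space \<Rightarrow>\<^sub>L 'b) set" and \<sigma> +
  fixes P :: "((nat \<Rightarrow> 'a \<Rightarrow>\<^sub>L 'a) \<times> (nat \<Rightarrow> 'b \<Rightarrow>\<^sub>L 'b)) set"
  assumes pair_in: "(X, Y) \<in> P \<Longrightarrow> X k \<in> M \<and> Y k \<in> N"
    and pair_add: "(X, Y) \<in> P \<Longrightarrow> (X', Y') \<in> P \<Longrightarrow> (\<lambda>k. X k + X' k, \<lambda>k. Y k + Y' k) \<in> P"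
    and pair_scale: "(X, Y) \<in> P \<Longrightarrow> (\<lambda>k. scale_op c (X k), \<lambda>k. scale_op c (Y k)) \<in> P"
    and pair_nonempty: "P \<noteq> {}"
begin

lemma pair_zero: "(\<lambda>_. 0, \<lambda>_. 0) \<in> P"
proof -
  obtain X Y where "(X, Y) \<in> P" using pair_nonempty by auto
  from pair_scale[OF this, of 0] show ?thesis by simp
qed

lemma pair_sum:
  "(\<And>l. l \<in> L \<Longrightarrow> (X l, Y l) \<in> P) \<Longrightarrow> (\<lambda>k. \<Sum>l\<in>L. X l k, \<lambda>k. \<Sum>l\<in>L. Y l k) \<in> P"
proof (induction L rule: infinite_finite_induct)
  case (insert l L)
  then have "(\<lambda>k. X l k + (\<Sum>l\<in>L. X l k), \<lambda>k. Y l k + (\<Sum>l\<in>L. Y l k)) \<in> P"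
    by (intro pair_add) auto
  then show ?case using insert.hyps by simp
qed (simp_all add: pair_zero)

text \<open>As the moments converge to the powers of the norms of \<open>1 + x\<close> and of its image, for \<open>n = 2m\<close> both the
  hypothesis and the conclusion of the theorem have this form, for matrices of different sizes.\<close>

definition moments_agree :: "'n :: finite itself \<Rightarrow> nat \<Rightarrow> bool" where
  "moments_agree _ n \<longleftrightarrow> (\<forall>X Y. (\<forall>i j :: 'n. (X i j, Y i j) \<in> P) \<longrightarrow>
    (\<lambda>k. mat_trace \<tau> (oprod (alt_word n (id_blinfun + (\<Sum>i\<in>UNIV. \<Sum>j\<in>UNIV. munit i j (X i j k)))))
       - mat_trace \<sigma> (oprod (alt_word n (id_blinfun + (\<Sum>i\<in>UNIV. \<Sum>j\<in>UNIV. munit i j (Y i j k))))))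
    \<longlonglongrightarrow> 0)"

lemma moments_agreeD:
  fixes r c :: "'l \<Rightarrow> 'n :: finite"
  assumes agree: "moments_agree TYPE('n) n" and fin: "finite L"
    and XY: "\<And>l. l \<in> L \<Longrightarrow> (X l, Y l) \<in> P"
  shows "(\<lambda>k. mat_trace \<tau> (oprod (alt_word n (id_blinfun + (\<Sum>l\<in>L. munit (r l) (c l) (X l k)))))
       - mat_trace \<sigma> (oprod (alt_word n (id_blinfun + (\<Sum>l\<in>L. munit (r l) (c l) (Y l k)))))) \<longlonglongrightarrow> 0"
proof -
  have "\<forall>i j. ((\<lambda>k. \<Sum>l\<in>{l \<in> L. i = r l \<and> j = c l}. X l k), (\<lambda>k. \<Sum>l\<in>{l \<in> L. i = r l \<and> j = c l}. Y l k)) \<in> P"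
    using XY by (intro allI pair_sum) auto
  from agree[unfolded moments_agree_def, rule_format, OF this[rule_format]]
  show ?thesis unfolding sum_munit_group[OF fin] .
qed

text \<open>From the matrices over \<open>E\<close> of size \<open>m\<close> to words with at most \<open>2m\<close> letters in \<open>E\<close>: the letters
  are placed along the staircase, whose vertices are among \<open>0, \<dots>, m - 1\<close>. Of the word \<open>os'\<close>, only the
  positions of its units matter: they record how the letters of \<open>zs\<close> fit into the alternating pattern.\<close>

lemma word_traces_agree:
  fixes zs :: "(bool \<times> (nat \<Rightarrow> 'a \<Rightarrow>\<^sub>L 'a) \<times> (nat \<Rightarrow> 'b \<Rightarrow>\<^sub>L 'b)) list" and os' :: "('x + 'y) list"
  assumes agree: "moments_agree TYPE('m :: finite) n" and n: "n = 2 * CARD('m)"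
    and zs: "snd ` set zs \<subseteq> P"
    and pad: "map fst (letters (zip (flags n False) os')) = map fst zs" "length os' = n"
  shows "(\<lambda>k. \<tau> (oprod (map (\<lambda>z. star_if (fst z) (fst (snd z) k)) zs))
       - \<sigma> (oprod (map (\<lambda>z. star_if (fst z) (snd (snd z) k)) zs))) \<longlonglongrightarrow> 0"
proof -
  define d where "d = length zs"
  define \<beta> where "\<beta> l = fst (zs ! l)" for l
  define X where "X l = fst (snd (zs ! l))" for l
  define Y where "Y l = snd (snd (zs ! l))" for l
  have XY: "(X l, Y l) \<in> P" if "l < d" for l
    using zs that nth_mem[of l zs] by (auto simp: d_def X_def Y_def)
  have "length zs = length (letters (zip (flags n False) os'))"
    using arg_cong[OF pad(1), of length] by simp
  also have "\<dots> \<le> n" using length_letters_le[of "zip (flags n False) os'"] pad(2) by simp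
  finally have dn: "d \<le> 2 * CARD('m)" by (simp add: d_def n)
  obtain e :: "nat \<Rightarrow> 'm" where e: "bij_betw e {0..<CARD('m)} UNIV"
    using ex_bij_betw_nat_finite[of "UNIV :: 'm set"] by auto
  define v where "v l = e (staircase d l)" for l
  have vertex: "staircase d l < CARD('m)" for l
    using dn by (auto simp: staircase_def)
  have v: "staircase d k = staircase d l" if "v k = v l" for k l
    using bij_betw_imp_inj_on[OF e] that vertex by (auto simp: v_def dest!: inj_onD)
  define r where "r l = (if \<beta> l then v (Suc l) else v l)" for l
  define c where "c l = (if \<beta> l then v l else v (Suc l))" for l
  have edge: "letter_edge r c (\<beta> l, l) = (v l, v (Suc l))" for l
    by (simp add: letter_edge_def r_def c_def)
  have closed: "v d = v 0" by (simp add: v_def staircase_def)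
  obtain Q :: "bool \<Rightarrow> complex poly" where Q: "\<And>b x y. x + y \<le> n \<Longrightarrow>
      poly (Q b) ((2 * \<i>) ^ x * (- (2 * \<i>)) ^ y) =
        (if x = (if b then 0 else 1) \<and> y = (if b then 1 else 0) then 1 else 0)"
    using probe_poly_exists[of n] by blast
  let ?K = "staircase_weight r c \<beta> d n"
  have "map fst zs = map \<beta> [0..<d]"
    by (rule nth_equalityI) (simp_all add: d_def \<beta>_def)
  then have K: "?K > 0"
    using pad by (intro staircase_weight_pos[where v = v and os' = os'] edge closed) auto
  have word: "map f zs = map (\<lambda>l. f (zs ! l)) [0..<d]" for f :: "_ \<Rightarrow> 'z"
    by (rule nth_equalityI) (simp_all add: d_def)
  let ?S = "PiE {..<d} (\<lambda>l. {..degree (Q (\<beta> l))})"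
  let ?G = "\<lambda>s k. mat_trace \<tau> (oprod (alt_word n (id_blinfun +
        (\<Sum>l<d. munit (r l) (c l) (scale_op ((2 * \<i>) ^ s l) (X l k))))))"
  let ?H = "\<lambda>s k. mat_trace \<sigma> (oprod (alt_word n (id_blinfun +
        (\<Sum>l<d. munit (r l) (c l) (scale_op ((2 * \<i>) ^ s l) (Y l k))))))"
  let ?q = "\<lambda>s. \<Prod>l<d. coeff (Q (\<beta> l)) (s l)"
  let ?D = "\<lambda>k. \<tau> (oprod (map (\<lambda>z. star_if (fst z) (fst (snd z) k)) zs))
       - \<sigma> (oprod (map (\<lambda>z. star_if (fst z) (snd (snd z) k)) zs))"
  have "(\<Sum>s\<in>?S. ?q s * (?G s k - ?H s k)) = of_real ?K * ?D k" for k
  proof -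
    have Xk: "X l k \<in> M" and Yk: "Y l k \<in> N" if "l < d" for l
      using pair_in[OF XY[OF that]] by auto
    have "(\<Sum>s\<in>?S. ?q s * ?G s k) = of_real ?K * \<tau> (oprod (map (letter_op (\<lambda>l. X l k)) (map (\<lambda>l. (\<beta> l, l)) [0..<d])))"
      by (rule M.staircase_extraction[where v = v]) (assumption | rule Xk Q v edge)+
    moreover have "(\<Sum>s\<in>?S. ?q s * ?H s k) = of_real ?K * \<sigma> (oprod (map (letter_op (\<lambda>l. Y l k)) (map (\<lambda>l. (\<beta> l, l)) [0..<d])))"
      by (rule N.staircase_extraction[where v = v]) (assumption | rule Yk Q v edge)+
    moreover have "map (letter_op (\<lambda>l. X l k)) (map (\<lambda>l. (\<beta> l, l)) [0..<d]) = map (\<lambda>z. star_if (fst z) (fst (snd z) k)) zs"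
      by (subst word) (simp add: letter_op_def \<beta>_def X_def)
    moreover have "map (letter_op (\<lambda>l. Y l k)) (map (\<lambda>l. (\<beta> l, l)) [0..<d]) = map (\<lambda>z. star_if (fst z) (snd (snd z) k)) zs"
      by (subst word) (simp add: letter_op_def \<beta>_def Y_def)
    ultimately show ?thesis
      by (simp only: right_diff_distrib sum_subtractf)
  qed
  moreover have "(\<lambda>k. \<Sum>s\<in>?S. ?q s * (?G s k - ?H s k)) \<longlonglongrightarrow> 0"
  proof (intro tendsto_null_sum tendsto_mult_right_zero)
    fix s
    show "(\<lambda>k. ?G s k - ?H s k) \<longlonglongrightarrow> 0"
      by (rule moments_agreeD[OF agree]) (auto intro: pair_scale XY)
  qed
  ultimately have "(\<lambda>k. of_real ?K * ?D k) \<longlonglongrightarrow> 0" by simp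
  then have "(\<lambda>k. (1 / of_real ?K) * (of_real ?K * ?D k)) \<longlonglongrightarrow> 0" by (rule tendsto_mult_right_zero)
  then show ?thesis using K by simp
qed

lemma moments_agree_all_sizes:
  assumes agree: "moments_agree TYPE('m :: finite) n" and n: "n = 2 * CARD('m)"
  shows "moments_agree TYPE('n :: finite) n"
  unfolding moments_agree_def
proof (intro allI impI)
  fix X :: "'n \<Rightarrow> 'n \<Rightarrow> _" and Y :: "'n \<Rightarrow> 'n \<Rightarrow> _"
  assume XY: "\<forall>i j. (X i j, Y i j) \<in> P"
  let ?W = "words (UNIV <+> UNIV) n :: ('n + 'n \<times> 'n) list set"
  let ?ls = "\<lambda>os :: ('n + 'n \<times> 'n) list. letters (zip (flags n False) os)"
  let ?X = "\<lambda>k l. X (fst l) (snd l) k" and ?Y = "\<lambda>k l. Y (fst l) (snd l) k"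
  let ?w = "\<lambda>os. complex_of_real (walk_weight fst snd n os)"
  have in_alg: "?X k l \<in> M" "?Y k l \<in> N" for k l using XY pair_in by blast+
  have expand: "mat_trace \<tau> (oprod (alt_word n (id_blinfun + (\<Sum>i\<in>UNIV. \<Sum>j\<in>UNIV. munit i j (X i j k)))))
       - mat_trace \<sigma> (oprod (alt_word n (id_blinfun + (\<Sum>i\<in>UNIV. \<Sum>j\<in>UNIV. munit i j (Y i j k)))))
     = (\<Sum>os\<in>?W. ?w os * (\<tau> (oprod (map (letter_op (?X k)) (?ls os))) - \<sigma> (oprod (map (letter_op (?Y k)) (?ls os)))))" for k
  proof -
    have X: "(\<Sum>i\<in>UNIV. \<Sum>j\<in>UNIV. munit i j (X i j k)) = (\<Sum>l\<in>UNIV. munit (fst l) (snd l) (?X k l))"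
      and Y: "(\<Sum>i\<in>UNIV. \<Sum>j\<in>UNIV. munit i j (Y i j k)) = (\<Sum>l\<in>UNIV. munit (fst l) (snd l) (?Y k l))"
      by (simp_all add: sum.cartesian_product case_prod_unfold)
    show ?thesis
      unfolding X Y M.mat_trace_one_plus_expand[OF in_alg(1) finite] N.mat_trace_one_plus_expand[OF in_alg(2) finite]
      by (simp only: right_diff_distrib sum_subtractf)
  qed
  have "(\<lambda>k. \<tau> (oprod (map (letter_op (?X k)) (?ls os))) - \<sigma> (oprod (map (letter_op (?Y k)) (?ls os)))) \<longlonglongrightarrow> 0"
    if os: "os \<in> ?W" for os
  proof -
    let ?zs = "map (\<lambda>(b, l). (b, X (fst l) (snd l), Y (fst l) (snd l))) (?ls os)"
    have "(\<lambda>k. \<tau> (oprod (map (\<lambda>z. star_if (fst z) (fst (snd z) k)) ?zs))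
       - \<sigma> (oprod (map (\<lambda>z. star_if (fst z) (snd (snd z) k)) ?zs))) \<longlonglongrightarrow> 0"
    proof (rule word_traces_agree[OF agree n])
      show "snd ` set ?zs \<subseteq> P" using XY by auto
      show "map fst (?ls os) = map fst ?zs" by (simp add: case_prod_unfold)
      show "length os = n" using os by (simp add: words_def)
    qed
    then show ?thesis by (simp add: letter_op_def[abs_def] case_prod_unfold o_def)
  qed
  then show "(\<lambda>k. mat_trace \<tau> (oprod (alt_word n (id_blinfun + (\<Sum>i\<in>UNIV. \<Sum>j\<in>UNIV. munit i j (X i j k)))))
       - mat_trace \<sigma> (oprod (alt_word n (id_blinfun + (\<Sum>i\<in>UNIV. \<Sum>j\<in>UNIV. munit i j (Y i j k)))))) \<longlonglongrightarrow> 0"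
    unfolding expand by (intro tendsto_null_sum tendsto_mult_right_zero)
qed

end

section \<open>Matrices of every size\<close>

lemma (in star_trace_lp) mat_lp_norm_one_add_limit:
  fixes x :: "'a lp_elem ^ 'n ^ 'n"
  assumes x: "\<And>i j. x $ i $ j \<in> Lp" and X: "\<And>i j. X i j \<in> x $ i $ j"
  defines "r \<equiv> mat_lp_norm A \<tau> (2 * m) (mat_lp_add A \<tau> (2 * m) (mat_lp_one A \<tau> (2 * m)) x)"
  shows "(\<lambda>k. mat_trace \<tau> (oprod (alt_word (2 * m) (id_blinfun + (\<Sum>i\<in>UNIV. \<Sum>j\<in>UNIV. munit i j (X i j k))))))
    \<longlonglongrightarrow> of_real (r ^ (2 * m))" "r \<ge> 0"
proof -
  interpret MA: star_trace "mat_algebra A :: (('a ^ 'n) \<Rightarrow>\<^sub>L ('a ^ 'n)) set" "mat_trace \<tau>"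
    by (rule star_trace_mat_algebra)
  let ?W = "\<lambda>k. id_blinfun + (\<Sum>i\<in>UNIV. \<Sum>j\<in>UNIV. munit i j (X i j k)) :: ('a ^ 'n) \<Rightarrow>\<^sub>L ('a ^ 'n)"
  let ?\<delta> = "\<lambda>i j :: 'n. if i = j then id_blinfun else (0 :: 'a \<Rightarrow>\<^sub>L 'a)"
  have \<delta>: "?\<delta> i j \<in> A" for i j by (simp add: id_in zero_in)
  have "(\<lambda>k. op_lp_norm (mat_trace \<tau>) (2 * m) (\<Sum>i\<in>UNIV. \<Sum>j\<in>UNIV. munit i j (?\<delta> i j + X i j k) :: ('a ^ 'n) \<Rightarrow>\<^sub>L ('a ^ 'n))) \<longlonglongrightarrow> r"
    unfolding r_def
    by (rule mat_lp_norm_limit)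
       (simp_all only: mat_lp_add_def mat_lp_one_def vec_lambda_beta lp_add_rep[OF lp_embed_rep[OF \<delta>] x X])
  moreover have "(\<Sum>i\<in>UNIV. \<Sum>j\<in>UNIV. munit i j (?\<delta> i j + X i j k)) = ?W k" for k
    by (rule entry_eqI) (simp add: entry_sum_munit entry_add entry_id)
  ultimately have lim: "(\<lambda>k. op_lp_norm (mat_trace \<tau>) (2 * m) (?W k)) \<longlonglongrightarrow> r" by simp
  have "X i j k \<in> A" for i j k using cauchy_seqs_in[OF Lp_cauchy[OF x X]] .
  then have W: "?W k \<in> mat_algebra A" for k
    by (intro MA.add_in MA.id_in MA.sum_in munit_in)
  show "(\<lambda>k. mat_trace \<tau> (oprod (alt_word (2 * m) (?W k)))) \<longlonglongrightarrow> of_real (r ^ (2 * m))"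
    unfolding MA.lp_norm_power[OF W m_pos, symmetric]
    by (intro tendsto_of_real tendsto_power lim)
  show "r \<ge> 0"
    by (rule LIMSEQ_le_const[OF lim]) (use MA.lp_norm_nonneg[OF W] in blast)
qed

theorem theorem3p6:
  fixes M :: "('a :: complex_hilbert_space \<Rightarrow>\<^sub>L 'a) set"
    and \<tau> :: "('a \<Rightarrow>\<^sub>L 'a) \<Rightarrow> complex"
    and N :: "('b :: complex_hilbert_space \<Rightarrow>\<^sub>L 'b) set"
    and \<sigma> :: "('b \<Rightarrow>\<^sub>L 'b) \<Rightarrow> complex"
    and E :: "'a lp_elem set"
    and u :: "'a lp_elem \<Rightarrow> 'b lp_elem"
    and m p :: nat
    and x :: "'a lp_elem ^ 'n ^ 'n"
  assumes "m = CARD('m :: finite)" and "p = 2 * m"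
    and "von_neumann_algebra M" and "normal_faithful_trace M \<tau>"
    and "von_neumann_algebra N" and "normal_faithful_trace N \<sigma>"
    and "lp_subspace M \<tau> p E"
    and "lp_linear_map M \<tau> N \<sigma> p E u"
    and "\<And>y :: 'a lp_elem ^ 'm ^ 'm. y \<in> mat_over E \<Longrightarrow>
           mat_lp_norm M \<tau> p (mat_lp_add M \<tau> p (mat_lp_one M \<tau> p) y) =
           mat_lp_norm N \<sigma> p (mat_lp_add N \<sigma> p (mat_lp_one N \<sigma> p) (mat_map u y))"
    and "x \<in> mat_over E"
  shows "mat_lp_norm M \<tau> p (mat_lp_add M \<tau> p (mat_lp_one M \<tau> p) x) =
         mat_lp_norm N \<sigma> p (mat_lp_add N \<sigma> p (mat_lp_one N \<sigma> p) (mat_map u x))"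
proof -
  have m: "m > 0" using assms(1) by simp
  interpret M: star_trace_lp M \<tau> m
    using von_neumann_star_trace[OF assms(3,4)] m by (simp add: star_trace_lp_def star_trace_lp_axioms_def)
  interpret N: star_trace_lp N \<sigma> m
    using von_neumann_star_trace[OF assms(5,6)] m by (simp add: star_trace_lp_def star_trace_lp_axioms_def)
  have E: "x \<in> M.Lp" "lp_add M \<tau> p x y \<in> E" "lp_scale M \<tau> p c x \<in> E" if "x \<in> E" "y \<in> E" for x y c
    using assms(2,7) that by (auto simp: lp_subspace_def)
  have u: "u x \<in> N.Lp" "u (lp_add M \<tau> p x y) = lp_add N \<sigma> p (u x) (u y)"
      "u (lp_scale M \<tau> p c x) = lp_scale N \<sigma> p c (u x)" if "x \<in> E" "y \<in> E" for x y c
    using assms(2,8) that by (auto simp: lp_linear_map_def)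
  define P where "P = {(X, Y). \<exists>x\<in>E. X \<in> x \<and> Y \<in> u x}"
  interpret trace_pair M \<tau> N \<sigma> P
  proof
    fix X Y X' Y' k c
    show "X k \<in> M \<and> Y k \<in> N" if "(X, Y) \<in> P"
    proof -
      obtain x where x: "x \<in> E" "X \<in> x" "Y \<in> u x" using \<open>(X, Y) \<in> P\<close> by (auto simp: P_def)
      show ?thesis
        using M.cauchy_seqs_in[OF M.Lp_cauchy[OF E(1)[OF x(1,1)] x(2)]]
          N.cauchy_seqs_in[OF N.Lp_cauchy[OF u(1)[OF x(1,1)] x(3)]] by blast
    qed
    show "(\<lambda>k. X k + X' k, \<lambda>k. Y k + Y' k) \<in> P" if "(X, Y) \<in> P" "(X', Y') \<in> P"
    proof -
      obtain x y where xy: "x \<in> E" "X \<in> x" "Y \<in> u x" "y \<in> E" "X' \<in> y" "Y' \<in> u y"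
        using \<open>(X, Y) \<in> P\<close> \<open>(X', Y') \<in> P\<close> by (auto simp: P_def)
      show ?thesis
        unfolding P_def
        using M.lp_add_rep(2)[of x X y X'] N.lp_add_rep(2)[of "u x" Y "u y" Y'] xy
          E(1,2)[OF xy(1,4)] E(1)[OF xy(4,4)] u(1,2)[OF xy(1,4)] u(1)[OF xy(4,4)] assms(2)
        by (auto intro!: bexI[of _ "lp_add M \<tau> p x y"])
    qed
    show "(\<lambda>k. scale_op c (X k), \<lambda>k. scale_op c (Y k)) \<in> P" if "(X, Y) \<in> P"
    proof -
      obtain x where xy: "x \<in> E" "X \<in> x" "Y \<in> u x"
        using \<open>(X, Y) \<in> P\<close> by (auto simp: P_def)
      show ?thesis
        unfolding P_def
        using M.lp_scale_rep(2)[of x X c] N.lp_scale_rep(2)[of "u x" Y c] xy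
          E(1,3)[OF xy(1,1)] u(1,3)[OF xy(1,1)] assms(2)
        by (auto intro!: bexI[of _ "lp_scale M \<tau> p c x"])
    qed
  next
    have "lp_embed M \<tau> p 0 \<in> E" using assms(7) by (simp add: lp_subspace_def)
    then show "P \<noteq> {}"
      unfolding P_def using E(1) u(1) M.Lp_nonempty N.Lp_nonempty by fastforce
  qed
  have entries: "y $ i $ j \<in> M.Lp" "mat_map u y $ i $ j \<in> N.Lp"
    if "y \<in> mat_over E" for y :: "'a lp_elem ^ 'k ^ 'k" and i j
  proof -
    have "y $ i $ j \<in> E" using that by (simp add: mat_over_def)
    from E(1)[OF this this] u(1)[OF this this]
    show "y $ i $ j \<in> M.Lp" "mat_map u y $ i $ j \<in> N.Lp" by (simp_all add: mat_map_def)
  qed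
  have "moments_agree TYPE('m) (2 * m)"
    unfolding moments_agree_def
  proof (intro allI impI)
    fix X :: "'m \<Rightarrow> 'm \<Rightarrow> _" and Y :: "'m \<Rightarrow> 'm \<Rightarrow> _"
    assume "\<forall>i j. (X i j, Y i j) \<in> P"
    then have "\<forall>i j. \<exists>x. x \<in> E \<and> X i j \<in> x \<and> Y i j \<in> u x" by (auto simp: P_def)
    then obtain y' where y': "\<And>i j. y' i j \<in> E \<and> X i j \<in> y' i j \<and> Y i j \<in> u (y' i j)" by metis
    define y :: "'a lp_elem ^ 'm ^ 'm" where "y = (\<chi> i j. y' i j)"
    have y: "y \<in> mat_over E" "X i j \<in> y $ i $ j" "Y i j \<in> mat_map u y $ i $ j" for i j
      using y' by (auto simp: y_def mat_over_def mat_map_def)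
    show "(\<lambda>k. mat_trace \<tau> (oprod (alt_word (2 * m) (id_blinfun + (\<Sum>i\<in>UNIV. \<Sum>j\<in>UNIV. munit i j (X i j k)))))
       - mat_trace \<sigma> (oprod (alt_word (2 * m) (id_blinfun + (\<Sum>i\<in>UNIV. \<Sum>j\<in>UNIV. munit i j (Y i j k)))))) \<longlonglongrightarrow> 0"
      using tendsto_diff[OF M.mat_lp_norm_one_add_limit(1)[OF entries(1)[OF y(1)] y(2)]
          N.mat_lp_norm_one_add_limit(1)[OF entries(2)[OF y(1)] y(3)]] assms(9)[OF y(1)] assms(2)
      by simp
  qed
  then have agree: "moments_agree TYPE('n) (2 * m)"
    using moments_agree_all_sizes assms(1) by blast
  have "\<forall>i j. \<exists>X. X \<in> x $ i $ j" "\<forall>i j. \<exists>Y. Y \<in> mat_map u x $ i $ j"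
    using entries[OF assms(10)] M.Lp_nonempty N.Lp_nonempty by auto
  then obtain X Y where X: "\<And>i j. X i j \<in> x $ i $ j" and Y: "\<And>i j. Y i j \<in> mat_map u x $ i $ j" by metis
  have XY: "(X i j, Y i j) \<in> P" for i j
    using X[of i j] Y[of i j] assms(10) by (auto simp: P_def mat_over_def mat_map_def)
  let ?r = "mat_lp_norm M \<tau> p (mat_lp_add M \<tau> p (mat_lp_one M \<tau> p) x)"
  let ?s = "mat_lp_norm N \<sigma> p (mat_lp_add N \<sigma> p (mat_lp_one N \<sigma> p) (mat_map u x))"
  note limM = M.mat_lp_norm_one_add_limit[OF entries(1)[OF assms(10)] X, folded assms(2)]
  note limN = N.mat_lp_norm_one_add_limit[OF entries(2)[OF assms(10)] Y, folded assms(2)]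
  have "(\<lambda>k. mat_trace \<tau> (oprod (alt_word p (id_blinfun + (\<Sum>i\<in>UNIV. \<Sum>j\<in>UNIV. munit i j (X i j k)))))
       - mat_trace \<sigma> (oprod (alt_word p (id_blinfun + (\<Sum>i\<in>UNIV. \<Sum>j\<in>UNIV. munit i j (Y i j k)))))) \<longlonglongrightarrow> 0"
    using agree XY unfolding moments_agree_def assms(2) by blast
  from LIMSEQ_unique[OF this tendsto_diff[OF limM(1) limN(1)]]
  have "complex_of_real (?r ^ p) = complex_of_real (?s ^ p)" by simp
  then have "?r ^ p = ?s ^ p" by (simp only: of_real_eq_iff)
  then show ?thesis
    using power_eq_imp_eq_base[of ?r p ?s] limM(2) limN(2) m assms(2) by simp
qed

end
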